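(* Let $(W,S)$ be a Coxeter system, and for $s,t\in S$ let $m(s,t)\in\{1,2,3,\ldots\}\cup\{\infty\}$ denote the order of $st$ in $W$. Suppose that (0) for each $s,t\in S$ such that $m(s,t)$ is even, $m(s,t)=2$; (1) for each $s\neq t\in S$ such that $m(s,t)$ is odd, $\{s,t\}$ is a maximal spherical subset of $S$; (2) there does not exist a three-point subset $\{s,t,u\}\subset S$ such that $m(s,t)$ and $m(t,u)$ are odd; and (3) for each $s\neq t\in S$ such that $m(s,t)$ is odd, the number of maximal spherical subsets of $S$ intersecting $\{s,t\}$ (i.e. having non-empty intersection with $\{s,t\}$) is at most two. Then the Coxeter group $W$ is rigid.
   Context: A Coxeter system $(W,S)$ consists of a group $W$ and a finite generating set $S$ such that $W$ has the presentation $\langle S\mid (st)^{m(s,t)}=1 \text{ for } s,t\in S\rangle$, where $m:S\times S\to\mathbb{N}\cup\{\infty\}$ satisfies $m(s,t)=m(t,s)$, $m(s,s)=1$, and $m(s,t)\ge 2$ for $s\ne t$ (no relation is imposed when $m(s,t)=\infty$; the value $\infty$ is neither even nor odd). Then $m(s,t)$ is the order of $st$ in $W$. For $T\subset S$, $W_T$ is the subgroup of $W$ generated by $T$ (trivial if $T=\emptyset$); $T$ is called spherical if $W_T$ is finite, and a maximal spherical subset is a spherical subset that is maximal with respect to inclusion. Two Coxeter systems $(W,S)$ and $(W',S')$ are isomorphic if there is a bijection $\psi:S\to S'$ with $m(s,t)=m'(\psi(s),\psi(t))$ for all $s,t\in S$, where $m'(s',t')$ is the order of $s't'$ in $W'$.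 A Coxeter generating set for $W$ is a generating set $S'$ of $W$ such that $(W,S')$ is a Coxeter system. A Coxeter group $W$ is rigid if for any Coxeter generating sets $S$ and $S'$ for $W$ the Coxeter systems $(W,S)$ and $(W,S')$ are isomorphic. *)

theory Defs
  imports "HOL-Algebra.Algebra" "HOL-Library.Extended_Nat"
begin

section \<open>Group presentations\<close>

text \<open>A letter \<open>(x, True)\<close> stands for the generator \<open>x\<close>, a letter \<open>(x, False)\<close> for its formal
  inverse.\<close>

definition words :: "'a set \<Rightarrow> ('a \<times> bool) list set" where
  "words S = lists (S \<times> UNIV)"

fun eval_letter :: "('a, 'b) monoid_scheme \<Rightarrow> 'a \<times> bool \<Rightarrow> 'a" where
  "eval_letter G (x, b) = (if b then x else inv\<^bsub>G\<^esub> x)"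

definition eval_word :: "('a, 'b) monoid_scheme \<Rightarrow> ('a \<times> bool) list \<Rightarrow> 'a" where
  "eval_word G w = foldr (\<lambda>l g. eval_letter G l \<otimes>\<^bsub>G\<^esub> g) w \<one>\<^bsub>G\<^esub>"

text \<open>Equality of words in the abstract group \<open>\<langle>S | r = 1 for r \<in> R\<rangle>\<close>: the equivalence relation
  generated by inserting or deleting a cancelling pair of letters or a relator.\<close>

inductive word_eq :: "'a set \<Rightarrow> ('a \<times> bool) list set \<Rightarrow> ('a \<times> bool) list \<Rightarrow> ('a \<times> bool) list \<Rightarrow> bool"
  for S R where
  refl: "w \<in> words S \<Longrightarrow> word_eq S R w w"
| sym: "word_eq S R v w \<Longrightarrow> word_eq S R w v"
| trans: "word_eq S R u v \<Longrightarrow> word_eq S R v w \<Longrightarrow> word_eq S R u w"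
| cancel: "u \<in> words S \<Longrightarrow> v \<in> words S \<Longrightarrow> x \<in> S \<Longrightarrow>
    word_eq S R (u @ [(x, b), (x, \<not> b)] @ v) (u @ v)"
| relator: "u \<in> words S \<Longrightarrow> v \<in> words S \<Longrightarrow> r \<in> R \<Longrightarrow> word_eq S R (u @ r @ v) (u @ v)"

definition has_presentation ::
    "('a, 'b) monoid_scheme \<Rightarrow> 'a set \<Rightarrow> ('a \<times> bool) list set \<Rightarrow> bool" where
  "has_presentation G S R \<longleftrightarrow>
     group G \<and> S \<subseteq> carrier G \<and> R \<subseteq> words S \<and> generate G S = carrier G \<and>
     (\<forall>v\<in>words S. \<forall>w\<in>words S. eval_word G v = eval_word G w \<longleftrightarrow> word_eq S R v w)"

section \<open>Coxeter systems\<close>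

definition coxeter_matrix :: "'a set \<Rightarrow> ('a \<Rightarrow> 'a \<Rightarrow> enat) \<Rightarrow> bool" where
  "coxeter_matrix S m \<longleftrightarrow>
     (\<forall>s\<in>S. \<forall>t\<in>S. m s t = m t s) \<and> (\<forall>s\<in>S. m s s = 1) \<and>
     (\<forall>s\<in>S. \<forall>t\<in>S. s \<noteq> t \<longrightarrow> m s t \<ge> 2)"

definition coxeter_relators :: "'a set \<Rightarrow> ('a \<Rightarrow> 'a \<Rightarrow> enat) \<Rightarrow> ('a \<times> bool) list set" where
  "coxeter_relators S m =
     {concat (replicate k [(s, True), (t, True)]) | s t k. s \<in> S \<and> t \<in> S \<and> m s t = enat k}"

definition coxeter_system :: "('a, 'b) monoid_scheme \<Rightarrow> 'a set \<Rightarrow> bool" where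
  "coxeter_system W S \<longleftrightarrow>
     finite S \<and> (\<exists>m. coxeter_matrix S m \<and> has_presentation W S (coxeter_relators S m))"

text \<open>The order of \<open>s t\<close> in \<open>W\<close>. The library's \<open>group.ord\<close> is \<open>0\<close> for elements of infinite order;
  here the value is \<open>\<infinity>\<close>, which is neither even nor odd.\<close>

definition cox_order :: "('a, 'b) monoid_scheme \<Rightarrow> 'a \<Rightarrow> 'a \<Rightarrow> enat" where
  "cox_order W s t =
     (if group.ord W (s \<otimes>\<^bsub>W\<^esub> t) = 0 then \<infinity> else enat (group.ord W (s \<otimes>\<^bsub>W\<^esub> t)))"

definition even_enat :: "enat \<Rightarrow> bool" where
  "even_enat n \<longleftrightarrow> (\<exists>k. n = enat k \<and> even k)"

definition odd_enat :: "enat \<Rightarrow> bool" where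
  "odd_enat n \<longleftrightarrow> (\<exists>k. n = enat k \<and> odd k)"

definition spherical :: "('a, 'b) monoid_scheme \<Rightarrow> 'a set \<Rightarrow> 'a set \<Rightarrow> bool" where
  "spherical W S T \<longleftrightarrow> T \<subseteq> S \<and> finite (generate W T)"

definition maximal_spherical :: "('a, 'b) monoid_scheme \<Rightarrow> 'a set \<Rightarrow> 'a set \<Rightarrow> bool" where
  "maximal_spherical W S T \<longleftrightarrow>
     spherical W S T \<and> (\<forall>T'. spherical W S T' \<and> T \<subseteq> T' \<longrightarrow> T' = T)"

definition coxeter_systems_isomorphic ::
    "('a, 'b) monoid_scheme \<Rightarrow> 'a set \<Rightarrow> ('c, 'd) monoid_scheme \<Rightarrow> 'c set \<Rightarrow> bool" where
  "coxeter_systems_isomorphic W S W' S' \<longleftrightarrow>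
     (\<exists>\<psi>. bij_betw \<psi> S S' \<and> (\<forall>s\<in>S. \<forall>t\<in>S. cox_order W s t = cox_order W' (\<psi> s) (\<psi> t)))"

definition rigid :: "('a, 'b) monoid_scheme \<Rightarrow> bool" where
  "rigid W \<longleftrightarrow>
     (\<forall>S S'. coxeter_system W S \<and> coxeter_system W S' \<longrightarrow> coxeter_systems_isomorphic W S W S')"

end

theory Submission
  imports Defs Complex_Main
begin

text \<open>
  Draw a graph on \<open>S\<close> with an edge of label \<open>m(s,t)\<close> between \<open>s \<noteq> t\<close> whenever this is finite. By
  \<open>even2\<close> and \<open>odd_max\<close> every spherical subset is either an odd edge or a set of pairwise commuting
  generators; by \<open>no_adjacent_odd\<close> the odd edges are pairwise disjoint; by \<open>at_most_two\<close> one end of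
  every odd edge is a leaf, attached to the rest of the graph only through the other end, the
  \<^emph>\<open>core\<close> of the edge. So the graph is determined by its \<^emph>\<open>components\<close> (odd edges and remaining single vertices), by the labels of the
  odd edges, and by the knowledge of which components meet which maximal spherical subsets. The
  proof recovers these data from the group alone.

  The maximal spherical subsets are visible in \<open>W\<close>: every finite subgroup is conjugate into some
  \<open>W\<^sub>T\<close> with \<open>T\<close> spherical (\<open>finite_subgroup_conjugate_into_spherical\<close>), and for maximal spherical
  \<open>T\<close>, \<open>U\<close> a conjugate of \<open>W\<^sub>U\<close> contains \<open>W\<^sub>T\<close> only if \<open>T = U\<close>
  (\<open>maximal_spherical_conjugate_eq\<close>). Hence for two Coxeter generating sets of one group there is a
  bijection \<open>\<phi>\<close> between their maximal spherical subsets with \<open>W\<^sub>T\<close> conjugate to the subgroup of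
  \<open>\<phi> T\<close> (\<open>maxsph_bijection\<close>). Both facts are general. They rest on the geometric representation on
  \<open>\<real>\<^sup>S\<close> and on Tits' theorem that \<open>w\<close> sends a simple root to a nonnegative or a nonpositive vector
  according to whether the length goes up or down (\<open>ascent_imp_positive\<close>): a finite group fixes the
  average of an orbit of linear functionals, and such an average can be moved into the fundamental
  chamber, where stabilisers are generated by simple reflections.

  The components are visible in the homomorphisms from \<open>W\<close> to \<open>\<int>/2\<close>. Such a homomorphism is the same
  as a set of components, and it kills \<open>W\<^sub>T\<close> iff no component in the set meets \<open>T\<close>. Killing is
  invariant under conjugation, so for each family of maximal spherical subsets the number of
  components disjoint from all of them agrees for both generating sets
  (\<open>card_vanishing_characters\<close>). By inclusion and exclusion there is a bijection \<open>\<beta>\<close> between the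
  components such that \<open>\<beta> b\<close> meets \<open>\<phi> T\<close> iff \<open>b\<close> meets \<open>T\<close> (\<open>component_bijection\<close>).

  With \<open>\<phi>\<close> and \<open>\<beta>\<close> at hand, the four conditions on \<open>S\<close> pass from one Coxeter generating set to any
  other (\<open>isolated_odd_coxeter_transfer\<close>, \<open>leaf_odd_coxeter_transfer\<close>), and the isomorphism is \<open>\<beta>\<close> on
  components, chosen to send cores to cores (\<open>leaf_odd_coxeter_isomorphic\<close>).
\<close>

section \<open>Coxeter groups and their actions\<close>

text \<open>The matrix \<open>m\<close> of the presentation is a parameter of its own: that it consists of the actual
  orders of the products \<open>s t\<close> is a theorem (\<open>cox_order_eq\<close> below), which needs the geometric
  representation.\<close>

locale coxeter = group W for W :: "('a, 'b) monoid_scheme" (structure) +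
  fixes S :: "'a set" and m :: "'a \<Rightarrow> 'a \<Rightarrow> enat"
  assumes finite_S: "finite S"
    and matrix: "coxeter_matrix S m"
    and presentation: "has_presentation W S (coxeter_relators S m)"
begin

lemma S_closed: "S \<subseteq> carrier W"
  using presentation by (simp add: has_presentation_def)

lemma S_closed' [simp, intro]: "s \<in> S \<Longrightarrow> s \<in> carrier W"
  using S_closed by blast

lemma m_sym: "s \<in> S \<Longrightarrow> t \<in> S \<Longrightarrow> m s t = m t s"
  using matrix by (simp add: coxeter_matrix_def)

lemma m_diag: "s \<in> S \<Longrightarrow> m s s = 1"
  using matrix by (simp add: coxeter_matrix_def)

lemma m_ge_2: "s \<in> S \<Longrightarrow> t \<in> S \<Longrightarrow> s \<noteq> t \<Longrightarrow> m s t \<ge> 2"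
  using matrix by (simp add: coxeter_matrix_def)

definition wprod :: "'a list \<Rightarrow> 'a" where
  "wprod xs = foldr (\<otimes>) xs \<one>"

lemma wprod_simps [simp]: "wprod [] = \<one>" "wprod (x # xs) = x \<otimes> wprod xs"
  by (simp_all add: wprod_def)

lemma wprod_closed [simp, intro]: "set xs \<subseteq> S \<Longrightarrow> wprod xs \<in> carrier W"
  by (induction xs) auto

lemma wprod_append:
  "set xs \<subseteq> S \<Longrightarrow> set ys \<subseteq> S \<Longrightarrow> wprod (xs @ ys) = wprod xs \<otimes> wprod ys"
  by (induction xs) (auto simp: m_assoc)

lemma eval_word_positive: "eval_word W (map (\<lambda>x. (x, True)) xs) = wprod xs"
  by (induction xs) (auto simp: eval_word_def wprod_def)

lemma eval_word_eqI: "word_eq S (coxeter_relators S m) v w \<Longrightarrow> v \<in> words S \<Longrightarrow> w \<in> words S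
    \<Longrightarrow> eval_word W v = eval_word W w"
  using presentation by (simp add: has_presentation_def)

lemma generator_square: assumes "s \<in> S" shows "s \<otimes> s = \<one>"
proof -
  have r: "[(s, True), (s, True)] \<in> coxeter_relators S m"
    unfolding coxeter_relators_def using assms m_diag[OF assms]
    by (auto intro!: exI[of _ s] exI[of _ "1::nat"] simp: one_enat_def)
  have "word_eq S (coxeter_relators S m) ([] @ [(s, True), (s, True)] @ []) ([] @ [])"
    by (rule word_eq.relator) (auto simp: words_def r)
  from eval_word_eqI[OF this] show ?thesis
    using assms by (simp add: words_def eval_word_def)
qed

lemma generator_inv [simp]: "s \<in> S \<Longrightarrow> inv s = s"
  by (rule inv_equality) (auto simp: generator_square)

lemma cancel_left: "s \<in> S \<Longrightarrow> w \<in> carrier W \<Longrightarrow> s \<otimes> (s \<otimes> w) = w"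
  by (metis S_closed' generator_square l_one m_assoc)

lemma cancel_right: "s \<in> S \<Longrightarrow> w \<in> carrier W \<Longrightarrow> w \<otimes> s \<otimes> s = w"
  by (metis S_closed' generator_square m_assoc r_one)

lemma coxeter_relation:
  assumes "s \<in> S" "t \<in> S" "m s t = enat k" shows "(s \<otimes> t) [^] k = \<one>"
proof -
  have r: "concat (replicate k [(s, True), (t, True)]) \<in> coxeter_relators S m"
    unfolding coxeter_relators_def using assms by blast
  have w: "concat (replicate k [(s, True), (t, True)]) \<in> words S" for k
    by (induction k) (auto simp: words_def assms)
  have "word_eq S (coxeter_relators S m)
      ([] @ concat (replicate k [(s, True), (t, True)]) @ []) ([] @ [])"
    by (rule word_eq.relator) (auto simp: words_def r)
  from eval_word_eqI[OF this] have "eval_word W (concat (replicate k [(s, True), (t, True)])) = \<one>"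
    using w by (simp add: words_def eval_word_def)
  moreover have "eval_word W (concat (replicate k [(s, True), (t, True)])) = (s \<otimes> t) [^] k" for k
  proof (induction k)
    case (Suc k)
    have "(s \<otimes> t) [^] Suc k = s \<otimes> (t \<otimes> (s \<otimes> t) [^] k)"
      using assms by (subst nat_pow_Suc2) (auto simp: m_assoc)
    then show ?case using Suc by (simp add: eval_word_def del: nat_pow_Suc)
  qed (simp add: eval_word_def)
  ultimately show ?thesis by simp
qed

lemma generate_eq_wprod:
  assumes "T \<subseteq> S" shows "generate W T = wprod ` lists T"
proof
  show "generate W T \<subseteq> wprod ` lists T"
  proof
    fix x assume "x \<in> generate W T"
    then show "x \<in> wprod ` lists T"
    proof induction
      case one show ?case by (auto intro!: image_eqI[of _ _ "[]"])
    next
      case (incl h)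
      then show ?case using assms by (auto intro!: image_eqI[of _ _ "[h]"])
    next
      case (inv h)
      then have "h \<in> S" using assms by auto
      then show ?case using inv by (auto intro!: image_eqI[of _ _ "[h]"])
    next
      case (eng h1 h2)
      then obtain xs ys where "xs \<in> lists T" "ys \<in> lists T" "h1 = wprod xs" "h2 = wprod ys" by auto
      moreover from this have "wprod (xs @ ys) = wprod xs \<otimes> wprod ys"
        using assms by (intro wprod_append) auto
      ultimately show ?case by (intro image_eqI[of _ _ "xs @ ys"]) auto
    qed
  qed
next
  show "wprod ` lists T \<subseteq> generate W T"
  proof safe
    fix xs assume "\<forall>x\<in>set xs. x \<in> T"
    then show "wprod xs \<in> generate W T"
      by (induction xs) (auto intro: generate.intros)
  qed
qed

lemma generate_S: "generate W S = carrier W"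
  using presentation by (simp add: has_presentation_def)

lemma wprod_surj: "w \<in> carrier W \<Longrightarrow> \<exists>xs. set xs \<subseteq> S \<and> wprod xs = w"
  using generate_eq_wprod[of S] generate_S by auto

text \<open>The universal property of the presentation, in the form of actions: maps \<open>F s\<close> on an
  arbitrary type that satisfy the Coxeter relations extend to an action of \<open>W\<close>. It will be used for
  the sign character, the geometric representation and the characters of order two. The word chosen
  in the definition of \<open>act\<close> is immaterial by \<open>foldr_wprod_eq\<close>.\<close>

definition satisfies_relations :: "('a \<Rightarrow> 'x \<Rightarrow> 'x) \<Rightarrow> bool" where
  "satisfies_relations F \<longleftrightarrow> (\<forall>s\<in>S. F s \<circ> F s = id) \<and>
     (\<forall>s\<in>S. \<forall>t\<in>S. \<forall>k. m s t = enat k \<longrightarrow> (F s \<circ> F t) ^^ k = id)"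

definition act :: "('a \<Rightarrow> 'x \<Rightarrow> 'x) \<Rightarrow> 'a \<Rightarrow> 'x \<Rightarrow> 'x" where
  "act F w = foldr F (SOME xs. set xs \<subseteq> S \<and> wprod xs = w)"

lemma foldr_word_eq:
  assumes F: "satisfies_relations F" and eq: "word_eq S (coxeter_relators S m) v w"
  shows "foldr F (map fst v) = foldr F (map fst w)"
  using eq
proof induction
  case (cancel u v x b)
  then have "F x \<circ> F x = id" using F by (simp add: satisfies_relations_def)
  then have "F x (F x z) = z" for z by (metis comp_apply id_apply)
  then show ?case by (simp add: fun_eq_iff)
next
  case (relator u v r)
  from \<open>r \<in> _\<close> obtain s t k where r: "r = concat (replicate k [(s, True), (t, True)])"
      "s \<in> S" "t \<in> S" "m s t = enat k"
    by (auto simp: coxeter_relators_def)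
  have "foldr F (map fst (concat (replicate k [(s, True), (t, True)]))) = (F s \<circ> F t) ^^ k" for k
    by (induction k) (auto simp: fun_eq_iff)
  then have "foldr F (map fst r) = id" using r F by (simp add: satisfies_relations_def)
  then show ?case by (simp add: fun_eq_iff)
qed auto

lemma foldr_wprod_eq:
  assumes F: "satisfies_relations F" and xs: "set xs \<subseteq> S" "set ys \<subseteq> S" "wprod xs = wprod ys"
  shows "foldr F xs = foldr F ys"
proof -
  let ?p = "map (\<lambda>x. (x, True))"
  have "?p xs \<in> words S" "?p ys \<in> words S" using xs by (auto simp: words_def)
  moreover have "eval_word W (?p xs) = eval_word W (?p ys)"
    using xs by (simp add: eval_word_positive)
  ultimately have "word_eq S (coxeter_relators S m) (?p xs) (?p ys)"
    using presentation by (simp add: has_presentation_def)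
  from foldr_word_eq[OF F this] show ?thesis by (simp add: comp_def)
qed

lemma act_wprod:
  assumes F: "satisfies_relations F" and xs: "set xs \<subseteq> S"
  shows "act F (wprod xs) = foldr F xs"
proof -
  let ?P = "\<lambda>ys. set ys \<subseteq> S \<and> wprod ys = wprod xs"
  have "?P xs" using xs by simp
  then have "?P (SOME ys. ?P ys)" by (rule someI[where P = ?P])
  then show ?thesis unfolding act_def using foldr_wprod_eq[OF F _ xs] by blast
qed

lemma act_mult:
  assumes F: "satisfies_relations F" and "v \<in> carrier W" "w \<in> carrier W"
  shows "act F (v \<otimes> w) z = act F v (act F w z)"
proof -
  obtain xs ys where "set xs \<subseteq> S" "wprod xs = v" "set ys \<subseteq> S" "wprod ys = w"
    using wprod_surj assms by metis
  then show ?thesis using act_wprod[OF F, of xs] act_wprod[OF F, of ys] act_wprod[OF F, of "xs @ ys"]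
    by (auto simp: wprod_append)
qed

lemma act_one: "satisfies_relations F \<Longrightarrow> act F \<one> z = z"
  using act_wprod[of F "[]"] by simp

lemma act_generator: "satisfies_relations F \<Longrightarrow> s \<in> S \<Longrightarrow> act F s = F s"
  using act_wprod[of F "[s]"] by (auto simp: fun_eq_iff)

lemma act_inv_cancel:
  assumes F: "satisfies_relations F" and "w \<in> carrier W"
  shows "act F w (act F (inv w) z) = z" "act F (inv w) (act F w z) = z"
  using assms by (metis act_mult act_one inv_closed r_inv, metis act_mult act_one inv_closed l_inv)

lemma generator_induct [consumes 1, case_names one mult]:
  assumes "w \<in> carrier W" "P \<one>" "\<And>w s. w \<in> carrier W \<Longrightarrow> s \<in> S \<Longrightarrow> P w \<Longrightarrow> P (s \<otimes> w)"
  shows "P w"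
proof -
  obtain xs where xs: "set xs \<subseteq> S" "wprod xs = w" using wprod_surj assms(1) by metis
  have "set xs \<subseteq> S \<Longrightarrow> P (wprod xs)"
    by (induction xs) (use assms(2,3) in auto)
  then show ?thesis using xs by simp
qed

definition wlen :: "'a \<Rightarrow> nat" where
  "wlen w = (LEAST n. \<exists>xs. set xs \<subseteq> S \<and> wprod xs = w \<and> length xs = n)"

lemma wlen_le: "set xs \<subseteq> S \<Longrightarrow> wlen (wprod xs) \<le> length xs"
  unfolding wlen_def by (rule Least_le) auto

lemma reduced_word: assumes "w \<in> carrier W"
  obtains xs where "set xs \<subseteq> S" "wprod xs = w" "length xs = wlen w"
proof -
  from wprod_surj[OF assms] have "\<exists>n xs. set xs \<subseteq> S \<and> wprod xs = w \<and> length xs = n" by auto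
  then have "\<exists>xs. set xs \<subseteq> S \<and> wprod xs = w \<and> length xs = wlen w"
    unfolding wlen_def by (rule LeastI_ex)
  with that show thesis by blast
qed

lemma wlen_mult_le:
  assumes "v \<in> carrier W" "w \<in> carrier W" shows "wlen (v \<otimes> w) \<le> wlen v + wlen w"
proof -
  obtain xs where xs: "set xs \<subseteq> S" "wprod xs = v" "length xs = wlen v" using reduced_word assms(1) .
  obtain ys where ys: "set ys \<subseteq> S" "wprod ys = w" "length ys = wlen w" using reduced_word assms(2) .
  show ?thesis using wlen_le[of "xs @ ys"] xs ys by (auto simp: wprod_append)
qed

lemma wlen_generator_le: "s \<in> S \<Longrightarrow> wlen s \<le> 1"
  using wlen_le[of "[s]"] by simp

lemma wlen_one [simp]: "wlen \<one> = 0"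
  using wlen_le[of "[]"] by simp

lemma parity_action: "satisfies_relations (\<lambda>s. Not)"
proof -
  have "(Not \<circ> Not) ^^ k = id" for k
    by (induction k) (auto simp: fun_eq_iff)
  then show ?thesis by (auto simp: satisfies_relations_def fun_eq_iff)
qed

lemma wlen_parity: "w \<in> carrier W \<Longrightarrow> act (\<lambda>s. Not) w True = even (wlen w)"
proof -
  assume "w \<in> carrier W"
  then obtain xs where xs: "set xs \<subseteq> S" "wprod xs = w" "length xs = wlen w" by (rule reduced_word)
  have "foldr (\<lambda>s. Not) xs True = even (length xs)" by (induction xs) auto
  then show ?thesis using act_wprod[OF parity_action xs(1)] xs by auto
qed

text \<open>The length changes by at most one, and it does change because the sign character is the parity
  of the length.\<close>

lemma wlen_mult_generator:
  assumes "w \<in> carrier W" "s \<in> S"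
  shows "wlen (w \<otimes> s) = wlen w + 1 \<or> wlen w = wlen (w \<otimes> s) + 1"
proof -
  have s: "s \<in> carrier W" using assms by auto
  have "wlen (w \<otimes> s) \<le> wlen w + 1"
    using wlen_mult_le[OF assms(1) s] wlen_generator_le[OF assms(2)] by linarith
  moreover have "wlen w \<le> wlen (w \<otimes> s) + 1"
    using wlen_mult_le[of "w \<otimes> s" s] wlen_generator_le[OF assms(2)] cancel_right[of s w] assms
    by auto
  moreover have "even (wlen (w \<otimes> s)) \<noteq> even (wlen w)"
  proof -
    have "act (\<lambda>s. Not) s True = False" using act_generator[OF parity_action assms(2)] by simp
    moreover have "act (\<lambda>s. Not) w False = (\<not> act (\<lambda>s. Not) w True)" if "w \<in> carrier W" for w
      using that
    proof (induction w rule: generator_induct)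
      case one then show ?case by (simp add: act_one[OF parity_action])
    next
      case (mult w s) then show ?case
        by (simp add: act_mult[OF parity_action] act_generator[OF parity_action])
    qed
    ultimately show ?thesis using assms
      by (metis act_mult[OF parity_action] wlen_parity m_closed s)
  qed
  ultimately show ?thesis by presburger
qed

lemma right_descent:
  assumes "w \<in> carrier W" "w \<noteq> \<one>" obtains s where "s \<in> S" "wlen w = wlen (w \<otimes> s) + 1"
proof -
  obtain xs where xs: "set xs \<subseteq> S" "wprod xs = w" "length xs = wlen w" using reduced_word assms(1) .
  then have "xs \<noteq> []" using assms by auto
  then obtain ys s where ys: "xs = ys @ [s]" by (meson rev_exhaust)
  then have s: "s \<in> S" "set ys \<subseteq> S" using xs by auto
  then have "w \<otimes> s = wprod ys" using xs ys wprod_append[of ys "[s]"]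
    by (auto simp: cancel_right)
  then have "wlen (w \<otimes> s) \<le> wlen w - 1" using wlen_le[OF s(2)] xs ys by auto
  then have "wlen w = wlen (w \<otimes> s) + 1" using wlen_mult_generator[OF assms(1) s(1)] xs ys by auto
  with s that show thesis by blast
qed

end

section \<open>The geometric representation\<close>

text \<open>Up to an index shift these are the Chebyshev polynomials of the second kind in \<open>c / 2\<close>. They
  are the coordinates of the roots in a rank two subsystem, where \<open>c = 2 cos (\<pi> / m)\<close>, or \<open>c = 2\<close> if
  \<open>m = \<infinity>\<close>.\<close>

fun cheb :: "real \<Rightarrow> nat \<Rightarrow> real" where
  "cheb c 0 = 0"
| "cheb c (Suc 0) = 1"
| "cheb c (Suc (Suc n)) = c * cheb c (Suc n) - cheb c n"

lemma cheb_cos: "cheb (2 * cos \<theta>) n * sin \<theta> = sin (real n * \<theta>)"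
proof (induction "2 * cos \<theta>" n rule: cheb.induct)
  case (3 n)
  have "sin (real (Suc (Suc n)) * \<theta>) + sin (real n * \<theta>) = 2 * cos \<theta> * sin (real (Suc n) * \<theta>)"
  proof -
    have "real (Suc (Suc n)) * \<theta> = real (Suc n) * \<theta> + \<theta>" "real n * \<theta> = real (Suc n) * \<theta> - \<theta>"
      by (simp_all add: algebra_simps)
    then show ?thesis by (simp only: sin_add sin_diff) (simp add: algebra_simps)
  qed
  with 3 show ?case by (simp add: algebra_simps)
qed auto

lemma cheb_two: "cheb 2 n = real n"
  by (induction "2::real" n rule: cheb.induct) auto

definition linear_map :: "(('a \<Rightarrow> real) \<Rightarrow> ('a \<Rightarrow> real)) \<Rightarrow> bool" where
  "linear_map f \<longleftrightarrow>
     (\<forall>a b x y. f (\<lambda>u. a * x u + b * y u) = (\<lambda>u. a * f x u + b * f y u))"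

lemma linear_mapD: "linear_map f \<Longrightarrow> f (\<lambda>u. a * x u + b * y u) = (\<lambda>u. a * f x u + b * f y u)"
  by (simp add: linear_map_def)

lemma linear_map_funpow: "linear_map f \<Longrightarrow> linear_map (f ^^ n)"
  by (induction n) (auto simp: linear_map_def)

text \<open>Vectors of \<open>\<real>\<^sup>S\<close> are functions; only their values on \<open>S\<close> matter.\<close>

definition simple :: "'a \<Rightarrow> 'a \<Rightarrow> real" where
  "simple s = (\<lambda>u. if u = s then 1 else 0)"

definition combo :: "real \<Rightarrow> 'a \<Rightarrow> real \<Rightarrow> 'a \<Rightarrow> 'a \<Rightarrow> real" where
  "combo p a q b = (\<lambda>u. p * simple a u + q * simple b u)"

lemma combo_commute: "combo p a q b = combo q b p a"
  by (auto simp: combo_def)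

context coxeter
begin

text \<open>The bilinear form is normalised so that simple roots have square length two; on the
  diagonal, \<open>- 2 cos (\<pi> / 1) = 2\<close> is consistent with that.\<close>

definition cartan :: "'a \<Rightarrow> 'a \<Rightarrow> real" where
  "cartan s t = (case m s t of enat k \<Rightarrow> - 2 * cos (pi / real k) | \<infinity> \<Rightarrow> - 2)"

definition form :: "('a \<Rightarrow> real) \<Rightarrow> ('a \<Rightarrow> real) \<Rightarrow> real" where
  "form x y = (\<Sum>u\<in>S. \<Sum>v\<in>S. cartan u v * x u * y v)"

definition reflect :: "'a \<Rightarrow> ('a \<Rightarrow> real) \<Rightarrow> 'a \<Rightarrow> real" where
  "reflect s x = (\<lambda>u. x u - form (simple s) x * simple s u)"

lemma cartan_diag: "s \<in> S \<Longrightarrow> cartan s s = 2"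
  by (simp add: cartan_def m_diag one_enat_def)

lemma cartan_sym: "s \<in> S \<Longrightarrow> t \<in> S \<Longrightarrow> cartan s t = cartan t s"
  by (simp add: cartan_def m_sym)

lemma form_sym: "form x y = form y x"
proof -
  have "form x y = (\<Sum>v\<in>S. \<Sum>u\<in>S. cartan u v * x u * y v)"
    unfolding form_def by (rule sum.swap)
  also have "\<dots> = form y x"
    unfolding form_def by (intro sum.cong HOL.refl) (use cartan_sym in auto)
  finally show ?thesis .
qed

lemma form_linear_right: "form x (\<lambda>u. a * y u + b * z u) = a * form x y + b * form x z"
  by (simp add: form_def algebra_simps sum.distrib sum_distrib_left)

lemma form_linear_left: "form (\<lambda>u. a * y u + b * z u) x = a * form y x + b * form z x"
  by (simp add: form_def algebra_simps sum.distrib sum_distrib_left)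

lemma form_simple_left: "s \<in> S \<Longrightarrow> form (simple s) x = (\<Sum>v\<in>S. cartan s v * x v)"
  unfolding form_def simple_def
  by (subst sum.remove[OF finite_S]) (auto intro!: sum.neutral)

lemma form_simple: "s \<in> S \<Longrightarrow> t \<in> S \<Longrightarrow> form (simple s) (simple t) = cartan s t"
  by (subst form_simple_left) (auto simp: simple_def finite_S if_distrib cong: if_cong)

lemma reflect_alt: "reflect s x = (\<lambda>u. 1 * x u + (- form (simple s) x) * simple s u)"
  by (simp add: reflect_def)

lemma form_reflect: "s \<in> S \<Longrightarrow> form (simple s) (reflect s x) = - form (simple s) x"
  unfolding reflect_alt form_linear_right by (simp add: form_simple cartan_diag)

lemma reflect_reflect: "s \<in> S \<Longrightarrow> reflect s (reflect s x) = x"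
  unfolding reflect_def[of s "reflect s x"] by (simp add: form_reflect) (simp add: reflect_def)

lemma linear_reflect: "linear_map (reflect s)"
  by (simp add: linear_map_def reflect_def form_linear_right algebra_simps)

lemma form_reflect_invariant:
  assumes "s \<in> S" shows "form (reflect s x) (reflect s y) = form x y"
proof -
  have l: "form (reflect s x) z = form x z - form (simple s) x * form (simple s) z" for z
    using form_linear_left[of 1 x "- form (simple s) x" "simple s" z] by (simp add: reflect_alt)
  have r: "form z (reflect s y) = form z y - form (simple s) y * form z (simple s)" for z
    using form_linear_right[of z 1 y "- form (simple s) y" "simple s"] by (simp add: reflect_alt)
  show ?thesis
    using assms by (simp add: l form_reflect r form_sym[of x] form_simple cartan_diag algebra_simps)
qed

lemma reflect_combo_left:
  assumes "a \<in> S" "b \<in> S"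
  shows "reflect a (combo p a q b) = combo (- cartan a b * q - p) a q b"
  unfolding reflect_alt combo_def form_linear_right
  using assms by (auto simp: form_simple cartan_diag algebra_simps)

lemma reflect_simple: "a \<in> S \<Longrightarrow> reflect a (simple a) = (\<lambda>u. - simple a u)"
  by (simp add: reflect_def form_simple cartan_diag)

lemma reflect_combo_cheb:
  assumes "a \<in> S" "b \<in> S" and c: "c = - cartan a b"
  shows "reflect a (combo (cheb c k) a (cheb c (Suc k)) b) =
         combo (cheb c (Suc (Suc k))) a (cheb c (Suc k)) b"
  using assms by (simp add: reflect_combo_left)

lemma rotation_simple:
  assumes "a \<in> S" "b \<in> S" and c: "c = - cartan a b"
  shows "((reflect a \<circ> reflect b) ^^ j) (simple a) = combo (cheb c (2 * j + 1)) a (cheb c (2 * j)) b"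
proof (induction j)
  case 0 show ?case by (simp add: combo_def)
next
  case (Suc j)
  have c': "c = - cartan b a" using assms cartan_sym by simp
  have "reflect b (combo (cheb c (2 * j + 1)) a (cheb c (2 * j)) b) =
      combo (cheb c (2 * j + 2)) b (cheb c (2 * j + 1)) a"
    using reflect_combo_cheb[OF assms(2,1) c', of "2 * j"] by (simp add: combo_commute)
  moreover have "reflect a (combo (cheb c (2 * j + 2)) b (cheb c (2 * j + 1)) a) =
      combo (cheb c (2 * j + 3)) a (cheb c (2 * j + 2)) b"
    using reflect_combo_cheb[OF assms, of "2 * j + 1"]
    by (simp add: combo_commute numeral_3_eq_3)
  ultimately show ?case using Suc by (simp add: numeral_3_eq_3)
qed

lemma cartan_finite:
  "m a b = enat k \<Longrightarrow> - cartan a b = 2 * cos (pi / real k)"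
  by (simp add: cartan_def)

lemma cartan_infinite: "m a b = \<infinity> \<Longrightarrow> - cartan a b = 2"
  by (simp add: cartan_def)

lemma finite_label_ge_2: "a \<in> S \<Longrightarrow> b \<in> S \<Longrightarrow> a \<noteq> b \<Longrightarrow> m a b = enat k \<Longrightarrow> 2 \<le> k"
  using m_ge_2[of a b] by (simp add: numeral_eq_enat)

lemma sin_pi_div_pos: "2 \<le> k \<Longrightarrow> sin (pi / real k) > 0"
  by (intro sin_gt_zero) (auto simp: field_simps)

lemma cheb_label:
  assumes "a \<in> S" "b \<in> S" "a \<noteq> b" "m a b = enat k"
  shows "cheb (- cartan a b) n = sin (real n * (pi / real k)) / sin (pi / real k)"
  using cheb_cos[of "pi / real k" n] sin_pi_div_pos[OF finite_label_ge_2[OF assms]]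
  by (simp add: cartan_finite[OF assms(4)] field_simps)

lemma rotation_fixes_simple:
  assumes "a \<in> S" "b \<in> S" "a \<noteq> b" "m a b = enat k"
  shows "((reflect a \<circ> reflect b) ^^ k) (simple a) = simple a"
proof -
  have k: "2 \<le> k" using finite_label_ge_2[OF assms] .
  have "real (2 * k) * (pi / real k) = 2 * pi" "real (2 * k + 1) * (pi / real k) = 2 * pi + pi / real k"
    using k by (simp_all add: field_simps)
  then have "cheb (- cartan a b) (2 * k) = 0" "cheb (- cartan a b) (2 * k + 1) = 1"
    using cheb_label[OF assms, of "2 * k"] cheb_label[OF assms, of "2 * k + 1"]
      sin_pi_div_pos[OF k] by (simp_all only: sin_add sin_two_pi cos_two_pi) simp_all
  then show ?thesis using rotation_simple[OF assms(1,2) HOL.refl, of k] by (simp add: combo_def)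
qed

lemma rotation_inverse:
  assumes "a \<in> S" "b \<in> S"
  shows "((reflect a \<circ> reflect b) ^^ n) (((reflect b \<circ> reflect a) ^^ n) x) = x"
proof (induction n arbitrary: x)
  case (Suc n)
  have "((reflect a \<circ> reflect b) ^^ Suc n) (((reflect b \<circ> reflect a) ^^ Suc n) x) =
     ((reflect a \<circ> reflect b) ^^ n) (reflect a (reflect b (reflect b (reflect a (((reflect b \<circ> reflect a) ^^ n) x)))))"
    using funpow_swap1[of "reflect a \<circ> reflect b" n] by simp
  then show ?case using Suc assms by (simp only: reflect_reflect)
qed simp

text \<open>The order of a product of two simple reflections. For finite \<open>m\<close> the form is nondegenerate on
  the plane of the two simple roots, so every vector is the sum of a vector of the plane, on which
  the product is a rotation by \<open>2 \<pi> / m\<close>, and a vector orthogonal to it, which is fixed.\<close>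

lemma rotation_order:
  assumes ab: "a \<in> S" "b \<in> S" "a \<noteq> b" and k: "m a b = enat k"
  shows "((reflect a \<circ> reflect b) ^^ k) x = x"
proof -
  let ?r = "(reflect a \<circ> reflect b) ^^ k"
  have k': "m b a = enat k" using k m_sym ab by simp
  have ra: "?r (simple a) = simple a" by (rule rotation_fixes_simple[OF assms])
  have rb: "?r (simple b) = simple b"
    using rotation_fixes_simple[OF ab(2,1) ab(3)[symmetric] k'] rotation_inverse[OF ab(1,2), of k "simple b"]
    by simp
  let ?g = "cartan a b" and ?A = "form (simple a) x" and ?B = "form (simple b) x"
  have "sin (pi / real k) ^ 2 > 0" using sin_pi_div_pos[OF finite_label_ge_2[OF assms]] by simp
  then have "4 - ?g\<^sup>2 > 0"
    using cartan_finite[OF k] by (simp add: sin_squared_eq power_mult_distrib power2_minus[of "cartan a b", symmetric] del: power2_minus)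
  then have d: "4 - ?g\<^sup>2 \<noteq> 0" by simp
  \<comment> \<open>The coefficients of the orthogonal projection of \<open>x\<close> to the plane, by Cramer's rule.\<close>
  define p where "p = (2 * ?A - ?g * ?B) / (4 - ?g\<^sup>2)"
  define q where "q = (2 * ?B - ?g * ?A) / (4 - ?g\<^sup>2)"
  have pq: "2 * p + ?g * q = ?A" "?g * p + 2 * q = ?B"
  proof -
    have "2 * p + ?g * q = (?A * (4 - ?g\<^sup>2)) / (4 - ?g\<^sup>2)"
      "?g * p + 2 * q = (?B * (4 - ?g\<^sup>2)) / (4 - ?g\<^sup>2)"
      unfolding p_def q_def times_divide_eq_right add_divide_distrib[symmetric]
      by (simp_all add: algebra_simps power2_eq_square)
    then show "2 * p + ?g * q = ?A" "?g * p + 2 * q = ?B" using d by simp_all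
  qed
  define y where "y = (\<lambda>u. 1 * x u + (-1) * combo p a q b u)"
  have "form (simple a) y = 0" "form (simple b) y = 0"
    unfolding y_def combo_def form_linear_right
    using pq ab by (simp_all add: form_simple cartan_diag cartan_sym[of b a] algebra_simps)
  then have "reflect a y = y" "reflect b y = y" by (simp_all add: reflect_def)
  then have ry: "?r y = y" by (induction k) auto
  have lin: "linear_map ?r"
    by (intro linear_map_funpow) (use linear_reflect in \<open>auto simp: linear_map_def\<close>)
  have x: "x = (\<lambda>u. 1 * y u + 1 * combo p a q b u)" by (simp add: y_def)
  have "?r (combo p a q b) = combo p a q b"
    unfolding combo_def linear_mapD[OF lin] ra rb ..
  then show ?thesis by (subst (1 2) x) (simp only: linear_mapD[OF lin] ry)
qed

lemma reflect_satisfies_relations: "satisfies_relations reflect"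
  unfolding satisfies_relations_def
proof (intro conjI ballI allI impI)
  fix s assume "s \<in> S" then show "reflect s \<circ> reflect s = id" by (auto simp: reflect_reflect)
next
  fix s t k assume st: "s \<in> S" "t \<in> S" "m s t = enat k"
  show "(reflect s \<circ> reflect t) ^^ k = id"
  proof (cases "s = t")
    case True
    then have "k = 1" using st m_diag[of s] by (simp add: one_enat_def)
    with True st show ?thesis by (auto simp: reflect_reflect)
  next
    case False
    with rotation_order[OF st(1,2) False st(3)] show ?thesis by (auto simp: fun_eq_iff)
  qed
qed

abbreviation geo :: "'a \<Rightarrow> ('a \<Rightarrow> real) \<Rightarrow> 'a \<Rightarrow> real" where
  "geo \<equiv> act reflect"

lemmas geo_mult = act_mult[OF reflect_satisfies_relations]
lemmas geo_one = act_one[OF reflect_satisfies_relations]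
lemmas geo_generator = act_generator[OF reflect_satisfies_relations]
lemmas geo_inv_cancel = act_inv_cancel[OF reflect_satisfies_relations]

lemma linear_geo: "w \<in> carrier W \<Longrightarrow> linear_map (geo w)"
proof (induction w rule: generator_induct)
  case (mult w s)
  then show ?case using linear_reflect[of s] by (auto simp: linear_map_def geo_mult geo_generator)
qed (auto simp: linear_map_def geo_one)

lemma geo_combo:
  "w \<in> carrier W \<Longrightarrow> geo w (combo p a q b) = (\<lambda>u. p * geo w (simple a) u + q * geo w (simple b) u)"
  using linear_mapD[OF linear_geo] by (simp add: combo_def)

lemma geo_uminus: "w \<in> carrier W \<Longrightarrow> geo w (\<lambda>u. - x u) = (\<lambda>u. - geo w x u)"
  using linear_mapD[OF linear_geo, of w "-1" x 0 x] by simp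

lemma geo_pow:
  "s \<in> S \<Longrightarrow> t \<in> S \<Longrightarrow> geo ((s \<otimes> t) [^] (n::nat)) = (reflect s \<circ> reflect t) ^^ n"
proof (induction n)
  case (Suc n)
  then show ?case by (simp add: fun_eq_iff geo_mult geo_generator funpow_Suc_right del: funpow.simps)
qed (simp add: fun_eq_iff geo_one)

text \<open>Already the image of the simple root \<open>s\<close> under \<open>(s t)\<^sup>n\<close> shows that no power of \<open>s t\<close> is trivial
  unless the presentation forces it to be.\<close>

lemma pow_eq_one_iff:
  assumes st: "s \<in> S" "t \<in> S"
  shows "(s \<otimes> t) [^] (n::nat) = \<one> \<longleftrightarrow> (case m s t of enat k \<Rightarrow> k dvd n | \<infinity> \<Rightarrow> n = 0)"
proof (cases "s = t")
  case True
  then show ?thesis using st by (simp add: m_diag one_enat_def generator_square)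
next
  case ne: False
  have fix0: "cheb (- cartan s t) (2 * n) = 0 \<and> cheb (- cartan s t) (2 * n + 1) = 1"
    if "(s \<otimes> t) [^] n = \<one>" for n :: nat
  proof -
    have "simple s = combo (cheb (- cartan s t) (2 * n + 1)) s (cheb (- cartan s t) (2 * n)) t"
      using geo_pow[OF st, of n] that rotation_simple[OF st HOL.refl, of n] geo_one[of "simple s"]
      by simp
    from fun_cong[OF this, of s] fun_cong[OF this, of t] show ?thesis
      using ne by (simp add: combo_def simple_def)
  qed
  show ?thesis
  proof (cases "m s t")
    case infinity
    then show ?thesis using fix0[of n] by (auto simp: cartan_infinite cheb_two)
  next
    case (enat k)
    note k = finite_label_ge_2[OF st ne enat]
    have rel: "(s \<otimes> t) [^] k = \<one>" using coxeter_relation[OF st enat] .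
    have "(s \<otimes> t) [^] (k * (n div k) + n mod k) = (s \<otimes> t) [^] (n mod k)"
      using st rel by (subst nat_pow_mult[symmetric]) (auto simp: nat_pow_pow[symmetric])
    then have red: "(s \<otimes> t) [^] n = (s \<otimes> t) [^] (n mod k)" by simp
    have "n mod k = 0" if "(s \<otimes> t) [^] n = \<one>"
    proof (rule ccontr)
      assume pos: "n mod k \<noteq> 0"
      define r \<phi> where "r = n mod k" and "\<phi> = real r * (pi / real k)"
      have r: "0 < r" "r < k" using pos k by (auto simp: r_def)
      \<comment> \<open>\<open>(s t)\<^sup>r\<close> with \<open>0 < r < k\<close> is a rotation by \<open>2 \<phi>\<close>, which is not a multiple of \<open>2 \<pi>\<close>.\<close>
      have phi: "0 < \<phi>" "\<phi> < pi" using r by (auto simp: \<phi>_def field_simps)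
      have c: "cheb (- cartan s t) (2 * r) = 0" "cheb (- cartan s t) (2 * r + 1) = 1"
        using fix0[of r] that red by (auto simp: r_def)
      have "real (2 * r) * (pi / real k) = 2 * \<phi>"
        "real (2 * r + 1) * (pi / real k) = 2 * \<phi> + pi / real k"
        by (simp_all add: \<phi>_def algebra_simps add_divide_distrib)
      then have "sin (2 * \<phi>) = 0" "sin (2 * \<phi> + pi / real k) = sin (pi / real k)"
        using c cheb_label[OF st ne enat, of "2 * r"] cheb_label[OF st ne enat, of "2 * r + 1"]
          sin_pi_div_pos[OF k] by (simp_all del: of_nat_add of_nat_mult)
      then have "sin \<phi> * cos \<phi> = 0" "cos (2 * \<phi>) = 1"
        using sin_pi_div_pos[OF k] by (auto simp: sin_double sin_add)
      then show False using sin_gt_zero[OF phi] by (auto simp: cos_double_sin)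
    qed
    moreover have "(s \<otimes> t) [^] n = \<one>" if "n mod k = 0"
      using red that by simp
    ultimately show ?thesis using enat by (auto simp: mod_eq_0_iff_dvd)
  qed
qed

lemma cox_order_eq: assumes st: "s \<in> S" "t \<in> S" shows "cox_order W s t = m s t"
proof -
  have c: "s \<otimes> t \<in> carrier W" using st by auto
  have o: "ord (s \<otimes> t) dvd n \<longleftrightarrow> (case m s t of enat k \<Rightarrow> k dvd n | \<infinity> \<Rightarrow> n = 0)" for n
    using pow_eq_one_iff[OF st, of n] pow_eq_id[OF c, of n] by simp
  show ?thesis
  proof (cases "m s t")
    case infinity
    then show ?thesis using o[of "ord (s \<otimes> t)"] by (simp add: cox_order_def)
  next
    case (enat k)
    then have "ord (s \<otimes> t) = k" using o[of k] o[of "ord (s \<otimes> t)"] by (auto intro: dvd_antisym)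
    moreover have "k \<noteq> 0" using enat finite_label_ge_2[OF st _ enat] m_diag[OF st(1)]
      by (cases "s = t") (auto simp: one_enat_def)
    ultimately show ?thesis using enat by (simp add: cox_order_def)
  qed
qed

section \<open>Signs of roots\<close>

text \<open>The alternating product with \<open>n\<close> factors that ends in \<open>b a\<close>. Building it at the right end is
  what both the recursion of \<open>cheb\<close> and the search for descents need.\<close>

fun alt :: "nat \<Rightarrow> 'a \<Rightarrow> 'a \<Rightarrow> 'a" where
  "alt 0 a b = \<one>"
| "alt (Suc n) a b = alt n b a \<otimes> a"

lemma alt_closed [simp]: "a \<in> S \<Longrightarrow> b \<in> S \<Longrightarrow> alt n a b \<in> carrier W"
  by (induction n a b rule: alt.induct) auto

lemma wlen_alt_le: "a \<in> S \<Longrightarrow> b \<in> S \<Longrightarrow> wlen (alt n a b) \<le> n"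
proof (induction n a b rule: alt.induct)
  case (2 n a b)
  then show ?case using wlen_mult_generator[of "alt n b a" a] by auto
qed simp

lemma alt_add:
  "a \<in> S \<Longrightarrow> b \<in> S \<Longrightarrow> alt (i + j) a b = (if even j then alt i a b else alt i b a) \<otimes> alt j a b"
  by (induction j arbitrary: a b) (auto simp: m_assoc)

lemma alt_double: "a \<in> S \<Longrightarrow> b \<in> S \<Longrightarrow> alt (2 * k) a b = (b \<otimes> a) [^] k"
  by (induction k) (auto simp: m_assoc)

lemma wlen_inv_le: assumes "w \<in> carrier W" shows "wlen (inv w) \<le> wlen w"
proof -
  have "inv (wprod xs) = wprod (rev xs)" if "set xs \<subseteq> S" for xs
    using that by (induction xs) (auto simp: inv_mult_group wprod_append)
  then show ?thesis using reduced_word[OF assms] wlen_le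
    by (metis length_rev set_rev)
qed

text \<open>If \<open>m(a,b) = k\<close>, an alternating product of \<open>k + 1\<close> factors equals one of \<open>k - 1\<close> factors, so
  reduced alternating products have at most \<open>k\<close> factors.\<close>

lemma wlen_alt_bound:
  assumes ab: "a \<in> S" "b \<in> S" "a \<noteq> b" and k: "m a b = enat k" and n: "wlen (alt n a b) = n"
  shows "n \<le> k"
proof (rule ccontr)
  assume "\<not> n \<le> k"
  then obtain i where i: "n = i + (k + 1)" using le_Suc_ex[of "k + 1" n] by (auto simp: add.commute)
  have k2: "2 \<le> k" using finite_label_ge_2[OF ab k] .
  have "alt (2 * k) a b = \<one>"
    using alt_double[of a b k] ab coxeter_relation[of b a k] m_sym[of a b] k by simp
  moreover have "2 * k = (k - 1) + (k + 1)" using k2 by simp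
  ultimately obtain c d where cd: "c \<in> S" "d \<in> S" "alt (k - 1) c d \<otimes> alt (k + 1) a b = \<one>"
    using alt_add[OF ab(1,2), of "k - 1" "k + 1"] ab by (auto simp del: alt.simps split: if_splits)
  then have "alt (k + 1) a b = inv (alt (k - 1) c d)"
    using ab by (metis alt_closed inv_equality inv_inv)
  then have short: "wlen (alt (k + 1) a b) \<le> k - 1"
    using wlen_inv_le[of "alt (k - 1) c d"] wlen_alt_le[OF cd(1,2), of "k - 1"] cd by auto
  obtain c d where cd: "c \<in> S" "d \<in> S" "alt n a b = alt i c d \<otimes> alt (k + 1) a b"
    using alt_add[OF ab(1,2), of i "k + 1"] ab i by (auto simp del: alt.simps split: if_splits)
  then have "wlen (alt n a b) \<le> i + (k - 1)"
    using wlen_mult_le[of "alt i c d" "alt (k + 1) a b"] wlen_alt_le[OF cd(1,2), of i] short ab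
    by (auto simp del: alt.simps)
  then show False using n i k2 by linarith
qed

lemma geo_alt_combo:
  assumes "a \<in> S" "b \<in> S" and c: "c = - cartan a b"
  shows "\<exists>p q. {p, q} \<subseteq> {cheb c (k + n), cheb c (Suc (k + n))} \<and>
           geo (alt n a b) (combo (cheb c k) a (cheb c (Suc k)) b) = combo p a q b"
  using assms
proof (induction n arbitrary: a b k)
  case 0 then show ?case by (auto simp: geo_one)
next
  case (Suc n)
  have "geo (alt (Suc n) a b) (combo (cheb c k) a (cheb c (Suc k)) b) =
      geo (alt n b a) (combo (cheb c (Suc k)) b (cheb c (Suc (Suc k))) a)"
    using Suc.prems reflect_combo_cheb[OF Suc.prems, of k]
    by (simp add: geo_mult geo_generator combo_commute[of _ b])
  moreover have "c = - cartan b a" using Suc.prems cartan_sym by simp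
  moreover from this obtain p q where
      "{p, q} \<subseteq> {cheb c (Suc k + n), cheb c (Suc (Suc k + n))}"
      "geo (alt n b a) (combo (cheb c (Suc k)) b (cheb c (Suc (Suc k))) a) = combo p b q a"
    using Suc.IH[of b a "Suc k"] Suc.prems by blast
  ultimately show ?case
    by (intro exI[of _ q] exI[of _ p]) (auto simp: combo_commute[of p] simp del: cheb.simps)
qed

text \<open>Strip letters \<open>a\<close> and \<open>b\<close> off the right end of \<open>w\<close> as long as the length decreases. What remains
  is the shortest element of the coset of \<open>w\<close> modulo the dihedral group of \<open>a\<close> and \<open>b\<close>.\<close>

lemma alt_decomposition:
  assumes "w \<in> carrier W" "a \<in> S" "b \<in> S" "wlen (w \<otimes> b) = wlen w + 1"
  shows "\<exists>n v. v \<in> carrier W \<and> w = v \<otimes> alt n a b \<and> wlen w = wlen v + n \<and>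
           wlen (v \<otimes> a) = wlen v + 1 \<and> wlen (v \<otimes> b) = wlen v + 1"
  using assms
proof (induction "wlen w" arbitrary: w a b rule: less_induct)
  case less
  show ?case
  proof (cases "wlen (w \<otimes> a) = wlen w + 1")
    case True
    then show ?thesis using less.prems by (intro exI[of _ 0] exI[of _ w]) auto
  next
    case False
    then have d: "wlen w = wlen (w \<otimes> a) + 1" using wlen_mult_generator[of w a] less.prems by auto
    moreover have "w \<otimes> a \<otimes> a = w" using less.prems by (simp add: cancel_right)
    ultimately obtain n v where nv: "v \<in> carrier W" "w \<otimes> a = v \<otimes> alt n b a"
        "wlen (w \<otimes> a) = wlen v + n" "wlen (v \<otimes> a) = wlen v + 1" "wlen (v \<otimes> b) = wlen v + 1"
      using less.hyps[of "w \<otimes> a" b a] less.prems by auto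
    have "w = v \<otimes> alt (Suc n) a b"
      using nv \<open>w \<otimes> a \<otimes> a = w\<close> less.prems by (metis S_closed' alt.simps(2) alt_closed m_assoc)
    then show ?thesis using nv d by (intro exI[of _ "Suc n"] exI[of _ v]) auto
  qed
qed

abbreviation nonneg :: "('a \<Rightarrow> real) \<Rightarrow> bool" where
  "nonneg x \<equiv> \<forall>u. 0 \<le> x u"

text \<open>Induction on the length. Take a descent \<open>t\<close> of \<open>w\<close> and write \<open>w = v a\<close> with \<open>v\<close> shortest in the
  coset of the dihedral group of \<open>s\<close> and \<open>t\<close>. The alternating product \<open>a\<close> followed by \<open>s\<close> is still
  reduced, so \<open>a\<close> sends the simple root \<open>s\<close> to a combination of the two simple roots whose
  coefficients are values \<open>sin (j \<pi> / m) / sin (\<pi> / m)\<close> with \<open>j \<le> m\<close>, hence nonnegative; and \<open>v\<close>,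
  which is shorter than \<open>w\<close>, keeps both simple roots nonnegative by induction.\<close>

theorem ascent_imp_positive:
  assumes "w \<in> carrier W" "s \<in> S" "wlen (w \<otimes> s) = wlen w + 1"
  shows "nonneg (geo w (simple s))"
  using assms
proof (induction "wlen w" arbitrary: w s rule: less_induct)
  case less
  show ?case
  proof (cases "w = \<one>")
    case True then show ?thesis by (simp add: geo_one simple_def)
  next
    case False
    obtain t where t: "t \<in> S" "wlen w = wlen (w \<otimes> t) + 1" using right_descent[OF less.prems(1) False] .
    then have ts: "t \<noteq> s" using less.prems by auto
    obtain n v where nv: "v \<in> carrier W" "w = v \<otimes> alt n t s" "wlen w = wlen v + n"
        "wlen (v \<otimes> t) = wlen v + 1" "wlen (v \<otimes> s) = wlen v + 1"
      using alt_decomposition[OF less.prems(1) t(1) less.prems(2,3)] by blast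
    have "n \<noteq> 0" using nv t less.prems by (intro notI) auto
    then have "wlen v < wlen w" using nv by simp
    then have pos: "nonneg (geo v (simple t))" "nonneg (geo v (simple s))"
      using less.hyps nv t less.prems by auto
    have "w \<otimes> s = v \<otimes> alt (Suc n) s t" using nv t less.prems by (simp add: m_assoc)
    then have "Suc n \<le> wlen (alt (Suc n) s t)"
      using wlen_mult_le[of v "alt (Suc n) s t"] nv t less.prems by (auto simp del: alt.simps)
    then have red: "wlen (alt (Suc n) s t) = Suc n"
      using wlen_alt_le[of s t "Suc n"] t less.prems by auto
    have nn: "0 \<le> cheb (- cartan t s) j" if "j \<le> Suc n" for j
    proof (cases "m t s")
      case infinity
      then show ?thesis by (simp add: cartan_infinite cheb_two)
    next
      case (enat k)
      then have "Suc n \<le> k" using wlen_alt_bound[of s t k "Suc n"] red t less.prems ts m_sym by auto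
      then have "sin (real j * (pi / real k)) \<ge> 0"
        using that by (intro sin_ge_zero) (auto simp: field_simps)
      then show ?thesis using cheb_label[OF t(1) less.prems(2) ts enat, of j]
          sin_pi_div_pos[OF finite_label_ge_2[OF t(1) less.prems(2) ts enat]] by simp
    qed
    obtain p q where pq: "{p, q} \<subseteq> {cheb (- cartan t s) n, cheb (- cartan t s) (Suc n)}"
        "geo (alt n t s) (combo 0 t 1 s) = combo p t q s"
      using geo_alt_combo[OF t(1) less.prems(2) HOL.refl, of 0 n] by auto
    then have "0 \<le> p" "0 \<le> q" using nn by auto
    moreover have "geo w (simple s) = geo v (combo p t q s)"
      using pq(2) nv t less.prems by (simp add: geo_mult combo_def)
    ultimately show ?thesis using pos by (simp add: geo_combo[OF nv(1)])
  qed
qed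

section \<open>Chambers\<close>

text \<open>Linear functionals that depend only on the coordinates in \<open>S\<close>. They are the points of the dual
  space, on which \<open>W\<close> acts by \<open>L \<mapsto> L \<circ> geo (inv w)\<close>; a functional that is nonnegative on the simple
  roots is a point of the closed fundamental chamber.\<close>

definition functional :: "(('a \<Rightarrow> real) \<Rightarrow> real) \<Rightarrow> bool" where
  "functional L \<longleftrightarrow> (\<forall>x. L x = (\<Sum>u\<in>S. L (simple u) * x u))"

lemma functional_eval: "functional L \<Longrightarrow> L x = (\<Sum>u\<in>S. L (simple u) * x u)"
  unfolding functional_def by blast

lemma functional_linear:
  assumes "functional L" shows "L (\<lambda>u. a * x u + b * y u) = a * L x + b * L y"
proof -
  have "L (\<lambda>u. a * x u + b * y u) = (\<Sum>u\<in>S. L (simple u) * (a * x u + b * y u))"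
    by (rule functional_eval[OF assms])
  also have "\<dots> = a * (\<Sum>u\<in>S. L (simple u) * x u) + b * (\<Sum>u\<in>S. L (simple u) * y u)"
    by (simp add: algebra_simps sum.distrib sum_distrib_left)
  also have "\<dots> = a * L x + b * L y"
    by (simp only: functional_eval[OF assms, symmetric])
  finally show ?thesis .
qed

lemma functional_uminus: "functional L \<Longrightarrow> L (\<lambda>u. - x u) = - L x"
  using functional_linear[of L "-1" x 0 x] by simp

lemma functional_reflect:
  "functional L \<Longrightarrow> L (reflect s x) = L x - form (simple s) x * L (simple s)"
  using functional_linear[of L 1 x "- form (simple s) x" "simple s"] by (simp add: reflect_alt)

lemma functional_comp_reflect:
  assumes L: "functional L" and s: "s \<in> S" shows "functional (\<lambda>x. L (reflect s x))"
  unfolding functional_def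
proof
  fix x
  have "(\<Sum>u\<in>S. L (reflect s (simple u)) * x u) =
      (\<Sum>u\<in>S. L (simple u) * x u - cartan s u * x u * L (simple s))"
    using s by (intro sum.cong HOL.refl) (simp add: functional_reflect[OF L] form_simple algebra_simps)
  also have "\<dots> = (\<Sum>u\<in>S. L (simple u) * x u) - form (simple s) x * L (simple s)"
    using s by (simp add: sum_subtractf form_simple_left sum_distrib_right)
  also have "(\<Sum>u\<in>S. L (simple u) * x u) = L x"
    by (simp only: functional_eval[OF L, symmetric])
  finally show "L (reflect s x) = (\<Sum>u\<in>S. L (reflect s (simple u)) * x u)"
    by (simp add: functional_reflect[OF L])
qed

lemma functional_comp_geo:
  assumes "w \<in> carrier W" "functional L" shows "functional (\<lambda>x. L (geo w x))"
  using assms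
proof (induction w arbitrary: L rule: generator_induct)
  case (mult w s)
  then show ?case using functional_comp_reflect[of L s] by (simp add: geo_mult geo_generator)
qed (simp add: geo_one)

lemma functional_nonneg:
  "functional L \<Longrightarrow> (\<And>u. u \<in> S \<Longrightarrow> 0 \<le> L (simple u)) \<Longrightarrow> nonneg x \<Longrightarrow> 0 \<le> L x"
  by (subst functional_eval) (auto intro!: sum_nonneg)

text \<open>The root system of the subgroup generated by \<open>T\<close>.\<close>

definition roots :: "'a set \<Rightarrow> ('a \<Rightarrow> real) set" where
  "roots T = {geo w (simple s) | w s. w \<in> generate W T \<and> s \<in> T}"

definition pos_roots :: "('a \<Rightarrow> real) set" where
  "pos_roots = {x \<in> roots S. nonneg x}"

lemma generate_closed: "T \<subseteq> S \<Longrightarrow> w \<in> generate W T \<Longrightarrow> w \<in> carrier W"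
  using generate_in_carrier[of T w] S_closed by blast

lemma rootsE:
  assumes "x \<in> roots S" obtains w s where "w \<in> carrier W" "s \<in> S" "x = geo w (simple s)"
  using assms generate_S by (auto simp: roots_def)

lemma rootsI: "w \<in> carrier W \<Longrightarrow> s \<in> S \<Longrightarrow> geo w (simple s) \<in> roots S"
  using generate_S by (auto simp: roots_def)

lemma roots_mono: "T \<subseteq> S \<Longrightarrow> roots T \<subseteq> roots S"
  using mono_generate[of T S] by (auto simp: roots_def)

lemma form_geo:
  "w \<in> carrier W \<Longrightarrow> form (geo w x) (geo w y) = form x y"
proof (induction w rule: generator_induct)
  case (mult w s)
  then show ?case by (simp add: geo_mult geo_generator form_reflect_invariant)
qed (simp add: geo_one)

lemma form_root: "x \<in> roots S \<Longrightarrow> form x x = 2"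
  by (elim rootsE) (simp add: form_geo form_simple cartan_diag)

lemma root_geo: "x \<in> roots S \<Longrightarrow> w \<in> carrier W \<Longrightarrow> geo w x \<in> roots S"
  by (elim rootsE) (auto simp: geo_mult[symmetric] intro!: rootsI)

lemma geo_times_generator:
  assumes "w \<in> carrier W" "s \<in> S"
  shows "geo (w \<otimes> s) (simple s) = (\<lambda>u. - geo w (simple s) u)"
  using assms by (simp add: geo_mult geo_generator reflect_simple geo_uminus)

lemma descent_imp_negative:
  assumes "w \<in> carrier W" "s \<in> S" "wlen w = wlen (w \<otimes> s) + 1"
  shows "nonneg (\<lambda>u. - geo w (simple s) u)"
  using ascent_imp_positive[of "w \<otimes> s" s] assms
  by (simp add: geo_times_generator cancel_right)

lemma root_sign: assumes "x \<in> roots S" shows "nonneg x \<or> nonneg (\<lambda>u. - x u)"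
proof -
  obtain w s where "w \<in> carrier W" "s \<in> S" "x = geo w (simple s)" using assms by (rule rootsE)
  then show ?thesis
    using wlen_mult_generator[of w s] ascent_imp_positive[of w s] descent_imp_negative[of w s] by blast
qed

lemma roots_uminus: assumes "T \<subseteq> S" "x \<in> roots T" shows "(\<lambda>u. - x u) \<in> roots T"
proof -
  obtain w s where x: "w \<in> generate W T" "s \<in> T" "x = geo w (simple s)"
    using assms by (auto simp: roots_def)
  then have "w \<otimes> s \<in> generate W T" by (auto intro: generate.intros)
  moreover have "(\<lambda>u. - x u) = geo (w \<otimes> s) (simple s)"
    using x assms generate_closed by (simp add: geo_times_generator subset_iff)
  ultimately show ?thesis using x by (auto simp: roots_def)
qed

lemma root_not_both: assumes "x \<in> roots S" "nonneg x" "nonneg (\<lambda>u. - x u)" shows False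
proof -
  have "x u = 0" for u using assms(2,3)[rule_format, of u] by simp
  then have "form x x = 0" by (simp add: form_def)
  then show False using form_root[OF assms(1)] by simp
qed

text \<open>All roots have the same length.\<close>

lemma proportional_pos_roots:
  assumes "x \<in> pos_roots" "y \<in> pos_roots" "\<And>u. x u = c * y u" shows "x = y"
proof -
  have xy: "x \<in> roots S" "y \<in> roots S" "nonneg x" "nonneg y" using assms by (auto simp: pos_roots_def)
  have x: "x = (\<lambda>u. c * y u + 0 * y u)" using assms(3) by auto
  have "form x x = c * c * form y y"
    by (subst (1 2) x) (simp only: form_linear_left form_linear_right, simp)
  then have "c * c = 1" using form_root xy by simp
  then have "c = 1 \<or> c = -1" by (simp add: square_eq_1_iff)
  moreover have "c \<noteq> -1"
  proof
    assume "c = -1"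
    then have "nonneg (\<lambda>u. - x u)" using assms(3) xy by simp
    then show False using root_not_both xy by blast
  qed
  ultimately show ?thesis using assms(3) by auto
qed

lemma simple_pos_root: "s \<in> S \<Longrightarrow> simple s \<in> pos_roots"
  using rootsI[OF one_closed, of s] by (auto simp: pos_roots_def geo_one) (simp add: simple_def)

text \<open>A simple reflection changes a single coordinate. If it made a positive root negative, all other
  coordinates of that root would be zero.\<close>

lemma reflect_pos_root:
  assumes x: "x \<in> pos_roots" and s: "s \<in> S" and ne: "x \<noteq> simple s"
  shows "reflect s x \<in> pos_roots"
proof (rule ccontr)
  have r: "x \<in> roots S" "nonneg x" using x by (auto simp: pos_roots_def)
  have r': "reflect s x \<in> roots S" using root_geo[OF r(1), of s] s by (simp add: geo_generator)
  assume "reflect s x \<notin> pos_roots"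
  then have neg: "nonneg (\<lambda>u. - reflect s x u)" using root_sign[OF r'] r' by (auto simp: pos_roots_def)
  have "x u = x s * simple s u" for u
  proof (cases "u = s")
    case False
    then show ?thesis using neg[rule_format, of u] r(2)[rule_format, of u]
      by (simp add: reflect_def simple_def)
  qed (simp add: simple_def)
  then show False using proportional_pos_roots[OF x simple_pos_root[OF s]] ne by blast
qed

definition inversions :: "'a \<Rightarrow> ('a \<Rightarrow> real) set" where
  "inversions w = {x \<in> pos_roots. nonneg (\<lambda>u. - geo w x u)}"

lemma finite_inversions: "w \<in> carrier W \<Longrightarrow> finite (inversions w)"
proof (induction w rule: generator_induct)
  case one
  have "inversions \<one> = {}" using root_not_both by (auto simp: inversions_def pos_roots_def geo_one)
  then show ?case by simp
next
  case (mult w s)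
  have "inversions (s \<otimes> w) \<subseteq> insert (geo (inv w) (simple s)) (inversions w)"
  proof
    fix x assume x: "x \<in> inversions (s \<otimes> w)"
    then have xr: "x \<in> pos_roots" "x \<in> roots S" by (auto simp: inversions_def pos_roots_def)
    have neg: "nonneg (\<lambda>u. - reflect s (geo w x) u)"
      using x mult by (simp add: inversions_def geo_mult geo_generator)
    have wr: "geo w x \<in> roots S" using root_geo xr mult by blast
    show "x \<in> insert (geo (inv w) (simple s)) (inversions w)"
    proof (cases "nonneg (geo w x)")
      case True
      then have "geo w x \<in> pos_roots" using wr by (simp add: pos_roots_def)
      moreover have "reflect s (geo w x) \<notin> pos_roots"
        using neg root_not_both by (auto simp: pos_roots_def)
      ultimately have "geo w x = simple s" using reflect_pos_root mult by blast
      then show ?thesis using geo_inv_cancel(2)[OF mult(1), of x] by simp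
    next
      case False
      then have "x \<in> inversions w" using root_sign[OF wr] xr(1) by (auto simp: inversions_def)
      then show ?thesis by simp
    qed
  qed
  then show ?case using mult.IH finite_subset by blast
qed

definition neg_set :: "(('a \<Rightarrow> real) \<Rightarrow> real) \<Rightarrow> ('a \<Rightarrow> real) set" where
  "neg_set L = {x \<in> pos_roots. L x < 0}"

text \<open>Reflecting in a simple root on which \<open>L\<close> is negative removes that root from the finite set of
  positive roots on which \<open>L\<close> is negative and permutes the others, so the process ends in the
  fundamental chamber.\<close>

lemma exists_dominant_translate:
  assumes "functional L" "finite (neg_set L)"
  shows "\<exists>w\<in>carrier W. \<forall>s\<in>S. 0 \<le> L (geo w (simple s))"
  using assms
proof (induction "card (neg_set L)" arbitrary: L rule: less_induct)
  case less
  show ?case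
  proof (cases "\<forall>s\<in>S. 0 \<le> L (simple s)")
    case True then show ?thesis by (intro bexI[of _ \<one>]) (auto simp: geo_one)
  next
    case False
    then obtain s where s: "s \<in> S" "L (simple s) < 0" by auto
    define L' where "L' = (\<lambda>x. L (reflect s x))"
    have L': "functional L'" using functional_comp_reflect less.prems s by (simp add: L'_def)
    have sub: "reflect s ` neg_set L' \<subseteq> neg_set L - {simple s}"
    proof
      fix y assume "y \<in> reflect s ` neg_set L'"
      then obtain x where x: "x \<in> pos_roots" "L (reflect s x) < 0" "y = reflect s x"
        by (auto simp: neg_set_def L'_def)
      then have "x \<noteq> simple s" using s less.prems(1)
        by (auto simp: reflect_simple functional_uminus)
      then have "y \<in> pos_roots" using reflect_pos_root x s by simp
      moreover have "y \<noteq> simple s"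
      proof
        assume "y = simple s"
        then have "x = (\<lambda>u. - simple s u)" using reflect_reflect[OF s(1), of x] x s by (simp add: reflect_simple)
        then have "x s = - 1" by (simp add: simple_def)
        then show False using x by (auto simp: pos_roots_def dest: spec[of _ s])
      qed
      ultimately show "y \<in> neg_set L - {simple s}" using x by (simp add: neg_set_def)
    qed
    have inj: "inj_on (reflect s) (neg_set L')"
      by (rule inj_on_inverseI[where g = "reflect s"]) (simp add: reflect_reflect s)
    have in_neg: "simple s \<in> neg_set L" using simple_pos_root s by (simp add: neg_set_def)
    have fin: "finite (neg_set L')"
      using inj sub less.prems(2) by (meson finite_Diff finite_imageD finite_subset)
    have "card (neg_set L') \<le> card (neg_set L - {simple s})"
      using card_inj_on_le[OF inj sub] less.prems by simp
    also have "\<dots> < card (neg_set L)" 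
      using in_neg less.prems(2) by (intro psubset_card_mono) auto
    finally obtain w where w: "w \<in> carrier W" "\<forall>t\<in>S. 0 \<le> L' (geo w (simple t))"
      using less.hyps[OF _ L' fin] by blast
    then show ?thesis using s
      by (intro bexI[of _ "s \<otimes> w"]) (auto simp: L'_def geo_mult geo_generator)
  qed
qed

text \<open>The closed chamber is a fundamental domain, and the stabiliser of a point in it is generated by
  the simple reflections that fix the point: if \<open>s\<close> is a descent of \<open>g\<close>, then \<open>L\<close> is both \<open>\<le> 0\<close> and
  \<open>\<ge> 0\<close> on \<open>geo g (simple s)\<close>, so \<open>s\<close> fixes \<open>L'\<close> and can be split off from \<open>g\<close>.\<close>

lemma dominant_unique:
  assumes "g \<in> carrier W" "functional L" "functional L'"
    and "\<And>s. s \<in> S \<Longrightarrow> 0 \<le> L (simple s)" "\<And>s. s \<in> S \<Longrightarrow> 0 \<le> L' (simple s)"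
    and "\<And>x. L' x = L (geo g x)"
  shows "g \<in> generate W {s \<in> S. L (simple s) = 0} \<and> (\<forall>x. L' x = L x)"
  using assms
proof (induction "wlen g" arbitrary: g rule: less_induct)
  case less
  show ?case
  proof (cases "g = \<one>")
    case True then show ?thesis using less.prems by (simp add: geo_one generate.one)
  next
    case False
    then obtain s where s: "s \<in> S" "wlen g = wlen (g \<otimes> s) + 1" using right_descent less.prems by metis
    have "0 \<le> L (\<lambda>u. - geo g (simple s) u)"
      by (rule functional_nonneg[OF less.prems(2,4) descent_imp_negative[OF less.prems(1) s]])
    then have "L' (simple s) \<le> 0" using functional_uminus[OF less.prems(2)] less.prems(6) by simp
    then have s0: "L' (simple s) = 0" using less.prems(5) s by force
    have "L' x = L (geo (g \<otimes> s) x)" for x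
    proof -
      have "L' x = L' (reflect s x)" using functional_reflect[OF less.prems(3)] s0 by simp
      then show ?thesis using less.prems s by (simp add: geo_mult geo_generator)
    qed
    then have IH: "g \<otimes> s \<in> generate W {s \<in> S. L (simple s) = 0}" "\<forall>x. L' x = L x"
      using less.hyps[of "g \<otimes> s"] less.prems s by auto
    then have "s \<in> generate W {s \<in> S. L (simple s) = 0}"
      using s s0 by (intro generate.incl) auto
    then have "g \<otimes> s \<otimes> s \<in> generate W {s \<in> S. L (simple s) = 0}"
      by (rule generate.eng[OF IH(1)])
    moreover have "g \<otimes> s \<otimes> s = g" by (rule cancel_right[OF s(1) less.prems(1)])
    ultimately show ?thesis using IH by simp
  qed
qed

text \<open>A chamber point whose stabiliser is exactly the subgroup generated by \<open>T\<close>. It turns membership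
  in this subgroup into an equation, see \<open>generate_iff_coef_off\<close>.\<close>

definition coef_off :: "'a set \<Rightarrow> ('a \<Rightarrow> real) \<Rightarrow> real" where
  "coef_off T x = (\<Sum>u\<in>S - T. x u)"

lemma coef_off_simple: "coef_off T (simple u) = (if u \<in> S - T then 1 else 0)"
  by (simp add: coef_off_def simple_def finite_S)

lemma functional_coef_off: "functional (coef_off T)"
proof -
  have "coef_off T x = (\<Sum>u\<in>S. coef_off T (simple u) * x u)" for x
    unfolding coef_off_simple
    unfolding coef_off_def using finite_S by (intro sum.mono_neutral_cong_left) auto
  then show ?thesis unfolding functional_def by blast
qed

lemma generate_invariant:
  assumes "T \<subseteq> S" "functional L" "\<And>t. t \<in> T \<Longrightarrow> L (simple t) = 0" "w \<in> generate W T"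
  shows "L (geo w x) = L x"
proof -
  obtain xs where xs: "set xs \<subseteq> T" "w = wprod xs"
    using assms(4) unfolding generate_eq_wprod[OF assms(1)] by auto
  have "set xs \<subseteq> T \<Longrightarrow> L (geo (wprod xs) x) = L x"
  proof (induction xs)
    case (Cons a xs)
    then have "a \<in> S" "wprod xs \<in> carrier W" using assms(1) by auto
    then show ?case using Cons assms by (simp add: geo_mult geo_generator functional_reflect)
  qed (simp add: geo_one)
  then show ?thesis using xs by simp
qed

lemma generate_iff_coef_off:
  assumes "T \<subseteq> S" "w \<in> carrier W"
  shows "w \<in> generate W T \<longleftrightarrow> (\<forall>x. coef_off T (geo w x) = coef_off T x)"
proof
  assume "w \<in> generate W T"
  then show "\<forall>x. coef_off T (geo w x) = coef_off T x"
    using generate_invariant[OF assms(1) functional_coef_off] by (simp add: coef_off_simple)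
next
  assume inv: "\<forall>x. coef_off T (geo w x) = coef_off T x"
  have "w \<in> generate W {s \<in> S. coef_off T (simple s) = 0} \<and> (\<forall>x. coef_off T x = coef_off T x)"
    by (rule dominant_unique[OF assms(2) functional_coef_off functional_coef_off])
       (use inv in \<open>auto simp: coef_off_simple\<close>)
  moreover have "{s \<in> S. coef_off T (simple s) = 0} = T" using assms by (auto simp: coef_off_simple)
  ultimately show "w \<in> generate W T" by simp
qed

lemma generate_is_subgroup: "T \<subseteq> S \<Longrightarrow> subgroup (generate W T) W"
  using generate_is_subgroup S_closed by blast

text \<open>The subgroup acts faithfully on its own roots: an element that fixes the simple roots of \<open>T\<close>
  has no descent in \<open>T\<close>, and by invariance of \<open>coef_off T\<close> no element of the subgroup has a descent
  outside \<open>T\<close>.\<close>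

lemma finite_roots_imp_finite:
  assumes T: "T \<subseteq> S" and fin: "finite (roots T)" shows "finite (generate W T)"
proof -
  let ?h = "\<lambda>w. \<lambda>s\<in>T. geo w (simple s)"
  have "?h ` generate W T \<subseteq> PiE T (\<lambda>_. roots T)"
    by (intro image_subsetI restrict_PiE_iff[THEN iffD2] ballI) (unfold roots_def, blast)
  moreover have "finite (PiE T (\<lambda>_. roots T))"
    using fin T finite_S by (intro finite_PiE) (auto intro: finite_subset)
  moreover have "inj_on ?h (generate W T)"
  proof (rule inj_onI)
    fix v w assume vw: "v \<in> generate W T" "w \<in> generate W T" "?h v = ?h w"
    then have c: "v \<in> carrier W" "w \<in> carrier W" using generate_closed T by auto
    define g where "g = inv v \<otimes> w"
    have g: "g \<in> generate W T" "g \<in> carrier W"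
      using vw generate_is_subgroup[OF T] c
      by (auto simp: g_def intro: subgroup.m_closed subgroup.m_inv_closed)
    have fix0: "geo g (simple s) = simple s" if "s \<in> T" for s
    proof -
      have "geo v (simple s) = geo w (simple s)" using fun_cong[OF vw(3), of s] that by simp
      then show ?thesis using c geo_inv_cancel(2)[OF c(1), of "simple s"] by (simp add: g_def geo_mult)
    qed
    have "g = \<one>"
    proof (rule ccontr)
      assume "g \<noteq> \<one>"
      then obtain s where s: "s \<in> S" "wlen g = wlen (g \<otimes> s) + 1" using right_descent g by metis
      have neg: "nonneg (\<lambda>u. - geo g (simple s) u)" using descent_imp_negative g s by blast
      then have "coef_off T (geo g (simple s)) \<le> 0" by (auto simp: coef_off_def intro!: sum_nonpos)
      then have "coef_off T (simple s) \<le> 0" using generate_iff_coef_off[OF T g(2)] g by simp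
      then have "s \<in> T" using s by (auto simp: coef_off_simple split: if_splits)
      then show False using neg[rule_format, of s] fix0[of s] by (simp add: simple_def)
    qed
    then show "v = w" using c g_def by (metis inv_closed inv_equality inv_inv)
  qed
  ultimately show ?thesis by (meson finite_imageD finite_subset)
qed

section \<open>Finite subgroups and maximal spherical subsets\<close>

text \<open>Tits' fixed point argument. The average \<open>L\<close> over \<open>F\<close> of a point of the open fundamental chamber
  is fixed by \<open>F\<close>. Any positive root on which \<open>L\<close> is not positive is made negative by some element
  of \<open>F\<close>, so there are finitely many of them. Hence \<open>L\<close> has a translate in the closed fundamental
  chamber, whose stabiliser is generated by a set \<open>T\<close> of simple reflections; and \<open>L\<close> vanishes on all
  the translated roots of \<open>T\<close>, so these are finite in number and \<open>T\<close> is spherical.\<close>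

theorem finite_subgroup_conjugate_into_spherical:
  assumes F: "subgroup F W" "finite F"
  shows "\<exists>w\<in>carrier W. \<exists>T. spherical W S T \<and> (\<forall>f\<in>F. inv w \<otimes> f \<otimes> w \<in> generate W T)"
proof -
  have Fc: "f \<in> carrier W" if "f \<in> F" for f using subgroup.mem_carrier[OF F(1) that] .
  define L where "L = (\<lambda>x. \<Sum>f\<in>F. coef_off {} (geo f x))"
  have L: "functional L"
    unfolding functional_def
  proof
    fix x
    have "L x = (\<Sum>f\<in>F. \<Sum>u\<in>S. coef_off {} (geo f (simple u)) * x u)"
      unfolding L_def
      by (intro sum.cong HOL.refl functional_eval functional_comp_geo functional_coef_off Fc)
    also have "\<dots> = (\<Sum>u\<in>S. L (simple u) * x u)"
      by (subst sum.swap) (simp add: L_def sum_distrib_right)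
    finally show "L x = (\<Sum>u\<in>S. L (simple u) * x u)" .
  qed
  have inv_L: "L (geo f x) = L x" if f: "f \<in> F" for f x
  proof -
    have "L (geo f x) = (\<Sum>h\<in>F. coef_off {} (geo (h \<otimes> f) x))"
      using f by (simp add: L_def geo_mult Fc)
    also have "\<dots> = L x" unfolding L_def
    proof (rule sum.reindex_bij_betw)
      show "bij_betw (\<lambda>h. h \<otimes> f) F F"
        by (rule bij_betw_byWitness[where f' = "\<lambda>h. h \<otimes> inv f"])
           (use F f Fc in \<open>auto simp: m_assoc intro: subgroup.m_closed subgroup.m_inv_closed\<close>)
    qed
    finally show ?thesis .
  qed
  have pos: "0 < coef_off {} x" if x: "x \<in> roots S" "nonneg x" for x
  proof -
    have "\<exists>u\<in>S. x u \<noteq> 0"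
    proof (rule ccontr)
      assume "\<not> (\<exists>u\<in>S. x u \<noteq> 0)"
      then have "form x x = 0" by (simp add: form_def)
      then show False using form_root x by simp
    qed
    then obtain u where u: "u \<in> S" "x u \<noteq> 0" by blast
    then have "0 < x u" using x(2)[rule_format, of u] by linarith
    then show ?thesis unfolding coef_off_def
      using sum_pos2[of S u x] u x(2) finite_S by simp
  qed
  have some_inverted: "x \<in> (\<Union>f\<in>F. inversions f)" if x: "x \<in> pos_roots" "L x \<le> 0" for x
  proof (rule ccontr)
    assume "x \<notin> (\<Union>f\<in>F. inversions f)"
    then have "nonneg (geo f x)" if "f \<in> F" for f
      using x root_sign[OF root_geo[of x f]] that Fc by (auto simp: inversions_def pos_roots_def)
    then have "0 < coef_off {} (geo f x)" if "f \<in> F" for f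
      using that x root_geo[of x f] Fc by (intro pos) (auto simp: pos_roots_def)
    moreover have "F \<noteq> {}" using subgroup.one_closed[OF F(1)] by auto
    ultimately have "0 < L x" unfolding L_def using F(2) by (intro sum_pos) auto
    with x show False by simp
  qed
  have finI: "finite (\<Union>f\<in>F. inversions f)" using F(2) finite_inversions Fc by auto
  have "neg_set L \<subseteq> (\<Union>f\<in>F. inversions f)"
    using some_inverted by (force simp: neg_set_def)
  then have "finite (neg_set L)" using finI finite_subset by blast
  then obtain w where w: "w \<in> carrier W" "\<forall>s\<in>S. 0 \<le> L (geo w (simple s))"
    using exists_dominant_translate[OF L] by blast
  define M where "M = (\<lambda>x. L (geo w x))"
  have M: "functional M" unfolding M_def by (rule functional_comp_geo[OF w(1) L])
  define T where "T = {s \<in> S. M (simple s) = 0}"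
  have T: "T \<subseteq> S" by (auto simp: T_def)
  have "inv w \<otimes> f \<otimes> w \<in> generate W T" if f: "f \<in> F" for f
  proof -
    have "M (geo (inv w \<otimes> f \<otimes> w) x) = M x" for x
    proof -
      have "geo w (geo (inv w \<otimes> f \<otimes> w) x) = geo f (geo w x)"
        using w(1) Fc[OF f] by (simp add: geo_mult geo_inv_cancel)
      then show ?thesis by (simp add: M_def inv_L[OF f])
    qed
    then show ?thesis
      using dominant_unique[OF _ M M, of "inv w \<otimes> f \<otimes> w"] w Fc[OF f] by (simp add: T_def M_def)
  qed
  moreover have "finite (roots T)"
  proof -
    let ?I = "\<Union>f\<in>F. inversions f"
    have "roots T \<subseteq> geo (inv w) ` (?I \<union> (\<lambda>x u. - x u) ` ?I)"
    proof
      fix x assume x: "x \<in> roots T"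
      then obtain v s where v: "v \<in> generate W T" "s \<in> T" "x = geo v (simple s)"
        by (auto simp: roots_def)
      have "M x = 0" using generate_invariant[OF T M _ v(1)] v by (simp add: T_def)
      then have L0: "L (geo w x) = 0" by (simp add: M_def)
      have r: "geo w x \<in> roots S" using x roots_mono[OF T] root_geo w by blast
      have "geo w x \<in> ?I \<union> (\<lambda>x u. - x u) ` ?I"
      proof (cases "nonneg (geo w x)")
        case True
        then show ?thesis using some_inverted[of "geo w x"] L0 r by (simp add: pos_roots_def)
      next
        case False
        then have "(\<lambda>u. - geo w x u) \<in> pos_roots"
          using root_sign[OF r] roots_uminus[OF subset_refl r] by (auto simp: pos_roots_def)
        then have "(\<lambda>u. - geo w x u) \<in> ?I"
          by (rule some_inverted) (simp add: L0 functional_uminus[OF L])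
        then have "(\<lambda>x u. - x u) (\<lambda>u. - geo w x u) \<in> (\<lambda>x u. - x u) ` ?I" by (rule imageI)
        then show ?thesis by simp
      qed
      moreover have "x = geo (inv w) (geo w x)" using geo_inv_cancel w by simp
      ultimately show "x \<in> geo (inv w) ` (?I \<union> (\<lambda>x u. - x u) ` ?I)" by blast
    qed
    then show ?thesis using finI finite_subset by blast
  qed
  then have "finite (generate W T)" using finite_roots_imp_finite[OF T] by blast
  ultimately show ?thesis using w T by (auto simp: spherical_def)
qed

lemma root_reflection:
  assumes "x \<in> roots S"
  shows "\<exists>r\<in>carrier W. \<forall>y. geo r y = (\<lambda>u. y u - form x y * x u)"
proof -
  obtain w s where w: "w \<in> carrier W" "s \<in> S" "x = geo w (simple s)" using assms by (rule rootsE)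
  have "geo (w \<otimes> s \<otimes> inv w) y = (\<lambda>u. y u - form x y * x u)" for y
  proof -
    define z where "z = geo (inv w) y"
    have z: "geo w z = y" using geo_inv_cancel w by (simp add: z_def)
    have "geo (w \<otimes> s \<otimes> inv w) y = geo w (reflect s z)"
      using w by (simp add: geo_mult geo_generator z_def)
    also have "\<dots> = (\<lambda>u. geo w z u - form (simple s) z * geo w (simple s) u)"
      using linear_mapD[OF linear_geo[OF w(1)], of 1 z "- form (simple s) z" "simple s"] by (simp add: reflect_alt)
    also have "form (simple s) z = form x y" using form_geo[OF w(1), of "simple s" z] w z by simp
    finally show ?thesis using z w by simp
  qed
  then show ?thesis using w by (intro bexI[of _ "w \<otimes> s \<otimes> inv w"]) auto
qed

text \<open>The reflection in a root that lies in the span of \<open>T\<close> fixes the point \<open>coef_off T\<close>, so it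
  belongs to the finite group generated by \<open>T\<close>; and a positive root is determined by its reflection.\<close>

lemma finite_pos_roots_in_span:
  assumes T: "T \<subseteq> S" and fin: "finite (generate W T)"
  shows "finite {x \<in> pos_roots. coef_off T x = 0}" (is "finite ?A")
proof -
  define h where "h x = (SOME r. r \<in> carrier W \<and> (\<forall>y. geo r y = (\<lambda>u. y u - form x y * x u)))" for x
  have h: "h x \<in> carrier W" "geo (h x) y = (\<lambda>u. y u - form x y * x u)" if "x \<in> pos_roots" for x y
    using someI_ex[of "\<lambda>r. r \<in> carrier W \<and> (\<forall>y. geo r y = (\<lambda>u. y u - form x y * x u))"]
      root_reflection[of x] that by (auto simp: h_def pos_roots_def)
  have "h ` ?A \<subseteq> generate W T"
  proof
    fix r assume "r \<in> h ` ?A"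
    then obtain x where x: "x \<in> pos_roots" "coef_off T x = 0" "r = h x" by auto
    have "coef_off T (geo r y) = coef_off T y" for y
      using functional_linear[OF functional_coef_off, of T 1 y "- form x y" x] h[OF x(1)] x by simp
    then show "r \<in> generate W T" using generate_iff_coef_off[OF T] h x by simp
  qed
  moreover have "inj_on h ?A"
  proof (rule inj_onI)
    fix x y assume xy: "x \<in> ?A" "y \<in> ?A" "h x = h y"
    then have pos: "x \<in> pos_roots" "y \<in> pos_roots" by auto
    have "geo (h x) x = geo (h y) x" using xy(3) by simp
    then have "(\<lambda>u. x u - form x x * x u) = (\<lambda>u. x u - form y x * y u)"
      by (simp only: h(2)[OF pos(1)] h(2)[OF pos(2)])
    moreover have "form x x = 2" using form_root xy by (simp add: pos_roots_def)
    ultimately have "x u - 2 * x u = x u - form y x * y u" for u by (metis)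
    then have "x u = form y x / 2 * y u" for u by (simp add: field_simps)
    then show "x = y" using proportional_pos_roots xy by blast
  qed
  ultimately show ?thesis using fin by (meson finite_imageD finite_subset)
qed

lemma infinite_pos_roots:
  assumes P: "P \<subseteq> S" and inf: "infinite (generate W P)"
  shows "infinite (roots P \<inter> pos_roots)"
proof
  let ?A = "roots P \<inter> pos_roots"
  assume fin: "finite ?A"
  have "roots P \<subseteq> ?A \<union> (\<lambda>x u. - x u) ` ?A"
  proof
    fix x assume x: "x \<in> roots P"
    then have r: "x \<in> roots S" using roots_mono P by blast
    show "x \<in> ?A \<union> (\<lambda>x u. - x u) ` ?A"
    proof (cases "nonneg x")
      case True then show ?thesis using x r by (simp add: pos_roots_def)
    next
      case False
      then have "(\<lambda>u. - x u) \<in> ?A"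
        using root_sign[OF r] roots_uminus[OF P x] roots_mono[OF P] by (auto simp: pos_roots_def)
      then have "(\<lambda>x u. - x u) (\<lambda>u. - x u) \<in> (\<lambda>x u. - x u) ` ?A" by (rule imageI)
      then show ?thesis by simp
    qed
  qed
  then have "finite (roots P)" using fin finite_subset by blast
  then show False using finite_roots_imp_finite P inf by blast
qed

text \<open>Let \<open>L\<close> be the translate by \<open>g\<close> of the chamber point with stabiliser \<open>W\<^sub>U\<close>. All of \<open>T\<close> fixes it, so
  it vanishes on the simple roots of \<open>T\<close>. It suffices that \<open>L\<close> lies in the closed fundamental
  chamber, for then \<open>L\<close> equals the chamber point of \<open>U\<close> and \<open>T \<subseteq> U\<close>. Suppose \<open>L\<close> is negative on the
  simple root of some \<open>s\<close>. By maximality \<open>insert s T\<close> generates an infinite group and so has infinitely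
  many positive roots. Finitely many of them lie in the span of \<open>T\<close>; on the others \<open>L\<close> is negative.
  But \<open>L\<close> is negative on finitely many positive roots only.\<close>

theorem maximal_spherical_conjugate_eq:
  assumes T: "maximal_spherical W S T" and U: "maximal_spherical W S U" and g: "g \<in> carrier W"
    and conj: "\<And>t. t \<in> T \<Longrightarrow> inv g \<otimes> t \<otimes> g \<in> generate W U"
  shows "T = U"
proof -
  have TS: "T \<subseteq> S" "finite (generate W T)" and US: "U \<subseteq> S"
    using T U by (auto simp: maximal_spherical_def spherical_def)
  define L where "L = (\<lambda>x. coef_off U (geo (inv g) x))"
  have L: "functional L" unfolding L_def
    by (rule functional_comp_geo) (use g functional_coef_off in auto)
  have LT: "L (simple t) = 0" if t: "t \<in> T" for t
  proof -
    have tS: "t \<in> S" using t TS by auto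
    define a where "a = inv g \<otimes> t \<otimes> g"
    have a: "a \<in> generate W U" "a \<in> carrier W" using conj t g tS by (auto simp: a_def)
    have "L (reflect t x) = L x" for x
    proof -
      have "geo (inv g) (reflect t x) = geo (inv g \<otimes> t) x" using g tS by (simp add: geo_mult geo_generator)
      also have "inv g \<otimes> t = a \<otimes> inv g" using g tS by (simp add: a_def m_assoc)
      finally show ?thesis using generate_iff_coef_off[OF US a(2)] a g by (simp add: L_def geo_mult)
    qed
    from this[of "simple t"] show ?thesis using tS by (simp add: reflect_simple functional_uminus[OF L])
  qed
  have "neg_set L \<subseteq> inversions (inv g)"
  proof
    fix x assume x: "x \<in> neg_set L"
    then have "\<not> nonneg (geo (inv g) x)"
      using sum_nonneg[of "S - U" "geo (inv g) x"] by (auto simp: neg_set_def L_def coef_off_def)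
    then show "x \<in> inversions (inv g)"
      using x root_sign[OF root_geo[of x "inv g"]] g by (auto simp: neg_set_def inversions_def pos_roots_def)
  qed
  then have fin_neg: "finite (neg_set L)" using finite_inversions g finite_subset inv_closed by metis
  have dom: "0 \<le> L (simple s)" if s: "s \<in> S" for s
  proof (rule ccontr)
    assume neg: "\<not> 0 \<le> L (simple s)"
    then have sT: "s \<notin> T" using LT by force
    let ?P = "insert s T"
    have P: "?P \<subseteq> S" using TS s by auto
    have "\<not> spherical W S ?P" using T sT by (auto simp: maximal_spherical_def)
    then have "infinite (generate W ?P)" using P by (simp add: spherical_def)
    then have inf: "infinite (roots ?P \<inter> pos_roots)" using infinite_pos_roots P by blast
    have "roots ?P \<inter> pos_roots \<subseteq> neg_set L \<union> {x \<in> pos_roots. coef_off T x = 0}"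
    proof
      fix x assume x: "x \<in> roots ?P \<inter> pos_roots"
      then obtain v t where v: "v \<in> generate W ?P" "t \<in> ?P" "x = geo v (simple t)"
        by (auto simp: roots_def)
      have nn: "0 \<le> x u" for u using x by (simp add: pos_roots_def)
      have "coef_off ?P x = 0"
        using generate_iff_coef_off[OF P generate_closed[OF P v(1)]] v by (simp add: coef_off_simple)
      then have zero: "x u = 0" if "u \<in> S" "u \<notin> ?P" for u
        using that nn finite_S sum_nonneg_eq_0_iff[of "S - ?P" x] by (auto simp: coef_off_def)
      have "L x = (\<Sum>u\<in>S. L (simple u) * x u)" by (rule functional_eval[OF L])
      also have "\<dots> = (\<Sum>u\<in>{s}. L (simple u) * x u)"
        by (rule sum.mono_neutral_right) (use finite_S s LT zero in auto)
      finally have Lx: "L x = L (simple s) * x s" by simp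
      show "x \<in> neg_set L \<union> {x \<in> pos_roots. coef_off T x = 0}"
      proof (cases "x s = 0")
        case True
        then have "coef_off T x = 0" unfolding coef_off_def using zero by (intro sum.neutral) auto
        then show ?thesis using x by simp
      next
        case False
        then have "0 < x s" using nn[of s] by simp
        then have "L x < 0" using Lx neg by (simp add: mult_neg_pos)
        then show ?thesis using x by (simp add: neg_set_def)
      qed
    qed
    then show False using inf fin_neg finite_pos_roots_in_span[OF TS] finite_subset by blast
  qed
  have "L x = coef_off U x" for x
  proof -
    have "inv g \<in> generate W {s \<in> S. coef_off U (simple s) = 0} \<and> (\<forall>x. L x = coef_off U x)"
      by (rule dominant_unique[OF _ functional_coef_off L])
         (use g dom in \<open>auto simp: coef_off_simple L_def\<close>)
    then show ?thesis by blast
  qed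
  then have "coef_off U (simple t) = 0" if "t \<in> T" for t using LT that by metis
  then have "\<not> (t \<in> S \<and> t \<notin> U)" if "t \<in> T" for t
    using that coef_off_simple[of U t] by force
  then have "T \<subseteq> U" using TS by blast
  moreover have "spherical W S U" using U by (simp add: maximal_spherical_def)
  ultimately show ?thesis using T by (auto simp: maximal_spherical_def)
qed

lemma label_bond_ge_1: "a \<in> S \<Longrightarrow> b \<in> S \<Longrightarrow> m a b = enat k \<Longrightarrow> 3 \<le> k \<Longrightarrow> 1 \<le> - cartan a b"
proof -
  assume k: "m a b = enat k" "3 \<le> k"
  have "cos (pi / 3) \<le> cos (pi / real k)"
    using k by (intro cos_monotone_0_pi_le) (auto simp: field_simps)
  then show ?thesis using cartan_finite[OF k(1)] by (simp add: cos_60)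
qed

text \<open>In an odd dihedral group products of two reflections commute with each other, so any three
  reflections \<open>a, b, c\<close> satisfy \<open>b a c = c a b\<close>. Three generators of a Coxeter group, pairwise joined
  by labels \<open>\<ge> 3\<close>, do not: the two sides act differently on the simple root of \<open>c\<close>.\<close>

lemma three_generators_not_commuting:
  assumes abc: "a \<in> S" "b \<in> S" "c \<in> S" "a \<noteq> b" "b \<noteq> c" "a \<noteq> c"
    and bonds: "1 \<le> - cartan a c" "1 \<le> - cartan b c" "0 \<le> - cartan a b"
  shows "b \<otimes> (a \<otimes> c) \<noteq> c \<otimes> (a \<otimes> b)"
proof
  assume "b \<otimes> (a \<otimes> c) = c \<otimes> (a \<otimes> b)"
  then have "geo (b \<otimes> (a \<otimes> c)) (simple c) c = geo (c \<otimes> (a \<otimes> b)) (simple c) c" by simp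
  then have eq: "reflect b (reflect a (reflect c (simple c))) c = reflect c (reflect a (reflect b (simple c))) c"
    using abc by (simp add: geo_mult geo_generator)
  define p q r where "p = - cartan b c" and "q = - cartan a c" and "r = - cartan a b"
  define y where "y = (\<lambda>u. 1 * simple c u + p * simple b u)"
  define z where "z = (\<lambda>u. 1 * y u + (q + p * r) * simple a u)"
  have "reflect b (reflect a (reflect c (simple c))) c = - 1"
    using abc by (simp add: reflect_simple) (simp add: reflect_def simple_def)
  moreover have "reflect b (simple c) = y"
    using abc by (simp add: reflect_def form_simple p_def y_def)
  moreover have "reflect a y = z"
  proof -
    have "form (simple a) y = - q - p * r"
      using abc form_linear_right[of "simple a" 1 "simple c" p "simple b"]
      by (simp add: y_def form_simple q_def r_def)
    then show ?thesis by (simp only: reflect_def z_def) (simp add: algebra_simps)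
  qed
  moreover have "reflect c z c = 1 - (2 - p * p - (q + p * r) * q)"
  proof -
    have "form (simple c) y = 2 - p * p"
      using abc form_linear_right[of "simple c" 1 "simple c" p "simple b"]
      by (simp add: y_def form_simple cartan_diag p_def cartan_sym[of c])
    then have "form (simple c) z = 2 - p * p - (q + p * r) * q"
      using abc form_linear_right[of "simple c" 1 y "q + p * r" "simple a"]
      by (simp add: z_def form_simple q_def cartan_sym[of c])
    moreover have "z c = 1" using abc by (simp add: z_def y_def simple_def)
    ultimately show ?thesis by (simp add: reflect_def simple_def)
  qed
  ultimately have "- 1 = 1 - (2 - p * p - (q + p * r) * q)"
    using eq by simp
  moreover have "1 \<le> p" "1 \<le> q" "0 \<le> r" using bonds by (simp_all add: p_def q_def r_def)
  then have "1 \<le> p" "1 \<le> q" "0 \<le> p * r" by (simp_all add: mult_nonneg_nonneg)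
  then have "1 * 1 \<le> p * p" "1 * 1 \<le> (q + p * r) * q" by (intro mult_mono; linarith)+
  ultimately show False by simp
qed

end

section \<open>Conjugate subgroups and characters of order two\<close>

context group
begin

text \<open>Homomorphisms to \<open>\<int>/2\<close>, written as predicates with exclusive or as addition. They are false
  outside the carrier, so that distinct predicates are distinct homomorphisms and counting makes
  sense.\<close>

definition characters :: "('a \<Rightarrow> bool) set" where
  "characters = {\<chi>. (\<forall>x. x \<notin> carrier G \<longrightarrow> \<not> \<chi> x) \<and>
     (\<forall>x\<in>carrier G. \<forall>y\<in>carrier G. \<chi> (x \<otimes> y) = (\<chi> x \<noteq> \<chi> y))}"

definition conjugate_sets :: "'a set \<Rightarrow> 'a set \<Rightarrow> bool" where
  "conjugate_sets A B \<longleftrightarrow> (\<exists>g\<in>carrier G. B = (\<lambda>x. inv g \<otimes> x \<otimes> g) ` A)"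

definition boolean_exponent :: "'a set \<Rightarrow> bool" where
  "boolean_exponent A \<longleftrightarrow> (\<forall>x\<in>A. x \<otimes> x = \<one>)"

lemma character_mult:
  "\<chi> \<in> characters \<Longrightarrow> x \<in> carrier G \<Longrightarrow> y \<in> carrier G \<Longrightarrow> \<chi> (x \<otimes> y) = (\<chi> x \<noteq> \<chi> y)"
  by (simp add: characters_def)

lemma character_one: "\<chi> \<in> characters \<Longrightarrow> \<not> \<chi> \<one>"
  using character_mult[of \<chi> \<one> \<one>] by auto

lemma character_inv: "\<chi> \<in> characters \<Longrightarrow> x \<in> carrier G \<Longrightarrow> \<chi> (inv x) = \<chi> x"
  using character_mult[of \<chi> "inv x" x] character_one by auto

lemma character_conjugate:
  "\<chi> \<in> characters \<Longrightarrow> x \<in> carrier G \<Longrightarrow> g \<in> carrier G \<Longrightarrow> \<chi> (inv g \<otimes> x \<otimes> g) = \<chi> x"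
  by (auto simp: character_mult character_inv)

lemma conjugate_mult:
  "x \<in> carrier G \<Longrightarrow> y \<in> carrier G \<Longrightarrow> g \<in> carrier G \<Longrightarrow>
    (inv g \<otimes> x \<otimes> g) \<otimes> (inv g \<otimes> y \<otimes> g) = inv g \<otimes> (x \<otimes> y) \<otimes> g"
  by (simp add: m_assoc) (simp add: m_assoc[symmetric])

lemma conjugate_conjugate:
  "x \<in> carrier G \<Longrightarrow> g \<in> carrier G \<Longrightarrow> h \<in> carrier G \<Longrightarrow>
    inv h \<otimes> (inv g \<otimes> x \<otimes> g) \<otimes> h = inv (g \<otimes> h) \<otimes> x \<otimes> (g \<otimes> h)"
  by (simp add: m_assoc inv_mult_group)

lemma conjugate_cancel:
  "x \<in> carrier G \<Longrightarrow> g \<in> carrier G \<Longrightarrow> g \<otimes> (inv g \<otimes> x \<otimes> g) \<otimes> inv g = x"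
  using conjugate_conjugate[of x g "inv g"] by simp

lemma conjugate_eq_iff:
  "x \<in> carrier G \<Longrightarrow> y \<in> carrier G \<Longrightarrow> g \<in> carrier G \<Longrightarrow>
    inv g \<otimes> x \<otimes> g = inv g \<otimes> y \<otimes> g \<longleftrightarrow> x = y"
  by (metis conjugate_cancel)

lemma conjugate_pow:
  assumes "x \<in> carrier G" "g \<in> carrier G"
  shows "(inv g \<otimes> x \<otimes> g) [^] (n::nat) = inv g \<otimes> x [^] n \<otimes> g"
  by (induction n) (use assms in \<open>simp_all add: conjugate_mult\<close>)

lemma conjugate_eq_one_iff:
  "x \<in> carrier G \<Longrightarrow> g \<in> carrier G \<Longrightarrow> inv g \<otimes> x \<otimes> g = \<one> \<longleftrightarrow> x = \<one>"
  using conjugate_eq_iff[of x \<one> g] by simp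

lemma conjugate_sets_sym:
  assumes "A \<subseteq> carrier G" "conjugate_sets A B" shows "conjugate_sets B A"
proof -
  obtain g where g: "g \<in> carrier G" "B = (\<lambda>x. inv g \<otimes> x \<otimes> g) ` A"
    using assms by (auto simp: conjugate_sets_def)
  have "A = (\<lambda>x. inv (inv g) \<otimes> x \<otimes> inv g) ` B"
  proof -
    have "(\<lambda>x. inv (inv g) \<otimes> x \<otimes> inv g) ` B = (\<lambda>x. x) ` A"
      unfolding g(2) image_image using assms(1) g(1) conjugate_cancel
      by (intro image_cong HOL.refl) auto
    then show ?thesis by simp
  qed
  then show ?thesis using g unfolding conjugate_sets_def by blast
qed

lemma conjugate_sets_boolean_exponent:
  assumes "A \<subseteq> carrier G" "conjugate_sets A B"
  shows "boolean_exponent A \<longleftrightarrow> boolean_exponent B"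
proof -
  obtain g where g: "g \<in> carrier G" "B = (\<lambda>x. inv g \<otimes> x \<otimes> g) ` A"
    using assms by (auto simp: conjugate_sets_def)
  have "inv g \<otimes> x \<otimes> g \<otimes> (inv g \<otimes> x \<otimes> g) = \<one> \<longleftrightarrow> x \<otimes> x = \<one>" if "x \<in> A" for x
    using that g assms(1) conjugate_mult[of x x g] conjugate_eq_one_iff[of "x \<otimes> x" g] by auto
  then show ?thesis unfolding g(2) boolean_exponent_def by simp
qed

lemma conjugate_sets_character:
  assumes "A \<subseteq> carrier G" "conjugate_sets A B" "\<chi> \<in> characters"
  shows "(\<forall>x\<in>A. \<not> \<chi> x) \<longleftrightarrow> (\<forall>x\<in>B. \<not> \<chi> x)"
proof -
  obtain g where g: "g \<in> carrier G" "B = (\<lambda>x. inv g \<otimes> x \<otimes> g) ` A"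
    using assms by (auto simp: conjugate_sets_def)
  have "\<chi> (inv g \<otimes> x \<otimes> g) = \<chi> x" if "x \<in> A" for x
    using that assms g(1) by (intro character_conjugate) auto
  then show ?thesis unfolding g(2) by simp
qed

end

context coxeter
begin

abbreviation maxsph :: "'a set \<Rightarrow> bool" where "maxsph T \<equiv> maximal_spherical W S T"

lemma maxsphD: "maxsph T \<Longrightarrow> T \<subseteq> S" "maxsph T \<Longrightarrow> finite (generate W T)" "maxsph T \<Longrightarrow> spherical W S T"
  by (auto simp: maximal_spherical_def spherical_def)

lemma generate_subset_carrier: "T \<subseteq> S \<Longrightarrow> generate W T \<subseteq> carrier W"
  using generate_closed by blast

lemma spherical_extends:
  assumes "spherical W S T" obtains U where "maxsph U" "T \<subseteq> U"
proof -
  have "finite {V. spherical W S V \<and> T \<subseteq> V}"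
    by (rule finite_subset[of _ "Pow S"]) (auto simp: spherical_def finite_S)
  moreover have "T \<in> {V. spherical W S V \<and> T \<subseteq> V}" using assms by simp
  ultimately obtain U where "U \<in> {V. spherical W S V \<and> T \<subseteq> V}"
      "\<forall>V\<in>{V. spherical W S V \<and> T \<subseteq> V}. U \<subseteq> V \<longrightarrow> V = U"
    using finite_has_maximal2[of "{V. spherical W S V \<and> T \<subseteq> V}" T] by metis
  then have "maxsph U" "T \<subseteq> U" by (auto simp: maximal_spherical_def)
  with that show thesis by blast
qed

lemma finite_maxsph: "finite {T. maxsph T}"
  by (rule finite_subset[of _ "Pow S"]) (auto simp: finite_S dest: maxsphD)

lemma finite_subgroup_conjugate_into_maxsph:
  assumes "subgroup F W" "finite F"
  obtains w T where "w \<in> carrier W" "maxsph T" "(\<lambda>f. inv w \<otimes> f \<otimes> w) ` F \<subseteq> generate W T"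
proof -
  obtain w T where wT: "w \<in> carrier W" "spherical W S T" "\<forall>f\<in>F. inv w \<otimes> f \<otimes> w \<in> generate W T"
    using finite_subgroup_conjugate_into_spherical[OF assms] by blast
  obtain U where "maxsph U" "T \<subseteq> U" using spherical_extends wT(2) .
  then show thesis using that[of w U] wT mono_generate[of T U] by blast
qed

text \<open>Maximal spherical subsets correspond to distinct conjugacy classes of subgroups.\<close>

lemma conjugate_maxsph_unique:
  assumes T: "maxsph T" and U: "maxsph U" and "A \<subseteq> carrier W"
    and "conjugate_sets (generate W T) A" "conjugate_sets (generate W U) A"
  shows "T = U"
proof -
  obtain g where g: "g \<in> carrier W" "A = (\<lambda>x. inv g \<otimes> x \<otimes> g) ` generate W T"
    using assms by (auto simp: conjugate_sets_def)
  have "conjugate_sets A (generate W U)"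
    using conjugate_sets_sym assms generate_subset_carrier maxsphD by blast
  then obtain h where h: "h \<in> carrier W" "generate W U = (\<lambda>x. inv h \<otimes> x \<otimes> h) ` A"
    by (auto simp: conjugate_sets_def)
  show ?thesis
  proof (rule maximal_spherical_conjugate_eq[OF T U])
    show "g \<otimes> h \<in> carrier W" using g h by simp
    fix t assume t: "t \<in> T"
    then have "t \<in> carrier W" using maxsphD[OF T] by auto
    then have "inv (g \<otimes> h) \<otimes> t \<otimes> (g \<otimes> h) = inv h \<otimes> (inv g \<otimes> t \<otimes> g) \<otimes> h"
      using g h conjugate_conjugate by simp
    moreover have "t \<in> generate W T" using t by (rule generate.incl)
    ultimately show "inv (g \<otimes> h) \<otimes> t \<otimes> (g \<otimes> h) \<in> generate W U"
      unfolding h(2) g(2) by blast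
  qed
qed

text \<open>The elements of the form \<open>(s t)\<^sup>i\<close> or \<open>(s t)\<^sup>i s\<close> are closed under multiplication by \<open>s\<close> and \<open>t\<close> from
  the right.\<close>

lemma dihedral_element:
  assumes st: "s \<in> S" "t \<in> S" and k: "m s t = enat k" and x: "x \<in> generate W {s, t}"
  shows "\<exists>i::nat. x = (s \<otimes> t) [^] i \<or> x = (s \<otimes> t) [^] i \<otimes> s"
proof -
  obtain xs where xs: "set xs \<subseteq> {s, t}" "x = wprod xs"
    using x generate_eq_wprod[of "{s, t}"] st by auto
  have c: "s \<in> carrier W" "t \<in> carrier W" using st by auto
  have "set xs \<subseteq> {s, t} \<Longrightarrow> \<exists>i::nat. wprod xs = (s \<otimes> t) [^] i \<or> wprod xs = (s \<otimes> t) [^] i \<otimes> s"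
  proof (induction xs rule: rev_induct)
    case Nil show ?case by (intro exI[of _ 0]) simp
  next
    case (snoc x xs)
    then have xS: "x \<in> S" "set xs \<subseteq> S" using st by auto
    have w: "wprod (xs @ [x]) = wprod xs \<otimes> x" using xS by (subst wprod_append) auto
    from snoc obtain i :: nat where
      "wprod xs = (s \<otimes> t) [^] i \<or> wprod xs = (s \<otimes> t) [^] i \<otimes> s" by auto
    then consider (1) "wprod xs = (s \<otimes> t) [^] i" "x = s" | (2) "wprod xs = (s \<otimes> t) [^] i" "x = t"
      | (3) "wprod xs = (s \<otimes> t) [^] i \<otimes> s" "x = s" | (4) "wprod xs = (s \<otimes> t) [^] i \<otimes> s" "x = t"
      using snoc.prems by auto
    then show ?case
    proof cases
      case 1 then show ?thesis using w by metis
    next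
      case 2
      have rel: "(s \<otimes> t) [^] k = \<one>" by (rule coxeter_relation[OF st k])
      have "k \<noteq> 0" using k finite_label_ge_2[OF st _ k] m_diag[OF st(1)]
        by (cases "s = t") (auto simp: one_enat_def)
      \<comment> \<open>\<open>(s t)\<^sup>i t = (s t)\<^sup>i\<^sup>-\<^sup>1 s\<close>, where \<open>i\<close> is first raised by the order \<open>k\<close> to avoid \<open>i = 0\<close>.\<close>
      then obtain k' where k': "k = Suc k'" using not0_implies_Suc by blast
      have "(s \<otimes> t) [^] i = (s \<otimes> t) [^] (i + k)"
        using rel c nat_pow_mult[of "s \<otimes> t" i k] by simp
      also have "\<dots> = (s \<otimes> t) [^] (i + k') \<otimes> s \<otimes> t" using c by (simp add: k' m_assoc)
      finally have "wprod xs \<otimes> t = (s \<otimes> t) [^] (i + k') \<otimes> s"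
        using 2 c cancel_right[OF st(2), of "(s \<otimes> t) [^] (i + k') \<otimes> s"] by simp
      then show ?thesis using w 2 by metis
    next
      case 3
      then show ?thesis using w c cancel_right[OF st(1), of "(s \<otimes> t) [^] i"] by auto
    next
      case 4
      then have "wprod xs \<otimes> x = (s \<otimes> t) [^] (Suc i)" using c by (simp add: m_assoc)
      then show ?thesis using w by metis
    qed
  qed
  then show ?thesis using xs by simp
qed

lemma finite_label_spherical:
  assumes st: "s \<in> S" "t \<in> S" and k: "m s t = enat k"
  shows "spherical W S {s, t}"
proof -
  have c: "s \<in> carrier W" "t \<in> carrier W" using st by auto
  have rel: "(s \<otimes> t) [^] k = \<one>" by (rule coxeter_relation[OF st k])
  have "k \<noteq> 0" using k finite_label_ge_2[OF st _ k] m_diag[OF st(1)]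
    by (cases "s = t") (auto simp: one_enat_def)
  have per: "(s \<otimes> t) [^] i \<in> (\<lambda>i. (s \<otimes> t) [^] i) ` {..<k}" for i :: nat
  proof -
    have "(s \<otimes> t) [^] i = (s \<otimes> t) [^] (k * (i div k) + i mod k)" by simp
    also have "\<dots> = (s \<otimes> t) [^] (i mod k)"
      using rel c by (subst nat_pow_mult[symmetric]) (auto simp: nat_pow_pow[symmetric])
    finally show ?thesis using \<open>k \<noteq> 0\<close> by auto
  qed
  let ?D = "(\<lambda>i. (s \<otimes> t) [^] i) ` {..<k}"
  have "generate W {s, t} \<subseteq> ?D \<union> (\<lambda>x. x \<otimes> s) ` ?D"
  proof
    fix x assume "x \<in> generate W {s, t}"
    then obtain i :: nat where "x = (s \<otimes> t) [^] i \<or> x = (s \<otimes> t) [^] i \<otimes> s"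
      using dihedral_element[OF st k] by metis
    then show "x \<in> ?D \<union> (\<lambda>x. x \<otimes> s) ` ?D" using per[of i] by auto
  qed
  then have "finite (generate W {s, t})" by (rule finite_subset) simp
  then show ?thesis using st by (simp add: spherical_def)
qed

lemma spherical_finite_label:
  assumes T: "spherical W S T" "s \<in> T" "t \<in> T"
  obtains k where "m s t = enat k"
proof -
  have st: "s \<in> S" "t \<in> S" using T by (auto simp: spherical_def)
  have sub: "subgroup (generate W T) W" using T generate_is_subgroup by (simp add: spherical_def)
  have "s \<otimes> t \<in> generate W T" using T by (auto intro: generate.intros)
  then have "(s \<otimes> t) [^] i \<in> generate W T" for i :: nat
    using sub by (induction i) (auto intro: subgroup.one_closed subgroup.m_closed)
  then have "range (\<lambda>i::nat. (s \<otimes> t) [^] i) \<subseteq> generate W T" by auto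
  then have "finite (range (\<lambda>i::nat. (s \<otimes> t) [^] i))"
    using T finite_subset by (auto simp: spherical_def)
  then obtain i j :: nat where ij: "i < j" "(s \<otimes> t) [^] i = (s \<otimes> t) [^] j"
    using finite_imageD[of "\<lambda>i::nat. (s \<otimes> t) [^] i" UNIV] infinite_UNIV_nat
    by (metis (mono_tags, lifting) injI linorder_neqE_nat)
  have "(s \<otimes> t) [^] i \<otimes> (s \<otimes> t) [^] (j - i) = (s \<otimes> t) [^] i"
    using st ij nat_pow_mult[of "s \<otimes> t" i "j - i"] by simp
  then have "(s \<otimes> t) [^] (j - i) = \<one>" using st by simp
  then have "m s t \<noteq> \<infinity>" using pow_eq_one_iff[OF st, of "j - i"] ij by (auto split: enat.splits)
  then show thesis using that by (cases "m s t") auto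
qed

lemma commuting_boolean_exponent:
  assumes T: "T \<subseteq> S" and two: "\<And>s t. s \<in> T \<Longrightarrow> t \<in> T \<Longrightarrow> s \<noteq> t \<Longrightarrow> m s t = 2"
  shows "boolean_exponent (generate W T)"
proof -
  have comm: "s \<otimes> t = t \<otimes> s" if st: "s \<in> T" "t \<in> T" for s t
  proof (cases "s = t")
    case False
    have sS: "s \<in> S" "t \<in> S" using st T by auto
    have "(s \<otimes> t) [^] (2::nat) = \<one>"
      using coxeter_relation[of s t 2] two[OF st False] sS by (simp add: numeral_eq_enat)
    then have "s \<otimes> t \<otimes> (s \<otimes> t) = \<one>" using sS by (simp add: numeral_2_eq_2)
    then have "s \<otimes> t = inv (s \<otimes> t)" using sS by (metis S_closed' inv_equality m_closed)
    then show ?thesis using sS by (simp add: inv_mult_group)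
  qed simp
  have move: "wprod xs \<otimes> s = s \<otimes> wprod xs" if "set xs \<subseteq> T" "s \<in> T" for xs s
    using that(1)
  proof (induction xs)
    case (Cons a xs)
    then have c: "a \<in> carrier W" "s \<in> carrier W" "wprod xs \<in> carrier W" using T that by auto
    have "wprod (a # xs) \<otimes> s = a \<otimes> (wprod xs \<otimes> s)" using c by (simp add: m_assoc)
    also have "\<dots> = (a \<otimes> s) \<otimes> wprod xs" using Cons c by (simp add: m_assoc)
    also have "a \<otimes> s = s \<otimes> a" using comm Cons that by auto
    finally show ?case using c by (simp add: m_assoc)
  qed (use T that in auto)
  have "wprod xs \<otimes> wprod xs = \<one>" if "set xs \<subseteq> T" for xs
    using that
  proof (induction xs)
    case (Cons a xs)
    then have c: "a \<in> carrier W" "a \<in> S" "wprod xs \<in> carrier W" using T by auto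
    have "wprod (a # xs) \<otimes> wprod (a # xs) = a \<otimes> ((wprod xs \<otimes> a) \<otimes> wprod xs)"
      using c by (simp add: m_assoc)
    also have "wprod xs \<otimes> a = a \<otimes> wprod xs" using move Cons by auto
    also have "a \<otimes> (a \<otimes> wprod xs \<otimes> wprod xs) = \<one>"
      using Cons c by (simp add: m_assoc cancel_left generator_square)
    finally show ?case .
  qed simp
  then show ?thesis unfolding boolean_exponent_def using generate_eq_wprod[OF T] by auto
qed

text \<open>In a dihedral group of twice odd order the rotations have odd order, so every involution is a
  reflection and the product of two of them is a rotation.\<close>

lemma odd_dihedral_product:
  assumes st: "s \<in> S" "t \<in> S" and k: "m s t = enat k" "odd k"
    and x: "x \<in> generate W {s, t}" "x \<noteq> \<one>" "x \<otimes> x = \<one>"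
    and y: "y \<in> generate W {s, t}" "y \<noteq> \<one>" "y \<otimes> y = \<one>"
  shows "\<exists>z::int. x \<otimes> y = (s \<otimes> t) [^] z"
proof -
  have c: "s \<in> carrier W" "t \<in> carrier W" "s \<otimes> t \<in> carrier W" using st by auto
  have refl: "\<exists>i::nat. x = (s \<otimes> t) [^] i \<otimes> s"
    if x: "x \<in> generate W {s, t}" "x \<noteq> \<one>" "x \<otimes> x = \<one>" for x
  proof -
    obtain i :: nat where i: "x = (s \<otimes> t) [^] i \<or> x = (s \<otimes> t) [^] i \<otimes> s"
      using dihedral_element[OF st k(1) x(1)] by blast
    moreover have "x \<noteq> (s \<otimes> t) [^] i"
    proof
      assume xi: "x = (s \<otimes> t) [^] i"
      then have "(s \<otimes> t) [^] (i + i) = \<one>" using x(3) c by (simp add: nat_pow_mult)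
      then have "k dvd 2 * i" using pow_eq_one_iff[OF st, of "i + i"] k by (simp add: mult_2)
      then have "k dvd i" using k(2) by (simp add: coprime_dvd_mult_right_iff)
      then show False using xi x(2) pow_eq_one_iff[OF st, of i] k by simp
    qed
    ultimately show ?thesis by blast
  qed
  obtain i j :: nat where ij: "x = (s \<otimes> t) [^] i \<otimes> s" "y = (s \<otimes> t) [^] j \<otimes> s"
    using refl[OF x] refl[OF y] by blast
  have "s \<otimes> y = inv (s \<otimes> t) [^] j"
  proof -
    have "s \<otimes> ((s \<otimes> t) [^] j \<otimes> s) = inv s \<otimes> (s \<otimes> t) [^] j \<otimes> s" using st c by (simp add: m_assoc)
    also have "\<dots> = (inv s \<otimes> (s \<otimes> t) \<otimes> s) [^] j" using conjugate_pow[of "s \<otimes> t" s j] c by simp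
    also have "inv s \<otimes> (s \<otimes> t) \<otimes> s = inv (s \<otimes> t)"
      using st c by (simp add: inv_mult_group cancel_left)
    finally show ?thesis using ij by simp
  qed
  then have "x \<otimes> y = (s \<otimes> t) [^] i \<otimes> inv ((s \<otimes> t) [^] j)"
    using ij c by (simp add: m_assoc nat_pow_inv)
  also have "\<dots> = (s \<otimes> t) [^] (int i - int j)"
    using c by (simp add: int_pow_diff int_pow_int)
  finally show ?thesis by blast
qed

text \<open>The diagonal is contained in this relation, as \<open>m s s = 1\<close> is odd.\<close>

definition odd_rel :: "('a \<times> 'a) set" where
  "odd_rel = {(s, t). s \<in> S \<and> t \<in> S \<and> odd_enat (m s t)}"

definition components :: "'a set set" where
  "components = S // odd_rel\<^sup>+"

lemma odd_rel_diag: "s \<in> S \<Longrightarrow> (s, s) \<in> odd_rel"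
  by (auto simp: odd_rel_def m_diag odd_enat_def one_enat_def)

lemma equiv_odd_trancl: "equiv S (odd_rel\<^sup>+)"
proof (rule equivI)
  have sub: "odd_rel \<subseteq> S \<times> S" by (auto simp: odd_rel_def)
  show "odd_rel\<^sup>+ \<subseteq> S \<times> S" by (rule trancl_subset_Sigma[OF sub])
  show "refl_on S (odd_rel\<^sup>+)" by (rule refl_onI) (auto intro: odd_rel_diag)
  show "sym (odd_rel\<^sup>+)" by (rule sym_trancl) (auto simp: sym_def odd_rel_def m_sym)
qed simp

lemma components_nonempty: "b \<in> components \<Longrightarrow> b \<noteq> {}"
  unfolding components_def using in_quotient_imp_non_empty equiv_odd_trancl by blast

lemma Union_components: "\<Union>components = S"
  unfolding components_def using Union_quotient equiv_odd_trancl by blast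

lemma components_disjoint: "b \<in> components \<Longrightarrow> c \<in> components \<Longrightarrow> b = c \<or> b \<inter> c = {}"
  unfolding components_def using quotient_disj[OF equiv_odd_trancl] by blast

lemma finite_components: "finite components"
  unfolding components_def by (rule finite_quotient) (use finite_S equiv_odd_trancl in \<open>auto simp: equiv_def\<close>)

lemma finite_component: "b \<in> components \<Longrightarrow> finite b"
  using Union_components finite_S by (auto intro: finite_subset)

lemma components_odd_closed:
  "b \<in> components \<Longrightarrow> s \<in> b \<Longrightarrow> (s, t) \<in> odd_rel \<Longrightarrow> t \<in> b"
  unfolding components_def using in_quotient_imp_closed[OF equiv_odd_trancl] by blast

lemma component_connected:
  "b \<in> components \<Longrightarrow> s \<in> b \<Longrightarrow> t \<in> b \<Longrightarrow> (s, t) \<in> odd_rel\<^sup>+"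
  unfolding components_def using in_quotient_imp_in_rel[OF equiv_odd_trancl] by blast

lemma character_wprod_vanishes:
  assumes "\<chi> \<in> characters" "T \<subseteq> S"
  shows "(\<forall>x\<in>generate W T. \<not> \<chi> x) \<longleftrightarrow> (\<forall>t\<in>T. \<not> \<chi> t)"
proof
  assume "\<forall>x\<in>generate W T. \<not> \<chi> x" then show "\<forall>t\<in>T. \<not> \<chi> t" by (auto intro: generate.incl)
next
  assume v: "\<forall>t\<in>T. \<not> \<chi> t"
  have "set xs \<subseteq> T \<Longrightarrow> \<not> \<chi> (wprod xs)" for xs
  proof (induction xs)
    case (Cons a xs)
    then have "a \<in> carrier W" "wprod xs \<in> carrier W" using assms by auto
    then show ?case using Cons v assms by (auto simp: character_mult)
  qed (simp add: character_one[OF assms(1)])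
  then show "\<forall>x\<in>generate W T. \<not> \<chi> x" using generate_eq_wprod[OF assms(2)] by auto
qed

text \<open>An odd power of \<open>s t\<close> is trivial.\<close>

lemma character_odd: assumes "\<chi> \<in> characters" "(s, t) \<in> odd_rel" shows "\<chi> s = \<chi> t"
proof -
  from assms obtain k where st: "s \<in> S" "t \<in> S" and k: "m s t = enat k" "odd k"
    by (auto simp: odd_rel_def odd_enat_def)
  have "\<chi> ((s \<otimes> t) [^] n) = (odd n \<and> \<chi> (s \<otimes> t))" for n :: nat
    by (induction n) (use st assms in \<open>auto simp: character_one character_mult\<close>)
  from this[of k] have "\<not> \<chi> (s \<otimes> t)"
    using coxeter_relation[OF st k(1)] k character_one assms by auto
  then show ?thesis using st assms by (auto simp: character_mult)
qed

lemma character_component: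
  assumes "\<chi> \<in> characters" "b \<in> components" "s \<in> b" "t \<in> b" shows "\<chi> s = \<chi> t"
  using component_connected[OF assms(2-4)]
  by (induction rule: trancl_induct) (use character_odd[OF assms(1)] in auto)

lemma character_ext:
  assumes "\<chi> \<in> characters" "\<xi> \<in> characters" "\<And>s. s \<in> S \<Longrightarrow> \<chi> s = \<xi> s" shows "\<chi> = \<xi>"
proof
  fix x
  show "\<chi> x = \<xi> x"
  proof (cases "x \<in> carrier W")
    case True
    then show ?thesis
      by (induction x rule: generator_induct) (use assms in \<open>auto simp: character_one character_mult\<close>)
  qed (use assms in \<open>auto simp: characters_def\<close>)
qed

lemma exists_character:
  assumes Q: "Q \<subseteq> components"
  obtains \<chi> where "\<chi> \<in> characters" "\<And>s. s \<in> S \<Longrightarrow> \<chi> s = (s \<in> \<Union>Q)"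
proof -
  define F where "F s b = (b \<noteq> (s \<in> \<Union>Q))" for s b
  have F2: "F s (F t b) = (b \<noteq> ((s \<in> \<Union>Q) \<noteq> (t \<in> \<Union>Q)))" for s t b by (auto simp: F_def)
  have "satisfies_relations F"
    unfolding satisfies_relations_def
  proof (intro conjI ballI allI impI)
    fix s show "F s \<circ> F s = id" by (auto simp: fun_eq_iff F_def)
  next
    fix s t k assume st: "s \<in> S" "t \<in> S" "m s t = enat k"
    have pow: "((F s \<circ> F t) ^^ n) b = (if odd n then F s (F t b) else b)" for n b
      by (induction n) (auto simp: F2)
    have "F s (F t b) = b" if "odd k" for b
    proof -
      have "(s, t) \<in> odd_rel" "(t, s) \<in> odd_rel"
        using st that m_sym[of s t] by (auto simp: odd_rel_def odd_enat_def)
      then have "s \<in> \<Union>Q \<longleftrightarrow> t \<in> \<Union>Q" using Q components_odd_closed by blast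
      then show ?thesis by (simp add: F2)
    qed
    then show "(F s \<circ> F t) ^^ k = id" by (auto simp: fun_eq_iff pow)
  qed
  note F = this
  have shift: "act F w b = (b \<noteq> act F w False)" if "w \<in> carrier W" for w b
    using that
  proof (induction w arbitrary: b rule: generator_induct)
    case one show ?case by (simp add: act_one[OF F])
  next
    case (mult w s)
    have step: "act F (s \<otimes> w) c = F s (act F w c)" for c
      using mult.hyps by (simp add: act_mult[OF F] act_generator[OF F])
    have "F s (act F w b) = (b \<noteq> F s (act F w False))"
      using mult.IH[of b] F_def by blast
    then show ?case by (simp only: step)
  qed
  define \<chi> where "\<chi> w = (w \<in> carrier W \<and> act F w False)" for w
  have "act F (x \<otimes> y) False = (act F x False \<noteq> act F y False)"
    if "x \<in> carrier W" "y \<in> carrier W" for x y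
    using act_mult[OF F that, of False] shift[OF that(1), of "act F y False"] by blast
  then have "\<chi> \<in> characters" by (simp add: characters_def \<chi>_def)
  moreover have "\<chi> s = (s \<in> \<Union>Q)" if "s \<in> S" for s
    using that by (simp add: \<chi>_def act_generator[OF F] F_def)
  ultimately show thesis using that by blast
qed

text \<open>Characters correspond to sets of components, namely those on which they are nontrivial, and a
  character kills \<open>W\<^sub>T\<close> iff it kills every generator in \<open>T\<close>.\<close>

theorem card_vanishing_characters:
  assumes D: "\<And>T. T \<in> D \<Longrightarrow> T \<subseteq> S"
  shows "card {\<chi> \<in> characters. \<forall>T\<in>D. \<forall>x\<in>generate W T. \<not> \<chi> x} =
         2 ^ card {b \<in> components. \<forall>T\<in>D. b \<inter> T = {}}"
proof -
  let ?A = "{\<chi> \<in> characters. \<forall>T\<in>D. \<forall>x\<in>generate W T. \<not> \<chi> x}"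
  let ?B = "{b \<in> components. \<forall>T\<in>D. b \<inter> T = {}}"
  let ?f = "\<lambda>\<chi>. {b \<in> components. \<exists>s\<in>b. \<chi> s}"
  have A: "\<chi> \<in> ?A \<longleftrightarrow> \<chi> \<in> characters \<and> (\<forall>T\<in>D. \<forall>t\<in>T. \<not> \<chi> t)" for \<chi>
  proof -
    have "(\<forall>x\<in>generate W T. \<not> \<chi> x) \<longleftrightarrow> (\<forall>t\<in>T. \<not> \<chi> t)" if "T \<in> D" "\<chi> \<in> characters" for T
      using character_wprod_vanishes[OF that(2) D[OF that(1)]] .
    then show ?thesis by (simp cong: conj_cong)
  qed
  have "bij_betw ?f ?A (Pow ?B)"
  proof (rule bij_betwI')
    fix \<chi> \<xi> assume "\<chi> \<in> ?A" "\<xi> \<in> ?A"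
    then have c: "\<chi> \<in> characters" "\<xi> \<in> characters" by auto
    show "?f \<chi> = ?f \<xi> \<longleftrightarrow> \<chi> = \<xi>"
    proof
      assume eq: "?f \<chi> = ?f \<xi>"
      show "\<chi> = \<xi>"
      proof (rule character_ext[OF c])
        fix s assume "s \<in> S"
        then obtain b where b: "b \<in> components" "s \<in> b" using Union_components by auto
        have "b \<in> ?f \<zeta> \<longleftrightarrow> \<zeta> s" if "\<zeta> \<in> characters" for \<zeta>
          using b character_component[OF that b(1) b(2)] by blast
        from this[OF c(1)] this[OF c(2)]
        show "\<chi> s = \<xi> s" unfolding eq by blast
      qed
    qed simp
  next
    fix \<chi> assume "\<chi> \<in> ?A"
    then have c: "\<chi> \<in> characters" "\<forall>T\<in>D. \<forall>t\<in>T. \<not> \<chi> t" using A by auto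
    have "b \<inter> T = {}" if "b \<in> ?f \<chi>" "T \<in> D" for b T
      using that c(2) character_component[OF c(1), of b] by blast
    then show "?f \<chi> \<in> Pow ?B" by blast
  next
    fix Q assume "Q \<in> Pow ?B"
    then have Q: "Q \<subseteq> components" "\<forall>b\<in>Q. \<forall>T\<in>D. b \<inter> T = {}" by auto
    obtain \<chi> where \<chi>: "\<chi> \<in> characters" "\<And>s. s \<in> S \<Longrightarrow> \<chi> s = (s \<in> \<Union>Q)"
      by (rule exists_character[OF Q(1)]) blast
    have "\<chi> \<in> ?A" unfolding A using \<chi> Q D by blast
    moreover have "Q = ?f \<chi>"
    proof
      show "Q \<subseteq> ?f \<chi>"
      proof
        fix b assume b: "b \<in> Q"
        then obtain s where "s \<in> b" using components_nonempty Q by blast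
        then show "b \<in> ?f \<chi>" using b Q \<chi>(2)[of s] Union_components by blast
      qed
      show "?f \<chi> \<subseteq> Q"
      proof
        fix b assume "b \<in> ?f \<chi>"
        then obtain s where s: "b \<in> components" "s \<in> b" "\<chi> s" by auto
        then have "s \<in> S" using Union_components by auto
        then obtain c where "c \<in> Q" "s \<in> c" using \<chi> s by auto
        then show "b \<in> Q" using components_disjoint[of b c] s Q by blast
      qed
    qed
    ultimately show "\<exists>\<chi>\<in>?A. Q = ?f \<chi>" by blast
  qed
  then have "card ?A = card (Pow ?B)" by (rule bij_betw_same_card)
  also have "\<dots> = 2 ^ card ?B" using finite_components by (intro card_Pow) auto
  finally show ?thesis .
qed

end

section \<open>A counting principle\<close>

text \<open>Taking \<open>D = C - Y\<close>, the hypothesis counts the elements whose label is contained in \<open>Y\<close>; by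
  induction on \<open>Y\<close> it yields the number of elements whose label is equal to \<open>Y\<close>.\<close>

lemma label_bijection:
  assumes fin: "finite B" "finite B'" "finite C"
    and L: "\<And>b. b \<in> B \<Longrightarrow> L b \<subseteq> C" and L': "\<And>b. b \<in> B' \<Longrightarrow> L' b \<subseteq> C"
    and count: "\<And>D. D \<subseteq> C \<Longrightarrow> card {b \<in> B. L b \<inter> D = {}} = card {b \<in> B'. L' b \<inter> D = {}}"
  obtains \<beta> where "bij_betw \<beta> B B'" "\<And>b. b \<in> B \<Longrightarrow> L' (\<beta> b) = L b"
proof -
  have below: "card {b \<in> B. L b \<subseteq> Y} = card {b \<in> B'. L' b \<subseteq> Y}" if "Y \<subseteq> C" for Y
  proof -
    have "{b \<in> B. L b \<subseteq> Y} = {b \<in> B. L b \<inter> (C - Y) = {}}" using L that by blast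
    moreover have "{b \<in> B'. L' b \<subseteq> Y} = {b \<in> B'. L' b \<inter> (C - Y) = {}}" using L' that by blast
    ultimately show ?thesis using count[of "C - Y"] by simp
  qed
  have split: "card {b \<in> A. M b \<subseteq> Y} = card {b \<in> A. M b = Y} + (\<Sum>Z\<in>{Z. Z \<subset> Y}. card {b \<in> A. M b = Z})"
    if "finite A" "finite Y" for A :: "'x set" and M :: "'x \<Rightarrow> 'c set" and Y
  proof -
    have "{b \<in> A. M b \<subseteq> Y} = (\<Union>Z\<in>Pow Y. {b \<in> A. M b = Z})" by auto
    also have "card \<dots> = (\<Sum>Z\<in>Pow Y. card {b \<in> A. M b = Z})"
      using that by (intro card_UN_disjoint) auto
    also have "Pow Y = insert Y {Z. Z \<subset> Y}" by auto
    also have "(\<Sum>Z\<in>insert Y {Z. Z \<subset> Y}. card {b \<in> A. M b = Z}) =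
        card {b \<in> A. M b = Y} + (\<Sum>Z\<in>{Z. Z \<subset> Y}. card {b \<in> A. M b = Z})"
      using that finite_subset[of "{Z. Z \<subset> Y}" "Pow Y"] by (intro sum.insert) auto
    finally show ?thesis .
  qed
  have exact: "card {b \<in> B. L b = Y} = card {b \<in> B'. L' b = Y}" if "Y \<subseteq> C" for Y
  proof -
    have "finite Y" using that fin finite_subset by blast
    then show ?thesis using that
    proof (induction Y rule: finite_psubset_induct)
      case (psubset Y)
      have "(\<Sum>Z\<in>{Z. Z \<subset> Y}. card {b \<in> B. L b = Z}) = (\<Sum>Z\<in>{Z. Z \<subset> Y}. card {b \<in> B'. L' b = Z})"
        using psubset by (intro sum.cong HOL.refl) auto
      then show ?case
        using below[OF psubset.prems] split[OF fin(1) psubset.hyps(1), of L] split[OF fin(2) psubset.hyps(1), of L']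
        by simp
    qed
  qed
  have "\<exists>g. bij_betw g {b \<in> B. L b = Y} {b \<in> B'. L' b = Y}" if "Y \<subseteq> C" for Y
    using exact[OF that] fin by (intro finite_same_card_bij) auto
  then obtain g where g: "\<And>Y. Y \<subseteq> C \<Longrightarrow> bij_betw (g Y) {b \<in> B. L b = Y} {b \<in> B'. L' b = Y}" by metis
  define \<beta> where "\<beta> b = g (L b) b" for b
  have img: "\<beta> b \<in> B' \<and> L' (\<beta> b) = L b" if "b \<in> B" for b
    using bij_betwE[OF g[OF L[OF that]]] that by (auto simp: \<beta>_def)
  have "bij_betw \<beta> B B'"
  proof (rule bij_betw_imageI)
    show "inj_on \<beta> B"
    proof (rule inj_onI)
      fix b c assume bc: "b \<in> B" "c \<in> B" "\<beta> b = \<beta> c"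
      then have "L b = L c" using img by metis
      then show "b = c" using bij_betw_imp_inj_on[OF g[OF L[OF bc(1)]]] bc by (auto simp: \<beta>_def inj_on_def)
    qed
    show "\<beta> ` B = B'"
    proof
      show "\<beta> ` B \<subseteq> B'" using img by auto
      show "B' \<subseteq> \<beta> ` B"
      proof
        fix c assume c: "c \<in> B'"
        then have "c \<in> g (L' c) ` {b \<in> B. L b = L' c}"
          using bij_betw_imp_surj_on[OF g[OF L'[OF c]]] by auto
        then obtain b where "b \<in> B" "L b = L' c" "c = g (L' c) b" by blast
        then have "b \<in> B" "c = \<beta> b" by (simp_all add: \<beta>_def)
        then show "c \<in> \<beta> ` B" by blast
      qed
    qed
  qed
  with img that show thesis by blast
qed

section \<open>Isolated odd edges\<close>

context coxeter
begin

lemma generator_ne_one: assumes "s \<in> S" shows "s \<noteq> \<one>"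
proof
  assume "s = \<one>"
  then have "(\<lambda>u. - simple s u) = simple s"
    using reflect_simple[OF assms] geo_generator[OF assms] geo_one[of "simple s"] by metis
  from fun_cong[OF this, of s] show False by (simp add: simple_def)
qed

lemma label_dvd:
  "s \<in> S \<Longrightarrow> t \<in> S \<Longrightarrow> m s t = enat k \<Longrightarrow> (s \<otimes> t) [^] (n::nat) = \<one> \<Longrightarrow> k dvd n"
  using pow_eq_one_iff[of s t n] by simp

lemma odd_conjugate_label_dvd:
  assumes st: "s \<in> S" "t \<in> S" "m s t = enat k" "odd k"
    and conj: "conjugate_sets (generate W {s, t}) A"
    and x: "x \<in> A" "x \<noteq> \<one>" "x \<otimes> x = \<one>" and y: "y \<in> A" "y \<noteq> \<one>" "y \<otimes> y = \<one>"
  shows "(x \<otimes> y) [^] k = \<one>"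
proof -
  have sub: "generate W {s, t} \<subseteq> carrier W" by (rule generate_subset_carrier) (use st in simp)
  obtain g where g: "g \<in> carrier W" "A = (\<lambda>x. inv g \<otimes> x \<otimes> g) ` generate W {s, t}"
    using conj by (auto simp: conjugate_sets_def)
  obtain x' where x': "x' \<in> generate W {s, t}" "x = inv g \<otimes> x' \<otimes> g"
    using x(1) unfolding g(2) by (rule imageE)
  obtain y' where y': "y' \<in> generate W {s, t}" "y = inv g \<otimes> y' \<otimes> g"
    using y(1) unfolding g(2) by (rule imageE)
  have c: "x' \<in> carrier W" "y' \<in> carrier W" using sub x' y' by auto
  have "x' \<noteq> \<one>" "y' \<noteq> \<one>" using x' y' x y c g by (auto simp: conjugate_eq_one_iff)
  moreover have "x' \<otimes> x' = \<one>" "y' \<otimes> y' = \<one>"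
    using x(3) y(3) x' y' c g by (simp_all add: conjugate_mult conjugate_eq_one_iff)
  ultimately obtain z :: int where z: "x' \<otimes> y' = (s \<otimes> t) [^] z"
    using odd_dihedral_product[OF st] x' y' by blast
  have "(x' \<otimes> y') [^] k = ((s \<otimes> t) [^] k) [^] z"
    using z st by (simp add: int_pow_int[symmetric] int_pow_pow mult.commute)
  then have "(x' \<otimes> y') [^] k = \<one>" using coxeter_relation[OF st(1-3)] by simp
  then show ?thesis using x' y' c g by (simp add: conjugate_mult conjugate_pow)
qed

end

text \<open>Every spherical subset of such a system is an odd edge or consists of commuting generators
  (\<open>spherical_cases\<close>). The two cases are told apart by whether all elements of the generated subgroup
  have square one, which is invariant under conjugation.\<close>

locale isolated_odd_coxeter = coxeter +
  assumes even_label: "s \<in> S \<Longrightarrow> t \<in> S \<Longrightarrow> even_enat (m s t) \<Longrightarrow> m s t = 2"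
    and odd_maximal: "s \<in> S \<Longrightarrow> t \<in> S \<Longrightarrow> s \<noteq> t \<Longrightarrow> odd_enat (m s t) \<Longrightarrow>
      maximal_spherical W S {s, t}"
begin

lemma finite_label_cases: "m s t = enat k \<Longrightarrow> s \<in> S \<Longrightarrow> t \<in> S \<Longrightarrow> m s t = 2 \<or> odd_enat (m s t)"
  using even_label[of s t] by (auto simp: even_enat_def odd_enat_def)

lemma spherical_cases:
  assumes T: "spherical W S T"
  shows "boolean_exponent (generate W T) \<or>
    (\<exists>s t. s \<in> S \<and> t \<in> S \<and> s \<noteq> t \<and> odd_enat (m s t) \<and> T = {s, t})"
proof (cases "\<exists>s\<in>T. \<exists>t\<in>T. s \<noteq> t \<and> odd_enat (m s t)")
  case True
  then obtain s t where st: "s \<in> T" "t \<in> T" "s \<noteq> t" "odd_enat (m s t)" by blast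
  then have S: "s \<in> S" "t \<in> S" using T by (auto simp: spherical_def)
  have "T = {s, t}"
    using odd_maximal[OF S st(3,4)] T st by (auto simp: maximal_spherical_def)
  then show ?thesis using st S by blast
next
  case False
  have TS: "T \<subseteq> S" using T by (simp add: spherical_def)
  have "m s t = 2" if st: "s \<in> T" "t \<in> T" "s \<noteq> t" for s t
  proof -
    obtain k where "m s t = enat k" using spherical_finite_label[OF T st(1,2)] .
    then have "m s t = 2 \<or> odd_enat (m s t)" using finite_label_cases[of s t k] st TS by blast
    then show ?thesis using False st by blast
  qed
  then show ?thesis using commuting_boolean_exponent[OF TS] by blast
qed

lemma odd_pair_not_boolean:
  assumes "s \<in> S" "t \<in> S" "s \<noteq> t" "odd_enat (m s t)" "{s, t} \<subseteq> A"
  shows "\<not> boolean_exponent (generate W A)"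
proof
  assume "boolean_exponent (generate W A)"
  moreover have "s \<otimes> t \<in> generate W A" using assms by (auto intro: generate.intros)
  ultimately have "(s \<otimes> t) [^] (2::nat) = \<one>" using assms by (simp add: boolean_exponent_def numeral_2_eq_2)
  moreover obtain k where k: "m s t = enat k" "odd k" using assms by (auto simp: odd_enat_def)
  ultimately have "k dvd 2" using label_dvd assms by blast
  then have "k \<le> 2" by (rule dvd_imp_le) simp
  then show False using finite_label_ge_2[OF assms(1-3) k(1)] k by auto
qed

lemma maxsph_cases:
  assumes "maxsph T" "\<not> boolean_exponent (generate W T)"
  obtains s t where "s \<in> S" "t \<in> S" "s \<noteq> t" "odd_enat (m s t)" "T = {s, t}"
  using spherical_cases[of T] assms maxsphD by blast

text \<open>A finite subgroup that contains an element whose square is not one is conjugate into an odd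
  dihedral group, so the relations among reflections of such a group hold for its involutions.\<close>

lemma finite_subgroup_involutions:
  assumes F: "subgroup F W" "finite F" "\<not> boolean_exponent F"
  obtains k :: nat where "odd k"
    "\<And>x y. x \<in> F \<Longrightarrow> x \<noteq> \<one> \<Longrightarrow> x \<otimes> x = \<one> \<Longrightarrow> y \<in> F \<Longrightarrow> y \<noteq> \<one> \<Longrightarrow> y \<otimes> y = \<one> \<Longrightarrow>
       (x \<otimes> y) [^] k = \<one>"
    "\<And>x y z. x \<in> F \<Longrightarrow> x \<noteq> \<one> \<Longrightarrow> x \<otimes> x = \<one> \<Longrightarrow> y \<in> F \<Longrightarrow> y \<noteq> \<one> \<Longrightarrow> y \<otimes> y = \<one> \<Longrightarrow>
       z \<in> F \<Longrightarrow> z \<noteq> \<one> \<Longrightarrow> z \<otimes> z = \<one> \<Longrightarrow> y \<otimes> (x \<otimes> z) = z \<otimes> (x \<otimes> y)"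
proof -
  obtain g T where g: "g \<in> carrier W" "maxsph T" "(\<lambda>f. inv g \<otimes> f \<otimes> g) ` F \<subseteq> generate W T"
    using finite_subgroup_conjugate_into_maxsph[OF F(1,2)] .
  have Fc: "x \<in> carrier W" if "x \<in> F" for x using subgroup.mem_carrier[OF F(1) that] .
  let ?c = "\<lambda>x. inv g \<otimes> x \<otimes> g"
  have "\<not> boolean_exponent (generate W T)"
  proof
    assume b: "boolean_exponent (generate W T)"
    have "x \<otimes> x = \<one>" if "x \<in> F" for x
    proof -
      have "?c x \<otimes> ?c x = \<one>" using b g that by (auto simp: boolean_exponent_def)
      then show ?thesis using Fc[OF that] g by (simp add: conjugate_mult conjugate_eq_one_iff)
    qed
    then show False using F(3) by (simp add: boolean_exponent_def)
  qed
  then obtain s t where st: "s \<in> S" "t \<in> S" "s \<noteq> t" "odd_enat (m s t)" "T = {s, t}"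
    using maxsph_cases g(2) by metis
  then obtain k where k: "m s t = enat k" "odd k" by (auto simp: odd_enat_def)
  have rot: "\<exists>z::int. ?c (x \<otimes> y) = (s \<otimes> t) [^] z"
    if x: "x \<in> F" "x \<noteq> \<one>" "x \<otimes> x = \<one>" and y: "y \<in> F" "y \<noteq> \<one>" "y \<otimes> y = \<one>" for x y
  proof -
    have c: "x \<in> carrier W" "y \<in> carrier W" using x y Fc by auto
    have "?c x \<in> generate W {s, t}" "?c y \<in> generate W {s, t}" using x y g st by auto
    moreover have "?c x \<noteq> \<one>" "?c y \<noteq> \<one>" using x y c g by (simp_all add: conjugate_eq_one_iff)
    moreover have "?c x \<otimes> ?c x = \<one>" "?c y \<otimes> ?c y = \<one>"
      using x y c g by (simp_all add: conjugate_mult conjugate_eq_one_iff)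
    ultimately have "\<exists>z::int. ?c x \<otimes> ?c y = (s \<otimes> t) [^] z"
      using odd_dihedral_product[OF st(1,2) k] by blast
    then show ?thesis using c g by (simp add: conjugate_mult)
  qed
  show thesis
  proof (rule that[OF k(2)])
    fix x y assume x: "x \<in> F" "x \<noteq> \<one>" "x \<otimes> x = \<one>" and y: "y \<in> F" "y \<noteq> \<one>" "y \<otimes> y = \<one>"
    obtain z :: int where z: "?c (x \<otimes> y) = (s \<otimes> t) [^] z" using rot[OF x y] by blast
    have "?c (x \<otimes> y) [^] k = ((s \<otimes> t) [^] k) [^] z"
      using z st by (simp add: int_pow_int[symmetric] int_pow_pow mult.commute)
    then have "?c ((x \<otimes> y) [^] k) = \<one>"
      using coxeter_relation[OF st(1,2) k(1)] conjugate_pow[of "x \<otimes> y" g k] x y Fc g by simp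
    then show "(x \<otimes> y) [^] k = \<one>" using x y Fc g by (simp add: conjugate_eq_one_iff)
  next
    fix x y z assume x: "x \<in> F" "x \<noteq> \<one>" "x \<otimes> x = \<one>" and y: "y \<in> F" "y \<noteq> \<one>" "y \<otimes> y = \<one>"
      and z: "z \<in> F" "z \<noteq> \<one>" "z \<otimes> z = \<one>"
    have c: "x \<in> carrier W" "y \<in> carrier W" "z \<in> carrier W" using x y z Fc by auto
    obtain i j :: int where ij: "?c (x \<otimes> y) = (s \<otimes> t) [^] i" "?c (x \<otimes> z) = (s \<otimes> t) [^] j"
      using rot[OF x y] rot[OF x z] by blast
    have "?c (x \<otimes> y) \<otimes> ?c (x \<otimes> z) = ?c (x \<otimes> z) \<otimes> ?c (x \<otimes> y)"
      unfolding ij using st int_pow_mult[of "s \<otimes> t" i j] int_pow_mult[of "s \<otimes> t" j i]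
      by (simp add: add.commute)
    then have "?c ((x \<otimes> y) \<otimes> (x \<otimes> z)) = ?c ((x \<otimes> z) \<otimes> (x \<otimes> y))"
      using c g by (simp only: conjugate_mult m_closed)
    then have "(x \<otimes> y) \<otimes> (x \<otimes> z) = (x \<otimes> z) \<otimes> (x \<otimes> y)"
      using c g by (subst (asm) conjugate_eq_iff) auto
    then have "x \<otimes> (y \<otimes> (x \<otimes> z)) = x \<otimes> (z \<otimes> (x \<otimes> y))" using c by (simp add: m_assoc)
    then show "y \<otimes> (x \<otimes> z) = z \<otimes> (x \<otimes> y)" using c by simp
  qed
qed

end

text \<open>Any two generators in \<open>S'\<close> with a finite label generate a finite subgroup of \<open>W\<close>, whose structure is
  known from \<open>S\<close>: either all its elements have square one, or the order of the product of the two
  generators is odd. A spherical subset of \<open>S'\<close> that properly contains an odd edge would consist of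
  involutions of an odd dihedral group, contradicting \<open>three_generators_not_commuting\<close>.\<close>

theorem isolated_odd_coxeter_transfer:
  fixes W :: "('a, 'b) monoid_scheme" (structure)
  assumes "isolated_odd_coxeter W S m" "coxeter W S' m'"
  shows "isolated_odd_coxeter W S' m'"
proof -
  interpret A: isolated_odd_coxeter W S m by fact
  interpret B: coxeter W S' m' by fact
  have gen: "s \<in> generate W T" "s \<noteq> \<one>" "s \<otimes> s = \<one>" if "s \<in> T" "T \<subseteq> S'" for s T
    using that B.generator_ne_one B.generator_square by (auto intro: generate.incl)
  show ?thesis
  proof unfold_locales
    fix s t assume st: "s \<in> S'" "t \<in> S'" and ev: "even_enat (m' s t)"
    then obtain k where k: "m' s t = enat k" "even k" by (auto simp: even_enat_def)
    have ne: "s \<noteq> t" using k st B.m_diag by (auto simp: one_enat_def)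
    have k2: "2 \<le> k" by (rule B.finite_label_ge_2[OF st ne k(1)])
    have sub: "{s, t} \<subseteq> S'" using st by simp
    have F: "subgroup (generate W {s, t}) W" "finite (generate W {s, t})"
      using B.generate_is_subgroup[OF sub] B.finite_label_spherical[OF st k(1)] by (auto simp: spherical_def)
    show "m' s t = 2"
    proof (cases "A.boolean_exponent (generate W {s, t})")
      case True
      moreover have "s \<otimes> t \<in> generate W {s, t}" by (auto intro: generate.intros)
      ultimately have "(s \<otimes> t) [^] (2::nat) = \<one>"
        using st by (simp add: A.boolean_exponent_def numeral_2_eq_2)
      then have "k dvd 2" using B.label_dvd[OF st k(1)] by blast
      then have "k \<le> 2" by (rule dvd_imp_le) simp
      then show ?thesis using k k2 by (simp add: numeral_eq_enat)
    next
      case False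
      obtain j :: nat where "odd j" "(s \<otimes> t) [^] j = \<one>"
        by (rule A.finite_subgroup_involutions[OF F False]) (auto simp: gen[OF _ sub])
      then have "k dvd j" using B.label_dvd[OF st k(1)] by blast
      then show ?thesis using \<open>odd j\<close> k(2) by auto
    qed
  next
    fix s t assume st: "s \<in> S'" "t \<in> S'" "s \<noteq> t" and od: "odd_enat (m' s t)"
    then obtain k where k: "m' s t = enat k" "odd k" by (auto simp: odd_enat_def)
    have k2: "2 \<le> k" by (rule B.finite_label_ge_2[OF st k(1)])
    have "T = {s, t}" if T: "spherical W S' T" "{s, t} \<subseteq> T" for T
    proof (rule ccontr)
      assume "T \<noteq> {s, t}"
      then obtain u where u: "u \<in> T" "u \<noteq> s" "u \<noteq> t" using T by blast
      have TS: "T \<subseteq> S'" using T by (simp add: spherical_def)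
      then have uS: "u \<in> S'" using u by blast
      have F: "subgroup (generate W T) W" "finite (generate W T)"
        using B.generate_is_subgroup[OF TS] T by (auto simp: spherical_def)
      have nb: "\<not> A.boolean_exponent (generate W T)"
      proof
        assume "A.boolean_exponent (generate W T)"
        moreover have "s \<otimes> t \<in> generate W T" using T by (auto intro: generate.intros)
        ultimately have "(s \<otimes> t) [^] (2::nat) = \<one>"
          using st by (simp add: A.boolean_exponent_def numeral_2_eq_2)
        then have "k dvd 2" using B.label_dvd[OF st(1,2) k(1)] by blast
        then have "k \<le> 2" by (rule dvd_imp_le) simp
        then show False using k k2 by auto
      qed
      obtain j :: nat where j: "odd j"
        "\<And>x y. x \<in> T \<Longrightarrow> y \<in> T \<Longrightarrow> (x \<otimes> y) [^] j = \<one>"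
        "\<And>x y z. x \<in> T \<Longrightarrow> y \<in> T \<Longrightarrow> z \<in> T \<Longrightarrow> y \<otimes> (x \<otimes> z) = z \<otimes> (x \<otimes> y)"
      proof (rule A.finite_subgroup_involutions[OF F nb])
        fix j :: nat
        assume j: "odd j"
          "\<And>x y. x \<in> generate W T \<Longrightarrow> x \<noteq> \<one> \<Longrightarrow> x \<otimes> x = \<one> \<Longrightarrow> y \<in> generate W T \<Longrightarrow> y \<noteq> \<one> \<Longrightarrow>
             y \<otimes> y = \<one> \<Longrightarrow> (x \<otimes> y) [^] j = \<one>"
          "\<And>x y z. x \<in> generate W T \<Longrightarrow> x \<noteq> \<one> \<Longrightarrow> x \<otimes> x = \<one> \<Longrightarrow> y \<in> generate W T \<Longrightarrow> y \<noteq> \<one> \<Longrightarrow>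
             y \<otimes> y = \<one> \<Longrightarrow> z \<in> generate W T \<Longrightarrow> z \<noteq> \<one> \<Longrightarrow> z \<otimes> z = \<one> \<Longrightarrow>
             y \<otimes> (x \<otimes> z) = z \<otimes> (x \<otimes> y)"
        show thesis
          by (rule that[OF j(1)]) (auto intro!: j(2,3) gen[OF _ TS])
      qed
      have bond: "1 \<le> - B.cartan x y" if xy: "x \<in> T" "y \<in> T" "x \<noteq> y" for x y
      proof -
        obtain l where l: "m' x y = enat l" using B.spherical_finite_label[OF T(1) xy(1,2)] .
        have S: "x \<in> S'" "y \<in> S'" using xy TS by auto
        have "l dvd j" using B.label_dvd[OF S l] j(2) xy by blast
        then have "odd l" using j(1) by (meson dvd_trans)
        moreover have "2 \<le> l" by (rule B.finite_label_ge_2[OF S xy(3) l])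
        ultimately have "3 \<le> l" by presburger
        then show ?thesis by (rule B.label_bond_ge_1[OF S l])
      qed
      have sT: "s \<in> T" "t \<in> T" using T by auto
      have "0 \<le> - B.cartan s t" using bond[OF sT st(3)] by simp
      then have "t \<otimes> (s \<otimes> u) \<noteq> u \<otimes> (s \<otimes> t)"
        using B.three_generators_not_commuting[of s t u] st uS u bond[OF sT(1) u(1)] bond[OF sT(2) u(1)]
        by auto
      then show False using j(3)[OF sT u(1)] by blast
    qed
    then show "maximal_spherical W S' {s, t}"
      unfolding maximal_spherical_def using B.finite_label_spherical[OF st(1,2) k(1)] by blast
  qed
qed

section \<open>Comparison of two Coxeter generating sets\<close>

text \<open>Conjugate \<open>W\<^sub>T\<close> into a maximal spherical subgroup for \<open>S'\<close>, and that one back into \<open>W\<^sub>U\<close> for a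
  maximal spherical \<open>U \<subseteq> S\<close>. Then \<open>T = U\<close>, and both inclusions are equalities by cardinality.\<close>

lemma maxsph_conjugate_exists:
  fixes W :: "('a, 'b) monoid_scheme" (structure)
  assumes "coxeter W S m" "coxeter W S' m'" and T: "maximal_spherical W S T"
  shows "\<exists>T'. maximal_spherical W S' T' \<and> group.conjugate_sets W (generate W T) (generate W T')"
proof -
  interpret A: coxeter W S m by fact
  interpret B: coxeter W S' m' by fact
  have TS: "T \<subseteq> S" "finite (generate W T)" using A.maxsphD[OF T] by auto
  obtain g T' where g: "g \<in> carrier W" "B.maxsph T'" "(\<lambda>x. inv g \<otimes> x \<otimes> g) ` generate W T \<subseteq> generate W T'"
    using B.finite_subgroup_conjugate_into_maxsph[OF A.generate_is_subgroup[OF TS(1)] TS(2)] .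
  have T'S: "T' \<subseteq> S'" "finite (generate W T')" using B.maxsphD[OF g(2)] by auto
  obtain h U where h: "h \<in> carrier W" "A.maxsph U" "(\<lambda>x. inv h \<otimes> x \<otimes> h) ` generate W T' \<subseteq> generate W U"
    using A.finite_subgroup_conjugate_into_maxsph[OF B.generate_is_subgroup[OF T'S(1)] T'S(2)] .
  have c: "generate W T \<subseteq> carrier W" "generate W T' \<subseteq> carrier W"
    using A.generate_subset_carrier TS B.generate_subset_carrier T'S by auto
  have "T = U"
  proof (rule A.maximal_spherical_conjugate_eq[OF T h(2)])
    show "g \<otimes> h \<in> carrier W" using g h by simp
    fix t assume "t \<in> T"
    then have t: "t \<in> generate W T" by (rule generate.incl)
    then have "inv h \<otimes> (inv g \<otimes> t \<otimes> g) \<otimes> h \<in> generate W U" using g h by blast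
    then show "inv (g \<otimes> h) \<otimes> t \<otimes> (g \<otimes> h) \<in> generate W U"
      using A.conjugate_conjugate[of t g h] t c g h by auto
  qed
  then have "card ((\<lambda>x. inv h \<otimes> x \<otimes> h) ` generate W T') \<le> card (generate W T)"
    using h TS by (intro card_mono) auto
  moreover have "inj_on (\<lambda>x. inv h \<otimes> x \<otimes> h) (generate W T')"
    using c h A.conjugate_eq_iff by (intro inj_onI) blast
  moreover have "inj_on (\<lambda>x. inv g \<otimes> x \<otimes> g) (generate W T)"
    using c g A.conjugate_eq_iff by (intro inj_onI) blast
  ultimately have "card (generate W T') \<le> card ((\<lambda>x. inv g \<otimes> x \<otimes> g) ` generate W T)"
    by (simp add: card_image)
  then have "(\<lambda>x. inv g \<otimes> x \<otimes> g) ` generate W T = generate W T'"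
    using g(3) T'S(2) by (intro card_seteq) auto
  then have "A.conjugate_sets (generate W T) (generate W T')"
    unfolding A.conjugate_sets_def using g(1) by blast
  then show ?thesis using g(2) by blast
qed

lemma maxsph_bijection:
  fixes W :: "('a, 'b) monoid_scheme" (structure)
  assumes "coxeter W S m" "coxeter W S' m'"
  obtains \<phi> where "bij_betw \<phi> {T. maximal_spherical W S T} {T. maximal_spherical W S' T}"
    "\<And>T. maximal_spherical W S T \<Longrightarrow> group.conjugate_sets W (generate W T) (generate W (\<phi> T))"
proof -
  interpret A: coxeter W S m by fact
  interpret B: coxeter W S' m' by fact
  obtain \<phi> where \<phi>: "\<And>T. A.maxsph T \<Longrightarrow> B.maxsph (\<phi> T)"
      "\<And>T. A.maxsph T \<Longrightarrow> A.conjugate_sets (generate W T) (generate W (\<phi> T))"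
    using maxsph_conjugate_exists[OF assms] by metis
  have c: "generate W T \<subseteq> carrier W" if "A.maxsph T" for T
    using A.generate_subset_carrier A.maxsphD that by blast
  have c': "generate W T \<subseteq> carrier W" if "B.maxsph T" for T
    using B.generate_subset_carrier B.maxsphD that by blast
  have "bij_betw \<phi> {T. A.maxsph T} {T. B.maxsph T}"
  proof (rule bij_betw_imageI)
    show "inj_on \<phi> {T. A.maxsph T}"
    proof (rule inj_onI)
      fix T U assume TU: "T \<in> {T. A.maxsph T}" "U \<in> {T. A.maxsph T}" "\<phi> T = \<phi> U"
      then have "A.conjugate_sets (generate W T) (generate W (\<phi> T))"
        "A.conjugate_sets (generate W U) (generate W (\<phi> T))" using \<phi>(2)[of T] \<phi>(2)[of U] by auto
      then show "T = U" using A.conjugate_maxsph_unique[of T U] TU c' \<phi>(1) by auto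
    qed
    show "\<phi> ` {T. A.maxsph T} = {T. B.maxsph T}"
    proof
      show "\<phi> ` {T. A.maxsph T} \<subseteq> {T. B.maxsph T}" using \<phi>(1) by auto
      show "{T. B.maxsph T} \<subseteq> \<phi> ` {T. A.maxsph T}"
      proof
        fix U assume "U \<in> {T. B.maxsph T}"
        then have U: "B.maxsph U" by simp
        then obtain T where T: "A.maxsph T" "A.conjugate_sets (generate W U) (generate W T)"
          using maxsph_conjugate_exists[OF assms(2,1)] by blast
        have "A.conjugate_sets (generate W (\<phi> T)) (generate W T)"
          by (rule A.conjugate_sets_sym[OF c[OF T(1)] \<phi>(2)[OF T(1)]])
        then have "U = \<phi> T" using B.conjugate_maxsph_unique[OF U \<phi>(1)[OF T(1)] c[OF T(1)] T(2)] by blast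
        then show "U \<in> \<phi> ` {T. A.maxsph T}" using T by blast
      qed
    qed
  qed
  with \<phi>(2) that show thesis by blast
qed

text \<open>Whether a character kills a subgroup depends only on the conjugacy class of the subgroup, so the
  counts of \<open>card_vanishing_characters\<close> agree for both generating sets, and \<open>label_bijection\<close>
  applies with the maximal spherical subsets that meet a component as its label.\<close>

lemma component_bijection:
  fixes W :: "('a, 'b) monoid_scheme" (structure)
  assumes "coxeter W S m" "coxeter W S' m'"
    and \<phi>: "bij_betw \<phi> {T. maximal_spherical W S T} {T. maximal_spherical W S' T}"
      "\<And>T. maximal_spherical W S T \<Longrightarrow> group.conjugate_sets W (generate W T) (generate W (\<phi> T))"
  obtains \<beta> where "bij_betw \<beta> (coxeter.components S m) (coxeter.components S' m')"
    "\<And>b T. b \<in> coxeter.components S m \<Longrightarrow> maximal_spherical W S T \<Longrightarrow>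
       \<beta> b \<inter> \<phi> T \<noteq> {} \<longleftrightarrow> b \<inter> T \<noteq> {}"
proof -
  interpret A: coxeter W S m by fact
  interpret B: coxeter W S' m' by fact
  let ?L = "\<lambda>b. {T. A.maxsph T \<and> b \<inter> T \<noteq> {}}"
  let ?L' = "\<lambda>b. {T. A.maxsph T \<and> b \<inter> \<phi> T \<noteq> {}}"
  have \<phi>1: "B.maxsph (\<phi> T)" if "A.maxsph T" for T using bij_betwE[OF \<phi>(1)] that by blast
  have count: "card {b \<in> A.components. ?L b \<inter> Q = {}} = card {b \<in> B.components. ?L' b \<inter> Q = {}}"
    if Q: "Q \<subseteq> {T. A.maxsph T}" for Q
  proof -
    have "card {\<chi> \<in> A.characters. \<forall>T\<in>Q. \<forall>x\<in>generate W T. \<not> \<chi> x} =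
        2 ^ card {b \<in> A.components. \<forall>T\<in>Q. b \<inter> T = {}}"
      using Q by (intro A.card_vanishing_characters) (auto dest: A.maxsphD)
    moreover have "card {\<chi> \<in> A.characters. \<forall>T\<in>\<phi> ` Q. \<forall>x\<in>generate W T. \<not> \<chi> x} =
        2 ^ card {b \<in> B.components. \<forall>T\<in>\<phi> ` Q. b \<inter> T = {}}"
      using Q \<phi>1 by (intro B.card_vanishing_characters) (auto dest: B.maxsphD)
    moreover have "{\<chi> \<in> A.characters. \<forall>T\<in>\<phi> ` Q. \<forall>x\<in>generate W T. \<not> \<chi> x} =
        {\<chi> \<in> A.characters. \<forall>T\<in>Q. \<forall>x\<in>generate W T. \<not> \<chi> x}"
    proof -
      have "(\<forall>x\<in>generate W (\<phi> T). \<not> \<chi> x) \<longleftrightarrow> (\<forall>x\<in>generate W T. \<not> \<chi> x)"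
        if "T \<in> Q" "\<chi> \<in> A.characters" for T \<chi>
      proof -
        have "A.maxsph T" using that Q by blast
        then show ?thesis
          using A.conjugate_sets_character[OF A.generate_subset_carrier \<phi>(2) that(2), of T] A.maxsphD by blast
      qed
      then show ?thesis by (auto simp del: split_paired_All)
    qed
    ultimately have "(2::nat) ^ card {b \<in> A.components. \<forall>T\<in>Q. b \<inter> T = {}} =
        2 ^ card {b \<in> B.components. \<forall>T\<in>\<phi> ` Q. b \<inter> T = {}}" by simp
    then have "card {b \<in> A.components. \<forall>T\<in>Q. b \<inter> T = {}} =
        card {b \<in> B.components. \<forall>T\<in>\<phi> ` Q. b \<inter> T = {}}" by simp
    moreover have "{b \<in> A.components. \<forall>T\<in>Q. b \<inter> T = {}} = {b \<in> A.components. ?L b \<inter> Q = {}}"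
      using Q by blast
    moreover have "{b \<in> B.components. \<forall>T\<in>\<phi> ` Q. b \<inter> T = {}} = {b \<in> B.components. ?L' b \<inter> Q = {}}"
      using Q by blast
    ultimately show ?thesis by simp
  qed
  obtain \<beta> where \<beta>: "bij_betw \<beta> A.components B.components" "\<And>b. b \<in> A.components \<Longrightarrow> ?L' (\<beta> b) = ?L b"
    by (rule label_bijection[OF A.finite_components B.finite_components A.finite_maxsph, of ?L ?L'])
       (use count in blast)+
  show thesis
  proof (rule that[OF \<beta>(1)])
    fix b T assume "b \<in> A.components" "A.maxsph T"
    with \<beta>(2)[of b] show "\<beta> b \<inter> \<phi> T \<noteq> {} \<longleftrightarrow> b \<inter> T \<noteq> {}" by blast
  qed
qed


section \<open>Odd edges with a leaf\<close>

locale matched_odd_coxeter = isolated_odd_coxeter +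
  assumes no_odd_path: "s \<in> S \<Longrightarrow> t \<in> S \<Longrightarrow> u \<in> S \<Longrightarrow> s \<noteq> t \<Longrightarrow> t \<noteq> u \<Longrightarrow> s \<noteq> u \<Longrightarrow>
      odd_enat (m s t) \<Longrightarrow> \<not> odd_enat (m t u)"
begin

lemma trancl_odd_rel: "odd_rel\<^sup>+ = odd_rel"
proof (rule trancl_id, rule transI)
  fix s t u assume "(s, t) \<in> odd_rel" "(t, u) \<in> odd_rel"
  then show "(s, u) \<in> odd_rel"
    using no_odd_path[of s t u] odd_rel_diag by (auto simp: odd_rel_def)
qed

lemma component_cases:
  assumes "b \<in> components"
  obtains s where "b = {s}" "s \<in> S"
  | s t where "s \<in> S" "t \<in> S" "s \<noteq> t" "odd_enat (m s t)" "b = {s, t}"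
proof -
  obtain s where s: "s \<in> S" "b = odd_rel `` {s}"
    using assms unfolding components_def trancl_odd_rel by (auto elim: quotientE)
  show thesis
  proof (cases "b = {s}")
    case True then show thesis using that(1) s by blast
  next
    case False
    then obtain t where t: "t \<noteq> s" "(s, t) \<in> odd_rel" using s odd_rel_diag by blast
    have "b = {s, t}"
    proof
      show "{s, t} \<subseteq> b" using s t odd_rel_diag by auto
      show "b \<subseteq> {s, t}"
      proof
        fix u assume "u \<in> b"
        then have "(s, u) \<in> odd_rel" using s by auto
        then show "u \<in> {s, t}" using t no_odd_path[of t s u] m_sym[of s t] by (auto simp: odd_rel_def)
      qed
    qed
    then show thesis using that(2)[of s t] t by (auto simp: odd_rel_def)
  qed
qed

text \<open>The maximal spherical subsets that are odd edges are at the same time components. This is what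
  makes \<open>\<phi>\<close> and \<open>\<beta>\<close> agree on odd edges.\<close>

lemma odd_component:
  assumes b: "b \<in> components" and T: "maxsph T" "\<not> boolean_exponent (generate W T)" "b \<inter> T \<noteq> {}"
  shows "b = T"
proof -
  obtain s t where st: "s \<in> S" "t \<in> S" "s \<noteq> t" "odd_enat (m s t)" "T = {s, t}"
    using maxsph_cases T by metis
  then have rel: "(s, t) \<in> odd_rel" "(t, s) \<in> odd_rel" using m_sym[of s t] by (auto simp: odd_rel_def)
  then have sub: "{s, t} \<subseteq> b" using components_odd_closed[OF b] T(3) st(5) by blast
  show ?thesis using b
  proof (cases b rule: component_cases)
    case (1 x) then show ?thesis using sub st by auto
  next
    case (2 x y) then show ?thesis using sub st by auto
  qed
qed

lemma pair_component:
  assumes "b \<in> components" "x \<in> b" "y \<in> b" "x \<noteq> y"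
  shows "b = {x, y}" "odd_enat (m x y)" "maxsph b" "\<not> boolean_exponent (generate W b)"
proof -
  obtain s t where st: "s \<in> S" "t \<in> S" "s \<noteq> t" "odd_enat (m s t)" "b = {s, t}"
    using assms by (cases b rule: component_cases) auto
  show "b = {x, y}" using st assms by auto
  show "odd_enat (m x y)" using st assms m_sym[of s t] by auto
  show "maxsph b" using odd_maximal st by blast
  show "\<not> boolean_exponent (generate W b)" using odd_pair_not_boolean st by blast
qed

lemma card_component: "b \<in> components \<Longrightarrow> card b = 1 \<or> card b = 2"
  by (cases b rule: component_cases) auto

end

locale leaf_odd_coxeter = matched_odd_coxeter +
  assumes at_most_two: "s \<in> S \<Longrightarrow> t \<in> S \<Longrightarrow> s \<noteq> t \<Longrightarrow> odd_enat (m s t) \<Longrightarrow>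
      card {T. maximal_spherical W S T \<and> T \<inter> {s, t} \<noteq> {}} \<le> 2"
begin

text \<open>The core of an odd edge is the end through which the edge is attached to the rest of the graph:
  every maximal spherical subset of commuting generators that meets the edge does so in the core
  only. A component with a single element is its own core.\<close>

definition is_core :: "'a set \<Rightarrow> 'a \<Rightarrow> bool" where
  "is_core b r \<longleftrightarrow> r \<in> b \<and>
     (\<forall>T. maxsph T \<and> boolean_exponent (generate W T) \<and> b \<inter> T \<noteq> {} \<longrightarrow> b \<inter> T = {r})"

text \<open>If both ends of an odd edge belonged to further maximal spherical subsets, these two and the edge
  itself would be three maximal spherical subsets that meet the edge.\<close>

lemma exists_core: assumes b: "b \<in> components" shows "\<exists>r. is_core b r"
  using b
proof (cases b rule: component_cases)
  case (1 s) then show ?thesis by (intro exI[of _ s]) (auto simp: is_core_def)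
next
  case (2 s t)
  have max: "maxsph {s, t}" and nb: "\<not> boolean_exponent (generate W {s, t})"
    using odd_maximal odd_pair_not_boolean 2 by auto
  have "\<exists>r\<in>{s, t}. \<forall>T. maxsph T \<and> T \<noteq> {s, t} \<and> {s, t} \<inter> T \<noteq> {} \<longrightarrow> {s, t} \<inter> T = {r}"
  proof (rule ccontr)
    assume no: "\<not> ?thesis"
    obtain T1 where T1: "maxsph T1" "T1 \<noteq> {s, t}" "{s, t} \<inter> T1 \<noteq> {}" "{s, t} \<inter> T1 \<noteq> {s}"
      using no by blast
    obtain T2 where T2: "maxsph T2" "T2 \<noteq> {s, t}" "{s, t} \<inter> T2 \<noteq> {}" "{s, t} \<inter> T2 \<noteq> {t}"
      using no by blast
    have proper: "\<not> {s, t} \<subseteq> T" if "maxsph T" "T \<noteq> {s, t}" for T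
      using max that by (auto simp: maximal_spherical_def)
    have "T1 \<noteq> T2" using T1 T2 proper[OF T1(1,2)] by auto
    then have "card {{s, t}, T1, T2} = 3" using T1 T2 by auto
    moreover have "{{s, t}, T1, T2} \<subseteq> {T. maxsph T \<and> T \<inter> {s, t} \<noteq> {}}"
      using T1 T2 max by auto
    moreover have "finite {T. maxsph T \<and> T \<inter> {s, t} \<noteq> {}}"
      using finite_maxsph by (rule rev_finite_subset) auto
    ultimately have "3 \<le> card {T. maxsph T \<and> T \<inter> {s, t} \<noteq> {}}" by (metis card_mono)
    then show False using at_most_two[of s t] 2 by simp
  qed
  then obtain r where "r \<in> b" "\<forall>T. maxsph T \<and> T \<noteq> b \<and> b \<inter> T \<noteq> {} \<longrightarrow> b \<inter> T = {r}"
    using 2 by auto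
  then show ?thesis using nb 2(5) unfolding is_core_def by blast
qed

text \<open>The labels between different components are expressed by incidences of components with maximal
  spherical subsets and by the position of the cores, all of which \<open>\<phi>\<close> and \<open>\<beta>\<close> preserve.\<close>

lemma label_between_components:
  assumes x: "b \<in> components" "x \<in> b" "is_core b r" and y: "c \<in> components" "y \<in> c" "is_core c r'"
    and ne: "b \<noteq> c"
  shows "m x y = (if x = r \<and> y = r' \<and>
      (\<exists>T. maxsph T \<and> boolean_exponent (generate W T) \<and> b \<inter> T \<noteq> {} \<and> c \<inter> T \<noteq> {}) then 2 else \<infinity>)"
proof -
  have S: "x \<in> S" "y \<in> S" using x y Union_components by auto
  have disj: "b \<inter> c = {}" using components_disjoint[OF x(1) y(1)] ne by blast
  have xy: "x \<noteq> y" using disj x y by auto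
  have not_odd: "\<not> odd_enat (m x y)"
  proof
    assume "odd_enat (m x y)"
    then have "y \<in> b" using components_odd_closed[OF x(1,2)] S by (auto simp: odd_rel_def)
    then show False using disj y by auto
  qed
  have iff: "m x y = 2 \<longleftrightarrow> (\<exists>T. maxsph T \<and> boolean_exponent (generate W T) \<and> x \<in> T \<and> y \<in> T)"
  proof
    assume "m x y = 2"
    then have "spherical W S {x, y}" using finite_label_spherical[OF S, of 2] by (simp add: numeral_eq_enat)
    then obtain T where T: "maxsph T" "{x, y} \<subseteq> T" by (rule spherical_extends)
    have "boolean_exponent (generate W T)"
    proof (rule ccontr)
      assume "\<not> boolean_exponent (generate W T)"
      then have "b = T" "c = T" using odd_component x y T by blast+
      then show False using ne by simp
    qed
    then show "\<exists>T. maxsph T \<and> boolean_exponent (generate W T) \<and> x \<in> T \<and> y \<in> T" using T by blast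
  next
    assume "\<exists>T. maxsph T \<and> boolean_exponent (generate W T) \<and> x \<in> T \<and> y \<in> T"
    then obtain T where T: "maxsph T" "x \<in> T" "y \<in> T" by blast
    obtain k where "m x y = enat k" using spherical_finite_label maxsphD T by metis
    then show "m x y = 2" using finite_label_cases[of x y k] S not_odd by blast
  qed
  have two_or_inf: "m x y = 2 \<or> m x y = \<infinity>"
    using finite_label_cases[of x y] S not_odd by (cases "m x y") auto
  have in_core: "x \<in> T \<longleftrightarrow> x = r \<and> b \<inter> T \<noteq> {}" "y \<in> T \<longleftrightarrow> y = r' \<and> c \<inter> T \<noteq> {}"
    if "maxsph T" "boolean_exponent (generate W T)" for T
    using that x y unfolding is_core_def by blast+
  have "(\<exists>T. maxsph T \<and> boolean_exponent (generate W T) \<and> x \<in> T \<and> y \<in> T) \<longleftrightarrow> x = r \<and> y = r' \<and>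
      (\<exists>T. maxsph T \<and> boolean_exponent (generate W T) \<and> b \<inter> T \<noteq> {} \<and> c \<inter> T \<noteq> {})"
    using in_core by metis
  then show ?thesis using iff two_or_inf by auto
qed

end

text \<open>Two odd edges of \<open>S'\<close> with a common vertex would lie in one component \<open>\<beta> b\<close>, and both would be the
  image under \<open>\<phi>\<close> of the same odd edge \<open>b\<close>. The maximal spherical subsets that meet an odd edge \<open>\<beta> b\<close>
  are the images of those that meet \<open>b\<close>, so there are at most two of them.\<close>

theorem leaf_odd_coxeter_transfer:
  fixes W :: "('a, 'b) monoid_scheme" (structure)
  assumes "leaf_odd_coxeter W S m" "coxeter W S' m'"
  shows "leaf_odd_coxeter W S' m'"
proof -
  interpret A: leaf_odd_coxeter W S m by fact
  interpret B: coxeter W S' m' by fact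
  have "isolated_odd_coxeter W S' m'"
    by (rule isolated_odd_coxeter_transfer[OF A.isolated_odd_coxeter_axioms assms(2)])
  then interpret B: isolated_odd_coxeter W S' m' .
  obtain \<phi> where \<phi>: "bij_betw \<phi> {T. A.maxsph T} {T. B.maxsph T}"
      "\<And>T. A.maxsph T \<Longrightarrow> A.conjugate_sets (generate W T) (generate W (\<phi> T))"
    using maxsph_bijection[OF A.coxeter_axioms assms(2)] by metis
  obtain \<beta> where \<beta>: "bij_betw \<beta> A.components B.components"
      "\<And>b T. b \<in> A.components \<Longrightarrow> A.maxsph T \<Longrightarrow> \<beta> b \<inter> \<phi> T \<noteq> {} \<longleftrightarrow> b \<inter> T \<noteq> {}"
    using component_bijection[OF A.coxeter_axioms assms(2) \<phi>] by metis
  have pre: "\<exists>T. A.maxsph T \<and> \<phi> T = {s, t} \<and> \<not> A.boolean_exponent (generate W T)"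
    if st: "s \<in> S'" "t \<in> S'" "s \<noteq> t" "odd_enat (m' s t)" for s t
  proof -
    have "{s, t} \<in> \<phi> ` {T. A.maxsph T}" using B.odd_maximal[OF st] bij_betw_imp_surj_on[OF \<phi>(1)] by simp
    then obtain T where T: "A.maxsph T" "{s, t} = \<phi> T" by blast
    moreover have "\<not> A.boolean_exponent (generate W (\<phi> T))"
      using B.odd_pair_not_boolean[OF st subset_refl] T by simp
    ultimately show ?thesis
      using A.conjugate_sets_boolean_exponent[OF A.generate_subset_carrier \<phi>(2)] A.maxsphD by metis
  qed
  have comp: "\<exists>b\<in>A.components. \<beta> b = c" if "c \<in> B.components" for c
  proof -
    have "c \<in> \<beta> ` A.components" using bij_betw_imp_surj_on[OF \<beta>(1)] that by simp
    then show ?thesis by blast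
  qed
  have matched: "\<not> odd_enat (m' t u)"
    if S: "s \<in> S'" "t \<in> S'" "u \<in> S'" and ne: "s \<noteq> t" "t \<noteq> u" "s \<noteq> u" and st: "odd_enat (m' s t)" for s t u
  proof
    assume tu: "odd_enat (m' t u)"
    obtain T1 where T1: "A.maxsph T1" "\<phi> T1 = {s, t}" "\<not> A.boolean_exponent (generate W T1)"
      using pre[OF S(1,2) ne(1) st] by blast
    obtain T2 where T2: "A.maxsph T2" "\<phi> T2 = {t, u}" "\<not> A.boolean_exponent (generate W T2)"
      using pre[OF S(2,3) ne(2) tu] by blast
    obtain c where c: "c \<in> B.components" "t \<in> c" using B.Union_components S by blast
    obtain b where b: "b \<in> A.components" "\<beta> b = c" using comp c by blast
    have "\<beta> b \<inter> \<phi> T1 \<noteq> {}" "\<beta> b \<inter> \<phi> T2 \<noteq> {}" unfolding b(2) T1(2) T2(2) using c by auto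
    then have "b \<inter> T1 \<noteq> {}" "b \<inter> T2 \<noteq> {}" using \<beta>(2)[OF b(1)] T1(1) T2(1) by simp_all
    then have "b = T1" "b = T2" using A.odd_component b T1 T2 by blast+
    then have "{s, t} = {t, u}" using T1 T2 by simp
    then show False using ne by auto
  qed
  interpret B: matched_odd_coxeter W S' m'
    by unfold_locales (rule matched)
  show ?thesis
  proof unfold_locales
    fix s t assume st: "s \<in> S'" "t \<in> S'" "s \<noteq> t" "odd_enat (m' s t)"
    obtain T where T: "A.maxsph T" "\<phi> T = {s, t}" "\<not> A.boolean_exponent (generate W T)"
      using pre[OF st] by blast
    have "(s, t) \<in> B.odd_rel" using st by (simp add: B.odd_rel_def)
    moreover obtain c where c: "c \<in> B.components" "s \<in> c" using B.Union_components st by blast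
    ultimately have "t \<in> c" using B.components_odd_closed by blast
    then have c_eq: "c = {s, t}" using B.pair_component(1)[OF c _ st(3)] by blast
    obtain b where b: "b \<in> A.components" "\<beta> b = c" using comp c by blast
    have "b \<inter> T \<noteq> {}" using \<beta>(2)[OF b(1) T(1)] T(2) b c by auto
    then have bT: "b = T" using A.odd_component b T by blast
    obtain x y where xy: "x \<in> S" "y \<in> S" "x \<noteq> y" "odd_enat (m x y)" "T = {x, y}"
      using A.maxsph_cases T by metis
    have "{U. B.maxsph U \<and> U \<inter> {s, t} \<noteq> {}} \<subseteq> \<phi> ` {U. A.maxsph U \<and> U \<inter> {x, y} \<noteq> {}}"
    proof
      fix U assume "U \<in> {U. B.maxsph U \<and> U \<inter> {s, t} \<noteq> {}}"
      then have U: "B.maxsph U" "U \<inter> {s, t} \<noteq> {}" by auto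
      then have "U \<in> \<phi> ` {T. A.maxsph T}" using bij_betw_imp_surj_on[OF \<phi>(1)] by simp
      then obtain V where V: "A.maxsph V" "U = \<phi> V" by blast
      have "\<beta> b \<inter> \<phi> V \<noteq> {}" using U V b c_eq by auto
      then have "b \<inter> V \<noteq> {}" using \<beta>(2)[OF b(1) V(1)] by simp
      then show "U \<in> \<phi> ` {U. A.maxsph U \<and> U \<inter> {x, y} \<noteq> {}}" using V bT xy by auto
    qed
    moreover have fin: "finite {U. A.maxsph U \<and> U \<inter> {x, y} \<noteq> {}}"
      using A.finite_maxsph by (rule rev_finite_subset) auto
    ultimately have "card {U. B.maxsph U \<and> U \<inter> {s, t} \<noteq> {}} \<le> card {U. A.maxsph U \<and> U \<inter> {x, y} \<noteq> {}}"
      by (rule surj_card_le[rotated])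
    then show "card {U. B.maxsph U \<and> U \<inter> {s, t} \<noteq> {}} \<le> 2" using A.at_most_two[OF xy(1-4)] by simp
  qed
qed

lemma pointed_bijection:
  assumes "finite A" "finite B" "card A = card B" "a \<in> A" "b \<in> B"
  obtains h where "bij_betw h A B" "h a = b"
proof -
  have "card (A - {a}) = card (B - {b})" using assms by simp
  then obtain g where g: "bij_betw g (A - {a}) (B - {b})"
    using finite_same_card_bij[of "A - {a}" "B - {b}"] assms by auto
  have "bij_betw (g(a := b)) (A - {a}) (B - {b})"
    using g by (subst bij_betw_cong[of _ _ g]) auto
  then have "bij_betw (g(a := b)) (A - {a} \<union> {a}) (B - {b} \<union> {b})"
    using notIn_Un_bij_betw[of a "A - {a}" "g(a := b)" "B - {b}"] by simp
  moreover have "A - {a} \<union> {a} = A" "B - {b} \<union> {b} = B" using assms by auto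
  ultimately show thesis using that[of "g(a := b)"] by simp
qed

text \<open>The bijection \<open>\<psi>\<close> maps each component \<open>b\<close> to \<open>\<beta> b\<close> and its core to the core of \<open>\<beta> b\<close>. The label of
  an odd edge is recovered from its dihedral group: it is a multiple of the order of any product of
  two involutions in that group. The remaining labels are governed by \<open>label_between_components\<close>.\<close>

theorem leaf_odd_coxeter_isomorphic:
  fixes W :: "('a, 'b) monoid_scheme" (structure)
  assumes "leaf_odd_coxeter W S m" "coxeter W S' m'"
  shows "\<exists>\<psi>. bij_betw \<psi> S S' \<and> (\<forall>s\<in>S. \<forall>t\<in>S. m s t = m' (\<psi> s) (\<psi> t))"
proof -
  interpret A: leaf_odd_coxeter W S m by fact
  have "leaf_odd_coxeter W S' m'" by (rule leaf_odd_coxeter_transfer[OF assms])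
  then interpret B: leaf_odd_coxeter W S' m' .
  obtain \<phi> where \<phi>: "bij_betw \<phi> {T. A.maxsph T} {T. B.maxsph T}"
      "\<And>T. A.maxsph T \<Longrightarrow> A.conjugate_sets (generate W T) (generate W (\<phi> T))"
    using maxsph_bijection[OF A.coxeter_axioms B.coxeter_axioms] by metis
  obtain \<beta> where \<beta>: "bij_betw \<beta> A.components B.components"
      "\<And>b T. b \<in> A.components \<Longrightarrow> A.maxsph T \<Longrightarrow> \<beta> b \<inter> \<phi> T \<noteq> {} \<longleftrightarrow> b \<inter> T \<noteq> {}"
    using component_bijection[OF A.coxeter_axioms B.coxeter_axioms \<phi>] by metis
  have \<beta>_in: "\<beta> b \<in> B.components" if "b \<in> A.components" for b
    using bij_betwE[OF \<beta>(1)] that by blast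
  have \<phi>_max: "B.maxsph (\<phi> T)" if "A.maxsph T" for T using bij_betwE[OF \<phi>(1)] that by blast
  have \<phi>_surj: "\<exists>T. A.maxsph T \<and> \<phi> T = U" if "B.maxsph U" for U
  proof -
    have "U \<in> \<phi> ` {T. A.maxsph T}" using bij_betw_imp_surj_on[OF \<phi>(1)] that by simp
    then show ?thesis by blast
  qed
  have \<phi>_bool: "A.boolean_exponent (generate W (\<phi> T)) \<longleftrightarrow> A.boolean_exponent (generate W T)"
    if "A.maxsph T" for T
    using A.conjugate_sets_boolean_exponent[OF A.generate_subset_carrier \<phi>(2)[OF that]] A.maxsphD(1)[OF that]
    by blast
  have \<phi>_odd: "\<beta> b = \<phi> b" if b: "b \<in> A.components" "A.maxsph b" "\<not> A.boolean_exponent (generate W b)" for b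
    using B.odd_component[OF \<beta>_in[OF b(1)] \<phi>_max[OF b(2)]] \<phi>_bool[OF b(2)] \<beta>(2)[OF b(1,2)]
      A.components_nonempty[OF b(1)] b(3) by simp
  have card_le: "card (\<beta> b) = 2" if b: "b \<in> A.components" "card b = 2" for b
  proof -
    obtain x y where xy: "b = {x, y}" "x \<noteq> y" using b(2) by (auto simp: card_2_iff)
    then have p: "A.maxsph b" "\<not> A.boolean_exponent (generate W b)"
      using A.pair_component(3,4)[OF b(1), of x y] by auto
    then have "B.maxsph (\<beta> b)" "\<not> A.boolean_exponent (generate W (\<beta> b))"
      using \<phi>_odd[OF b(1)] \<phi>_bool \<phi>_max by auto
    then show ?thesis by (metis B.maxsph_cases card_2_iff)
  qed
  have card_ge: "card b = 2" if b: "b \<in> A.components" "card (\<beta> b) = 2" for b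
  proof -
    obtain x y where xy: "\<beta> b = {x, y}" "x \<noteq> y" using b(2) by (auto simp: card_2_iff)
    then have p: "B.maxsph (\<beta> b)" "\<not> A.boolean_exponent (generate W (\<beta> b))"
      using B.pair_component(3,4)[OF \<beta>_in[OF b(1)], of x y] by auto
    obtain T where T: "A.maxsph T" "\<phi> T = \<beta> b" using \<phi>_surj[OF p(1)] by blast
    have nb: "\<not> A.boolean_exponent (generate W T)" using p T \<phi>_bool by metis
    have "b \<inter> T \<noteq> {}" using \<beta>(2)[OF b(1) T(1)] T(2) xy by auto
    then have "b = T" using A.odd_component[OF b(1) T(1) nb] by blast
    then show ?thesis using T(1) nb by (metis A.maxsph_cases card_2_iff)
  qed
  have card_eq: "card b = card (\<beta> b)" if b: "b \<in> A.components" for b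
    using A.card_component[OF b] B.card_component[OF \<beta>_in[OF b]] card_le[OF b] card_ge[OF b] by linarith
  obtain r where r: "\<And>b. b \<in> A.components \<Longrightarrow> A.is_core b (r b)" using A.exists_core by metis
  obtain r' where r': "\<And>b. b \<in> B.components \<Longrightarrow> B.is_core b (r' b)" using B.exists_core by metis
  have "\<exists>h. bij_betw h b (\<beta> b) \<and> h (r b) = r' (\<beta> b)" if b: "b \<in> A.components" for b
  proof -
    have "finite b" "finite (\<beta> b)"
      using A.finite_component[OF b] B.finite_component[OF \<beta>_in[OF b]] by auto
    then show ?thesis
      using pointed_bijection[of b "\<beta> b" "r b" "r' (\<beta> b)"] card_eq[OF b] r[OF b] r'[OF \<beta>_in[OF b]]
      unfolding A.is_core_def B.is_core_def by metis
  qed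
  then obtain h where h: "\<And>b. b \<in> A.components \<Longrightarrow> bij_betw (h b) b (\<beta> b)"
      "\<And>b. b \<in> A.components \<Longrightarrow> h b (r b) = r' (\<beta> b)" by metis
  have "\<exists>b. b \<in> A.components \<and> s \<in> b" if "s \<in> S" for s using A.Union_components that by blast
  then obtain \<kappa> where \<kappa>: "\<And>s. s \<in> S \<Longrightarrow> \<kappa> s \<in> A.components" "\<And>s. s \<in> S \<Longrightarrow> s \<in> \<kappa> s" by metis
  have \<kappa>_eq: "\<kappa> s = b" if "b \<in> A.components" "s \<in> b" for s b
  proof -
    have "s \<in> S" using that A.Union_components by blast
    then show ?thesis using A.components_disjoint[OF \<kappa>(1) that(1)] \<kappa>(2) that(2) by blast
  qed
  define \<psi> where "\<psi> s = h (\<kappa> s) s" for s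
  have \<psi>_in: "\<psi> s \<in> \<beta> (\<kappa> s)" if "s \<in> S" for s
    using bij_betwE[OF h(1)[OF \<kappa>(1)[OF that]]] \<kappa>(2)[OF that] by (simp add: \<psi>_def)
  have \<psi>_core: "\<psi> s = r' (\<beta> (\<kappa> s)) \<longleftrightarrow> s = r (\<kappa> s)" if s: "s \<in> S" for s
  proof -
    have "r (\<kappa> s) \<in> \<kappa> s" using r[OF \<kappa>(1)[OF s]] by (simp add: A.is_core_def)
    then show ?thesis
      using h(2)[OF \<kappa>(1)[OF s]] bij_betw_imp_inj_on[OF h(1)[OF \<kappa>(1)[OF s]]] \<kappa>(2)[OF s]
      unfolding \<psi>_def by (metis inj_onD)
  qed
  have \<psi>_inj: "inj_on \<psi> S"
  proof (rule inj_onI)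
    fix s t assume st: "s \<in> S" "t \<in> S" "\<psi> s = \<psi> t"
    have "\<beta> (\<kappa> s) = \<beta> (\<kappa> t)"
      using B.components_disjoint[OF \<beta>_in[OF \<kappa>(1)[OF st(1)]] \<beta>_in[OF \<kappa>(1)[OF st(2)]]]
        \<psi>_in[OF st(1)] \<psi>_in[OF st(2)] st(3) by auto
    then have k: "\<kappa> s = \<kappa> t" using bij_betw_imp_inj_on[OF \<beta>(1)] \<kappa>(1) st by (meson inj_onD)
    then have "h (\<kappa> s) s = h (\<kappa> s) t" using st(3) by (simp add: \<psi>_def)
    then show "s = t"
      using bij_betw_imp_inj_on[OF h(1)[OF \<kappa>(1)[OF st(1)]]] \<kappa>(2)[OF st(1)] \<kappa>(2)[OF st(2)] k
      by (metis inj_onD)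
  qed
  have "bij_betw \<psi> S S'"
  proof (rule bij_betw_imageI[OF \<psi>_inj], rule subset_antisym)
    show "\<psi> ` S \<subseteq> S'" using \<psi>_in \<beta>_in \<kappa>(1) B.Union_components by blast
    show "S' \<subseteq> \<psi> ` S"
    proof
      fix y assume "y \<in> S'"
      then obtain c where c: "c \<in> B.components" "y \<in> c" using B.Union_components by blast
      then obtain b where b: "b \<in> A.components" "c = \<beta> b" using bij_betw_imp_surj_on[OF \<beta>(1)] by blast
      then have "y \<in> h b ` b" using bij_betw_imp_surj_on[OF h(1)[OF b(1)]] c by simp
      then obtain x where x: "x \<in> b" "y = h b x" by blast
      then have "y = \<psi> x" using \<kappa>_eq[OF b(1) x(1)] by (simp add: \<psi>_def)
      moreover have "x \<in> S" using x b A.Union_components by blast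
      ultimately show "y \<in> \<psi> ` S" by blast
    qed
  qed
  moreover have "m s t = m' (\<psi> s) (\<psi> t)" if st: "s \<in> S" "t \<in> S" for s t
  proof -
    have S': "\<psi> s \<in> S'" "\<psi> t \<in> S'" using \<open>bij_betw \<psi> S S'\<close> st bij_betwE by blast+
    let ?b = "\<kappa> s" and ?c = "\<kappa> t"
    note b = \<kappa>(1)[OF st(1)] and c = \<kappa>(1)[OF st(2)]
    consider (eq) "s = t" | (pair) "s \<noteq> t" "?b = ?c" | (far) "?b \<noteq> ?c" by blast
    then show ?thesis
    proof cases
      case eq then show ?thesis using st S' A.m_diag B.m_diag by simp
    next
      case pair
      have b1: "?b = {s, t}" "odd_enat (m s t)" "A.maxsph ?b" "\<not> A.boolean_exponent (generate W ?b)"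
        using A.pair_component[OF b \<kappa>(2)[OF st(1)] _ pair(1)] \<kappa>(2)[OF st(2)] pair(2) by auto
      have ne: "\<psi> s \<noteq> \<psi> t" using \<psi>_inj st pair(1) by (meson inj_onD)
      have b2: "\<beta> ?b = {\<psi> s, \<psi> t}" "odd_enat (m' (\<psi> s) (\<psi> t))"
        using B.pair_component(1,2)[OF \<beta>_in[OF b] \<psi>_in[OF st(1)] _ ne] \<psi>_in[OF st(2)] pair(2) by auto
      obtain k l where k: "m s t = enat k" "odd k" and l: "m' (\<psi> s) (\<psi> t) = enat l" "odd l"
        using b1(2) b2(2) by (auto simp: odd_enat_def)
      have conj: "A.conjugate_sets (generate W {s, t}) (generate W {\<psi> s, \<psi> t})"
        using \<phi>(2)[OF b1(3)] \<phi>_odd[OF b b1(3,4)] b1(1) b2(1) by simp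
      then have conj': "A.conjugate_sets (generate W {\<psi> s, \<psi> t}) (generate W {s, t})"
        by (rule A.conjugate_sets_sym[OF A.generate_subset_carrier, rotated]) (use st in simp)
      have g: "x \<in> generate W {x, y}" "y \<in> generate W {x, y}" for x y by (auto intro: generate.incl)
      have "(\<psi> s \<otimes> \<psi> t) [^] k = \<one>"
        using S' by (intro A.odd_conjugate_label_dvd[OF st k conj]) (auto simp: g B.generator_ne_one B.generator_square)
      then have "l dvd k" by (rule B.label_dvd[OF S' l(1)])
      moreover have "(s \<otimes> t) [^] l = \<one>"
        using st by (intro B.odd_conjugate_label_dvd[OF S' l conj']) (auto simp: g A.generator_ne_one A.generator_square)
      then have "k dvd l" by (rule A.label_dvd[OF st k(1)])
      ultimately show ?thesis using k l by (simp add: dvd_antisym)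
    next
      case far
      have ne: "\<beta> ?b \<noteq> \<beta> ?c" using far bij_betw_imp_inj_on[OF \<beta>(1)] b c by (meson inj_onD)
      have "(\<exists>U. B.maxsph U \<and> A.boolean_exponent (generate W U) \<and> \<beta> ?b \<inter> U \<noteq> {} \<and> \<beta> ?c \<inter> U \<noteq> {}) \<longleftrightarrow>
          (\<exists>T. A.maxsph T \<and> A.boolean_exponent (generate W T) \<and> ?b \<inter> T \<noteq> {} \<and> ?c \<inter> T \<noteq> {})"
      proof
        assume "\<exists>U. B.maxsph U \<and> A.boolean_exponent (generate W U) \<and> \<beta> ?b \<inter> U \<noteq> {} \<and> \<beta> ?c \<inter> U \<noteq> {}"
        then obtain U where U: "B.maxsph U" "A.boolean_exponent (generate W U)"
          "\<beta> ?b \<inter> U \<noteq> {}" "\<beta> ?c \<inter> U \<noteq> {}" by blast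
        obtain T where T: "A.maxsph T" "\<phi> T = U" using \<phi>_surj[OF U(1)] by blast
        then have "A.boolean_exponent (generate W T)" "?b \<inter> T \<noteq> {}" "?c \<inter> T \<noteq> {}"
          using U(2-4) \<phi>_bool[OF T(1)] \<beta>(2)[OF b T(1)] \<beta>(2)[OF c T(1)] by simp_all
        then show "\<exists>T. A.maxsph T \<and> A.boolean_exponent (generate W T) \<and> ?b \<inter> T \<noteq> {} \<and> ?c \<inter> T \<noteq> {}"
          using T(1) by blast
      next
        assume "\<exists>T. A.maxsph T \<and> A.boolean_exponent (generate W T) \<and> ?b \<inter> T \<noteq> {} \<and> ?c \<inter> T \<noteq> {}"
        then obtain T where T: "A.maxsph T" "A.boolean_exponent (generate W T)"
          "?b \<inter> T \<noteq> {}" "?c \<inter> T \<noteq> {}" by blast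
        then have "A.boolean_exponent (generate W (\<phi> T))" "\<beta> ?b \<inter> \<phi> T \<noteq> {}" "\<beta> ?c \<inter> \<phi> T \<noteq> {}"
          using \<phi>_bool[OF T(1)] \<beta>(2)[OF b T(1)] \<beta>(2)[OF c T(1)] by simp_all
        then show "\<exists>U. B.maxsph U \<and> A.boolean_exponent (generate W U) \<and> \<beta> ?b \<inter> U \<noteq> {} \<and> \<beta> ?c \<inter> U \<noteq> {}"
          using \<phi>_max[OF T(1)] by blast
      qed
      then show ?thesis
        using A.label_between_components[OF b \<kappa>(2)[OF st(1)] r[OF b] c \<kappa>(2)[OF st(2)] r[OF c] far]
          B.label_between_components[OF \<beta>_in[OF b] \<psi>_in[OF st(1)] r'[OF \<beta>_in[OF b]]
            \<beta>_in[OF c] \<psi>_in[OF st(2)] r'[OF \<beta>_in[OF c]] ne]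
          \<psi>_core[OF st(1)] \<psi>_core[OF st(2)] by simp
    qed
  qed
  ultimately show ?thesis by blast
qed

lemma coxeter_system_imp_coxeter:
  assumes "coxeter_system W S" shows "coxeter W S (cox_order W)"
proof -
  obtain m where m: "finite S" "coxeter_matrix S m" "has_presentation W S (coxeter_relators S m)"
    using assms by (auto simp: coxeter_system_def)
  then have "group W" by (simp add: has_presentation_def)
  then interpret A: coxeter W S m using m by (simp add: coxeter_def coxeter_axioms_def)
  have eq: "cox_order W s t = m s t" if "s \<in> S" "t \<in> S" for s t using A.cox_order_eq that .
  then have "coxeter_relators S (cox_order W) = coxeter_relators S m"
    unfolding coxeter_relators_def by (intro Collect_cong ex_cong1) auto
  moreover have "coxeter_matrix S (cox_order W)" using m(2) eq by (simp add: coxeter_matrix_def)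
  ultimately show ?thesis using m \<open>group W\<close> by (simp add: coxeter_def coxeter_axioms_def)
qed

theorem theorem1p2:
  fixes W :: "('a, 'b) monoid_scheme" and S :: "'a set"
  assumes cox: "coxeter_system W S"
    and even2: "\<forall>s\<in>S. \<forall>t\<in>S. even_enat (cox_order W s t) \<longrightarrow> cox_order W s t = 2"
    and odd_max: "\<forall>s\<in>S. \<forall>t\<in>S. s \<noteq> t \<and> odd_enat (cox_order W s t) \<longrightarrow>
                    maximal_spherical W S {s, t}"
    and no_adjacent_odd: "\<not> (\<exists>s\<in>S. \<exists>t\<in>S. \<exists>u\<in>S. card {s, t, u} = 3 \<and>
                    odd_enat (cox_order W s t) \<and> odd_enat (cox_order W t u))"
    and at_most_two: "\<forall>s\<in>S. \<forall>t\<in>S. s \<noteq> t \<and> odd_enat (cox_order W s t) \<longrightarrow>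
                    card {T. maximal_spherical W S T \<and> T \<inter> {s, t} \<noteq> {}} \<le> 2"
  shows "rigid W"
proof -
  interpret coxeter W S "cox_order W" by (rule coxeter_system_imp_coxeter[OF cox])
  interpret leaf_odd_coxeter W S "cox_order W"
  proof unfold_locales
    fix s t u assume S: "s \<in> S" "t \<in> S" "u \<in> S" and ne: "s \<noteq> t" "t \<noteq> u" "s \<noteq> u"
      and odd: "odd_enat (cox_order W s t)"
    have "card {s, t, u} = 3" using ne by simp
    then show "\<not> odd_enat (cox_order W t u)" using no_adjacent_odd S odd by blast
  qed (use even2 odd_max at_most_two in blast)+
  have iso: "\<exists>\<psi>. bij_betw \<psi> S S' \<and> (\<forall>s\<in>S. \<forall>t\<in>S. cox_order W s t = cox_order W (\<psi> s) (\<psi> t))"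
    if "coxeter_system W S'" for S'
    by (rule leaf_odd_coxeter_isomorphic[OF leaf_odd_coxeter_axioms coxeter_system_imp_coxeter[OF that]])
  show ?thesis
    unfolding rigid_def coxeter_systems_isomorphic_def
  proof (intro allI impI, elim conjE)
    fix S1 S2 assume "coxeter_system W S1" "coxeter_system W S2"
    then obtain f g where f: "bij_betw f S S1" "\<forall>s\<in>S. \<forall>t\<in>S. cox_order W s t = cox_order W (f s) (f t)"
      and g: "bij_betw g S S2" "\<forall>s\<in>S. \<forall>t\<in>S. cox_order W s t = cox_order W (g s) (g t)"
      using iso by metis
    let ?i = "inv_into S f"
    have i: "bij_betw ?i S1 S" by (rule bij_betw_inv_into[OF f(1)])
    have "bij_betw (g \<circ> ?i) S1 S2" using i g(1) by (rule bij_betw_trans)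
    moreover have "cox_order W s t = cox_order W ((g \<circ> ?i) s) ((g \<circ> ?i) t)" if "s \<in> S1" "t \<in> S1" for s t
    proof -
      have "?i s \<in> S" "?i t \<in> S" using bij_betwE[OF i] that by auto
      moreover have "f (?i s) = s" "f (?i t) = t" using bij_betw_inv_into_right[OF f(1)] that by auto
      ultimately show ?thesis using f(2) g(2) by (metis comp_apply)
    qed
    ultimately show "\<exists>\<psi>. bij_betw \<psi> S1 S2 \<and> (\<forall>s\<in>S1. \<forall>t\<in>S1. cox_order W s t = cox_order W (\<psi> s) (\<psi> t))"
      by blast
  qed
qed

end
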